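(* Let $K$ be an interface element. The space $V^n_h(K)$ has the nodal degrees of freedom $\{v_h(\mathbf{z}):\ \mathbf{z}\in\mathcal{N}_K\}$; that is, every assignment of nodal values on $\mathcal{N}_K$ determines exactly one function $v_h\in V^n_h(K)$.
   Context: $\Omega\subseteq\mathbb{R}^3$ is an open bounded domain, $\Omega^-\subseteq\Omega$ a subdomain, $\Omega^+=\Omega\setminus\overline{\Omega^-}$, and $\Gamma=\partial\Omega^-$ is a sufficiently smooth interface. $\beta$ is piecewise constant with positive values $\beta^\pm$ on $\Omega^\pm$. $\mathcal{T}_h$ is a shape-regular tetrahedral mesh of $\Omega$ generated independently of the interface; an (open) element $K\in\mathcal{T}_h$ is an interface element if it meets $\Gamma$. Boundary triangulation assumption: each face of an interface element $K$ is triangulated, with the maximum angle condition, using only the vertices of $K$ and the points where $\Gamma$ cuts the edges of $K$ as vertices; if a face is cut by $\Gamma$, the curve (face $\cap\,\Gamma$) is approximated by an edge of this triangulation with error $\mathcal{O}(h_K^2)$. $\mathcal{N}_K$ and $\mathcal{F}_K$ denote the sets of nodes and triangles of the resulting triangulation of $\partial K$. With $\mathcal{P}_1(T)$ the linear polynomials on $T$, set $\mathcal{B}^n_h(\partial K)=\{v_h\in C(\partial K):\ v_h|_T\in\mathcal{P}_1(T)\ \forall T\in\mathcal{F}_K\}$ and $$V^n_h(K)=\{v_h\in H^1(K):\ \beta\nabla v_h\in\mathbf{H}(\mathrm{div};K),\ \nabla\cdot(\beta\nabla v_h)=0,\ v_h|_{\partial K}\in\mathcal{B}^n_h(\partial K)\}.$$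 *)

theory Defs
  imports "HOL-Analysis.Analysis"
begin

type_synonym R3 = "real^3"

section \<open>Classically differentiable functions\<close>

definition grad :: "(R3 \<Rightarrow> real) \<Rightarrow> R3 \<Rightarrow> R3" where
  "grad f x = (\<chi> i. frechet_derivative f (at x) (axis i 1))"

text \<open>\<open>Ck_on k U f\<close> is meant for open \<open>U\<close>.\<close>

primrec Ck_on :: "nat \<Rightarrow> R3 set \<Rightarrow> (R3 \<Rightarrow> real) \<Rightarrow> bool" where
  "Ck_on 0 U f \<longleftrightarrow> continuous_on U f"
| "Ck_on (Suc k) U f \<longleftrightarrow>
     (\<forall>x\<in>U. f differentiable (at x)) \<and> (\<forall>i. Ck_on k U (\<lambda>x. grad f x $ i))"

definition smooth :: "(R3 \<Rightarrow> real) \<Rightarrow> bool" where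
  "smooth f \<longleftrightarrow> (\<forall>k. Ck_on k UNIV f)"

definition test_function :: "R3 set \<Rightarrow> (R3 \<Rightarrow> real) \<Rightarrow> bool" where
  "test_function K \<phi> \<longleftrightarrow> smooth \<phi> \<and>
     compact (closure {x. \<phi> x \<noteq> 0}) \<and> closure {x. \<phi> x \<noteq> 0} \<subseteq> K"

definition Ck_surface :: "nat \<Rightarrow> R3 set \<Rightarrow> bool" where
  "Ck_surface k S \<longleftrightarrow>
     (\<forall>p\<in>S. \<exists>U \<phi>. open U \<and> p \<in> U \<and> Ck_on k U \<phi> \<and> (\<forall>x\<in>U. grad \<phi> x \<noteq> 0) \<and>
        S \<inter> U = {x \<in> U. \<phi> x = 0})"

section \<open>Sobolev spaces\<close>

text \<open>Elements of the function spaces below are represented by functions defined on all of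
  space; only their values on \<open>K\<close> matter, and equality in \<open>H\<^sup>1(K)\<close> is equality almost everywhere
  on \<open>K\<close>.\<close>

definition L2 :: "'a measure \<Rightarrow> ('a \<Rightarrow> 'b::euclidean_space) \<Rightarrow> bool" where
  "L2 M f \<longleftrightarrow> f \<in> borel_measurable M \<and> integrable M (\<lambda>x. (norm (f x))\<^sup>2)"

definition L2_tendsto ::
    "'a measure \<Rightarrow> (nat \<Rightarrow> 'a \<Rightarrow> 'b::euclidean_space) \<Rightarrow> ('a \<Rightarrow> 'b) \<Rightarrow> bool" where
  "L2_tendsto M f g \<longleftrightarrow> (\<forall>n. L2 M (f n)) \<and> L2 M g \<and>
     (\<lambda>n. \<integral>x. (norm (f n x - g x))\<^sup>2 \<partial>M) \<longlonglongrightarrow> 0"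

definition weak_grad :: "R3 set \<Rightarrow> (R3 \<Rightarrow> real) \<Rightarrow> (R3 \<Rightarrow> R3) \<Rightarrow> bool" where
  "weak_grad K v G \<longleftrightarrow> L2 (lebesgue_on K) v \<and> L2 (lebesgue_on K) G \<and>
     (\<forall>\<phi>. test_function K \<phi> \<longrightarrow>
        (\<forall>i. (\<integral>x. v x * grad \<phi> x $ i \<partial>lebesgue_on K) = - (\<integral>x. G x $ i * \<phi> x \<partial>lebesgue_on K)))"

definition H1 :: "R3 set \<Rightarrow> (R3 \<Rightarrow> real) set" where
  "H1 K = {v. \<exists>G. weak_grad K v G}"

definition weak_div :: "R3 set \<Rightarrow> (R3 \<Rightarrow> R3) \<Rightarrow> (R3 \<Rightarrow> real) \<Rightarrow> bool" where
  "weak_div K q d \<longleftrightarrow> L2 (lebesgue_on K) q \<and> L2 (lebesgue_on K) d \<and>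
     (\<forall>\<phi>. test_function K \<phi> \<longrightarrow>
        (\<integral>x. q x \<bullet> grad \<phi> x \<partial>lebesgue_on K) = - (\<integral>x. d x * \<phi> x \<partial>lebesgue_on K))"

definition Hdiv :: "R3 set \<Rightarrow> (R3 \<Rightarrow> R3) set" where
  "Hdiv K = {q. \<exists>d. weak_div K q d}"

section \<open>Traces on the boundary of a tetrahedron\<close>

text \<open>Surface measure on the triangle \<open>abc\<close>: the image of Lebesgue measure on the unit triangle
  under the affine parametrization, scaled by its Jacobian \<open>\<bar>(b - a) \<times> (c - a)\<bar>\<close>. It does not depend
  on the order of the vertices.\<close>

definition triangle_measure :: "R3 \<Rightarrow> R3 \<Rightarrow> R3 \<Rightarrow> R3 measure" where
  "triangle_measure a b c =
     scale_measure (ennreal (norm (cross3 (b - a) (c - a))))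
       (distr (restrict_space lborel {(s, t). 0 \<le> s \<and> 0 \<le> t \<and> s + t \<le> (1::real)})
          (restrict_space borel (convex hull {a, b, c}))
          (\<lambda>(s, t). a + s *\<^sub>R (b - a) + t *\<^sub>R (c - a)))"

text \<open>The trace operator is the continuous extension of \<open>u \<mapsto> u|\<^bsub>\<partial>K\<^esub>\<close> from \<open>C\<^sup>\<infinity>(closure K)\<close> to
  \<open>H\<^sup>1(K)\<close>, with values in \<open>L\<^sup>2(\<partial>K)\<close>. Here \<open>K\<close> is an open tetrahedron, so convergence in
  \<open>L\<^sup>2(\<partial>K)\<close> is convergence on each of its triangular faces.\<close>

definition has_trace :: "R3 set \<Rightarrow> (R3 \<Rightarrow> real) \<Rightarrow> (R3 \<Rightarrow> real) \<Rightarrow> bool" where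
  "has_trace K v g \<longleftrightarrow>
     (\<exists>u G. weak_grad K v G \<and> (\<forall>n. smooth (u n)) \<and>
        L2_tendsto (lebesgue_on K) u v \<and>
        L2_tendsto (lebesgue_on K) (\<lambda>n. grad (u n)) G \<and>
        (\<forall>a b c. (convex hull {a, b, c}) facet_of closure K \<longrightarrow>
           L2_tendsto (triangle_measure a b c) u g))"

text \<open>Value at a boundary point of the continuous representative of the trace.\<close>

definition boundary_value :: "R3 set \<Rightarrow> (R3 \<Rightarrow> real) \<Rightarrow> R3 \<Rightarrow> real" where
  "boundary_value K v z =
     (THE y. \<exists>g. continuous_on (frontier K) g \<and> has_trace K v g \<and> g z = y)"

section \<open>Mesh and boundary triangulation\<close>

text \<open>The elements of a mesh are the open tetrahedra.\<close>

definition tetrahedral_mesh :: "R3 set \<Rightarrow> R3 set set \<Rightarrow> bool" where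
  "tetrahedral_mesh \<Omega> \<T> \<longleftrightarrow>
     triangulation (closure ` \<T>) \<and>
     (\<forall>K\<in>\<T>. 3 simplex (closure K) \<and> K = interior (closure K) \<and> K \<subseteq> \<Omega>) \<and>
     (\<Union>K\<in>\<T>. closure K) = closure \<Omega>"

definition inradius :: "R3 set \<Rightarrow> real" where
  "inradius K = Sup {r. \<exists>x. ball x r \<subseteq> K}"

definition shape_regular :: "real \<Rightarrow> R3 set set \<Rightarrow> bool" where
  "shape_regular \<sigma> \<T> \<longleftrightarrow> (\<forall>K\<in>\<T>. diameter K \<le> \<sigma> * inradius K)"

definition angle_at :: "R3 \<Rightarrow> R3 \<Rightarrow> R3 \<Rightarrow> real" where
  "angle_at a b c = arccos (((b - a) \<bullet> (c - a)) / (norm (b - a) * norm (c - a)))"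

definition max_angle_condition :: "real \<Rightarrow> R3 set set \<Rightarrow> bool" where
  "max_angle_condition \<theta> \<F> \<longleftrightarrow>
     (\<forall>T\<in>\<F>. \<forall>a b c. T = convex hull {a, b, c} \<longrightarrow> angle_at a b c \<le> \<theta>)"

definition hausdorff_within :: "R3 set \<Rightarrow> R3 set \<Rightarrow> real \<Rightarrow> bool" where
  "hausdorff_within A B \<epsilon> \<longleftrightarrow>
     (\<forall>x\<in>A. \<exists>y\<in>B. dist x y \<le> \<epsilon>) \<and> (\<forall>y\<in>B. \<exists>x\<in>A. dist x y \<le> \<epsilon>)"

definition nodes :: "R3 set set \<Rightarrow> R3 set" where
  "nodes \<F> = {z. \<exists>T\<in>\<F>. z extreme_point_of T}"

text \<open>\<open>\<theta>\<close> and \<open>C\<close> are the constants of the maximum angle condition and of the \<open>O(h\<^sub>K\<^sup>2)\<close> bound.\<close>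

definition boundary_triangulation ::
    "R3 set \<Rightarrow> real \<Rightarrow> real \<Rightarrow> R3 set \<Rightarrow> R3 set set \<Rightarrow> bool" where
  "boundary_triangulation \<Gamma> \<theta> C K \<F> \<longleftrightarrow>
     triangulation \<F> \<and> (\<forall>T\<in>\<F>. 2 simplex T) \<and>
     (\<forall>T\<in>\<F>. \<exists>F. F facet_of closure K \<and> T \<subseteq> F) \<and>
     (\<forall>F. F facet_of closure K \<longrightarrow> F = \<Union>{T\<in>\<F>. T \<subseteq> F}) \<and>
     (\<forall>z\<in>nodes \<F>. z extreme_point_of closure K \<or> (\<exists>e. e edge_of closure K \<and> z \<in> e \<inter> \<Gamma>)) \<and>
     max_angle_condition \<theta> \<F> \<and>
     (\<forall>F. F facet_of closure K \<and> rel_interior F \<inter> \<Gamma> \<noteq> {} \<longrightarrow>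
        (\<exists>T\<in>\<F>. \<exists>e. T \<subseteq> F \<and> e edge_of T \<and> hausdorff_within (F \<inter> \<Gamma>) e (C * (diameter K)\<^sup>2)))"

section \<open>The local spaces\<close>

definition B_space :: "R3 set \<Rightarrow> R3 set set \<Rightarrow> (R3 \<Rightarrow> real) set" where
  "B_space K \<F> = {g. continuous_on (frontier K) g \<and>
     (\<forall>T\<in>\<F>. \<exists>p q. \<forall>x\<in>T. g x = p \<bullet> x + q)}"

definition V_space :: "(R3 \<Rightarrow> real) \<Rightarrow> R3 set \<Rightarrow> R3 set set \<Rightarrow> (R3 \<Rightarrow> real) set" where
  "V_space \<beta> K \<F> = {v \<in> H1 K.
     (\<exists>G. weak_grad K v G \<and> (\<lambda>x. \<beta> x *\<^sub>R G x) \<in> Hdiv K \<and>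
          weak_div K (\<lambda>x. \<beta> x *\<^sub>R G x) (\<lambda>x. 0)) \<and>
     (\<exists>g\<in>B_space K \<F>. has_trace K v g)}"

end

theory Submission
  imports Defs
begin

text \<open>Functions in \<open>V\<^sup>n\<^sub>h(K)\<close> solve a Dirichlet problem for \<open>-\<nabla>\<cdot>(\<beta>\<nabla>v) = 0\<close> on the tetrahedron \<open>K\<close>, and
  nodal values determine the piecewise linear boundary data, so the claim is existence and uniqueness
  for this problem.

  For existence, the interpolant \<open>f\<close> of the nodal values is Lipschitz and can be approximated uniformly by
  smooth functions with bounded gradients. Among smooth functions within \<open>1/n\<close> of \<open>f\<close> on the boundary
  choose \<open>u n\<close> with almost minimal energy \<open>\<integral> \<beta> |\<nabla>u|\<^sup>2\<close>; the parallelogram identity makes the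
  gradients Cauchy, a Poincare inequality does the same for \<open>u n\<close>, and the first variation of the energy
  vanishes in the limit.

  For uniqueness, integration along segments emanating from a face bounds the mass of \<open>u\<close> in the layer of
  width \<open>\<epsilon>\<close> along that face by \<open>\<epsilon>\<close> times its trace and \<open>\<epsilon>\<^sup>2\<close> times the energy in the layer. If
  \<open>u\<close> has zero trace, testing the equation with \<open>u\<close> times a cutoff of width \<open>\<epsilon>\<close> therefore shows that
  the energy of \<open>u\<close> is bounded by its energy in that layer, which tends to zero.\<close>

text \<open>The coefficient jumps across the interface, so the argument relies on no regularity of
  solutions beyond a square-integrable gradient; it works throughout with smooth functions and their
  \<open>L2\<close> limits. \<open>has_trace\<close> asks for smooth approximants converging in
  \<open>K\<close> together with their gradients and on every face at once. A minimizing sequence of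
  smooth functions with approximate boundary values is such a sequence, which replaces both the
  density of smooth functions in \<open>H1\<close> and a trace theorem. The price is paid in
  uniqueness: a zero trace in this sense does not directly provide approximation by test functions.
  A cutoff makes the approximants admissible; its gradient has size 1/\<epsilon>, and the factor
  \<open>\<epsilon>\<^sup>2\<close> in the layer estimate is what compensates for its square. Nodal
  values are read through \<open>boundary_value\<close>, a definite description, so the continuous
  trace has to be shown unique; there the fibre argument runs the other way, from the volume to the
  face. Finally, \<beta> is unspecified on the interface, so its measurability rests on the
  interface being a null set.\<close>

section \<open>Calculus of smooth functions\<close>

lemma axis_basis: "axis i (1::real) \<in> (Basis :: R3 set)"
  by (auto simp: Basis_vec_def)

lemma has_derivative_grad:
  assumes "f differentiable (at x)"
  shows "(f has_derivative (\<lambda>h. grad f x \<bullet> h)) (at x)"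
proof -
  let ?D = "frechet_derivative f (at x)"
  have D: "(f has_derivative ?D) (at x)"
    using assms frechet_derivative_works by blast
  have lin: "linear ?D" using assms linear_frechet_derivative by blast
  have "?D h = grad f x \<bullet> h" for h
  proof -
    have "h = (\<Sum>i\<in>UNIV. (h $ i) *\<^sub>R axis i 1)"
      by (simp add: vec_eq_iff axis_def if_distrib cong: if_cong)
    then have "?D h = ?D (\<Sum>i\<in>UNIV. (h $ i) *\<^sub>R axis i 1)" by simp
    also have "\<dots> = (\<Sum>i\<in>UNIV. (h $ i) * ?D (axis i 1))"
      using lin by (simp add: linear_sum linear_cmul)
    also have "\<dots> = grad f x \<bullet> h"
      by (simp add: grad_def inner_vec_def mult.commute)
    finally show ?thesis .
  qed
  then have "?D = (\<lambda>h. grad f x \<bullet> h)" by auto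
  then show ?thesis using D by metis
qed

lemma has_derivative_imp_grad:
  assumes "(f has_derivative (\<lambda>h. g \<bullet> h)) (at x)"
  shows "f differentiable (at x)" "grad f x = g"
proof -
  show d: "f differentiable (at x)" using assms differentiable_def by blast
  have "(\<lambda>h. grad f x \<bullet> h) = (\<lambda>h. g \<bullet> h)"
    using has_derivative_grad[OF d] assms has_derivative_unique by blast
  then show "grad f x = g" by (metis inner_commute vector_eq_ldot)
qed

text \<open>Any explicitly given gradient may be used in place of \<open>grad\<close>, so the
  closure proofs below only have to name a candidate and differentiate.\<close>

lemma Ck_on_UNIV_Suc_iff:
  "Ck_on (Suc k) UNIV f \<longleftrightarrow> (\<exists>g. (\<forall>x. (f has_derivative (\<lambda>h. g x \<bullet> h)) (at x)) \<and>
     (\<forall>i. Ck_on k UNIV (\<lambda>x. g x $ i)))"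
proof
  assume "Ck_on (Suc k) UNIV f"
  then show "\<exists>g. (\<forall>x. (f has_derivative (\<lambda>h. g x \<bullet> h)) (at x)) \<and> (\<forall>i. Ck_on k UNIV (\<lambda>x. g x $ i))"
    by (intro exI[of _ "grad f"]) (auto intro: has_derivative_grad)
next
  assume "\<exists>g. (\<forall>x. (f has_derivative (\<lambda>h. g x \<bullet> h)) (at x)) \<and> (\<forall>i. Ck_on k UNIV (\<lambda>x. g x $ i))"
  then obtain g where g: "\<And>x. (f has_derivative (\<lambda>h. g x \<bullet> h)) (at x)" "\<And>i. Ck_on k UNIV (\<lambda>x. g x $ i)"
    by blast
  have "grad f x = g x" for x using has_derivative_imp_grad(2)[OF g(1)] .
  then show "Ck_on (Suc k) UNIV f" using g has_derivative_imp_grad(1)[OF g(1)] by simp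
qed

lemma Ck_on_UNIV_SucD: "Ck_on (Suc k) UNIV f \<Longrightarrow> Ck_on k UNIV f"
proof (induction k arbitrary: f)
  case 0
  then show ?case
    by (auto intro!: continuous_at_imp_continuous_on differentiable_imp_continuous_within)
next
  case (Suc k)
  show ?case unfolding Ck_on.simps(2)[of k]
    using Suc.prems Suc.IH unfolding Ck_on.simps(2)[of "Suc k"] by blast
qed

lemma Ck_on_const: "Ck_on k UNIV (\<lambda>x. c)"
proof (induction k arbitrary: c)
  case (Suc k)
  show ?case unfolding Ck_on_UNIV_Suc_iff
    by (rule exI[of _ "\<lambda>x. 0"]) (use has_derivative_const in \<open>auto simp: Suc inner_zero_left[abs_def]\<close>)
qed simp

lemma Ck_on_affine: "Ck_on k UNIV (\<lambda>x. p \<bullet> x + q)"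
proof (cases k)
  case 0
  then show ?thesis by (auto intro!: continuous_intros)
next
  case (Suc k)
  show ?thesis unfolding Suc Ck_on_UNIV_Suc_iff
    by (rule exI[of _ "\<lambda>x. p"]) (auto simp: Ck_on_const intro!: derivative_eq_intros)
qed

lemma Ck_on_add:
  "Ck_on k UNIV f \<Longrightarrow> Ck_on k UNIV g \<Longrightarrow> Ck_on k UNIV (\<lambda>x. f x + g x)"
proof (induction k arbitrary: f g)
  case 0 then show ?case by (simp add: continuous_on_add)
next
  case (Suc k)
  obtain f' g' where
    d: "\<And>x. (f has_derivative (\<lambda>h. f' x \<bullet> h)) (at x)" "\<And>x. (g has_derivative (\<lambda>h. g' x \<bullet> h)) (at x)"
    and c: "\<And>i. Ck_on k UNIV (\<lambda>x. f' x $ i)" "\<And>i. Ck_on k UNIV (\<lambda>x. g' x $ i)"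
    using Suc.prems unfolding Ck_on_UNIV_Suc_iff by blast
  have "((\<lambda>x. f x + g x) has_derivative (\<lambda>t. (f' x + g' x) \<bullet> t)) (at x)" for x
    using has_derivative_add[OF d(1)[of x] d(2)[of x]] by (simp add: inner_add_left)
  moreover have "Ck_on k UNIV (\<lambda>x. (f' x + g' x) $ i)" for i
    unfolding vector_add_component by (intro Suc.IH c)
  ultimately show ?case unfolding Ck_on_UNIV_Suc_iff
    by (intro exI[of _ "\<lambda>x. f' x + g' x"] conjI allI)
qed

lemma Ck_on_mult:
  "Ck_on k UNIV f \<Longrightarrow> Ck_on k UNIV g \<Longrightarrow> Ck_on k UNIV (\<lambda>x. f x * g x)"
proof (induction k arbitrary: f g)
  case 0 then show ?case by (simp add: continuous_on_mult)
next
  case (Suc k)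
  obtain f' g' where
    d: "\<And>x. (f has_derivative (\<lambda>h. f' x \<bullet> h)) (at x)" "\<And>x. (g has_derivative (\<lambda>h. g' x \<bullet> h)) (at x)"
    and c: "\<And>i. Ck_on k UNIV (\<lambda>x. f' x $ i)" "\<And>i. Ck_on k UNIV (\<lambda>x. g' x $ i)"
    using Suc.prems unfolding Ck_on_UNIV_Suc_iff by blast
  have fg: "Ck_on k UNIV f" "Ck_on k UNIV g" by (rule Suc.prems[THEN Ck_on_UNIV_SucD])+
  have "((\<lambda>x. f x * g x) has_derivative (\<lambda>t. (f x *\<^sub>R g' x + g x *\<^sub>R f' x) \<bullet> t)) (at x)" for x
    using has_derivative_mult[OF d(1)[of x] d(2)[of x]]
    by (simp add: inner_add_left mult.commute)
  moreover have "Ck_on k UNIV (\<lambda>x. (f x *\<^sub>R g' x + g x *\<^sub>R f' x) $ i)" for i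
    unfolding vector_add_component vector_scaleR_component real_scaleR_def
    by (intro Ck_on_add Suc.IH c fg)
  ultimately show ?case unfolding Ck_on_UNIV_Suc_iff
    by (intro exI[of _ "\<lambda>x. f x *\<^sub>R g' x + g x *\<^sub>R f' x"] conjI allI)
qed

text \<open>A unary operation whose derivative is expressed through the operation itself preserves
  \<open>C\<^sup>k\<close>, by induction on \<open>k\<close>.\<close>

lemma Ck_on_comp:
  assumes "\<And>x. f x \<in> V" "open V"
    and der: "\<And>y. y \<in> V \<Longrightarrow> (h has_real_derivative h' y) (at y)"
    and step: "\<And>j. Ck_on j UNIV f \<Longrightarrow> Ck_on j UNIV (\<lambda>x. h (f x)) \<Longrightarrow> Ck_on j UNIV (\<lambda>x. h' (f x))"
  shows "Ck_on k UNIV f \<Longrightarrow> Ck_on k UNIV (\<lambda>x. h (f x))"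
proof (induction k)
  case 0
  have "continuous_on V h"
    by (meson DERIV_isCont continuous_at_imp_continuous_on der)
  then show ?case using 0 assms(1)
    by (auto intro: continuous_on_compose2[of V])
next
  case (Suc k)
  obtain f' where
    d: "\<And>x. (f has_derivative (\<lambda>h. f' x \<bullet> h)) (at x)"
    and c: "\<And>i. Ck_on k UNIV (\<lambda>x. f' x $ i)"
    using Suc.prems unfolding Ck_on_UNIV_Suc_iff by blast
  have fk: "Ck_on k UNIV f" using Suc.prems by (rule Ck_on_UNIV_SucD)
  have "((\<lambda>x. h (f x)) has_derivative (\<lambda>t. (h' (f x) *\<^sub>R f' x) \<bullet> t)) (at x)" for x
    using has_derivative_compose[OF d[of x] der[OF assms(1), unfolded has_field_derivative_def]]
    by simp
  moreover have "Ck_on k UNIV (\<lambda>x. (h' (f x) *\<^sub>R f' x) $ i)" for i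
    by (auto intro!: Ck_on_mult c step fk Suc.IH)
  ultimately show ?case unfolding Ck_on_UNIV_Suc_iff
    by (intro exI[of _ "\<lambda>x. h' (f x) *\<^sub>R f' x"] conjI allI)
qed

lemma smoothI: "(\<And>k. Ck_on k UNIV f) \<Longrightarrow> smooth f" by (simp add: smooth_def)
lemma smoothD: "smooth f \<Longrightarrow> Ck_on k UNIV f" by (simp add: smooth_def)

lemma smooth_differentiable: "smooth f \<Longrightarrow> f differentiable (at x)"
  using smoothD[of f "Suc 0"] by simp

lemma smooth_continuous: "smooth f \<Longrightarrow> continuous_on S f"
  using smoothD[of f 0] by (auto intro: continuous_on_subset)

lemma smooth_grad_continuous: "smooth f \<Longrightarrow> continuous_on S (grad f)"
proof -
  assume "smooth f"
  then have "\<And>i. continuous_on UNIV (\<lambda>x. grad f x $ i)"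
    using smoothD[of f "Suc 0"] by simp
  then have "continuous_on UNIV (\<lambda>x. \<chi> i. grad f x $ i)"
    by (intro continuous_on_vec_lambda) auto
  then show ?thesis by (auto intro: continuous_on_subset)
qed

lemma smooth_has_derivative: "smooth f \<Longrightarrow> (f has_derivative (\<lambda>h. grad f x \<bullet> h)) (at x)"
  by (simp add: has_derivative_grad smooth_differentiable)

lemma smooth_const [simp]: "smooth (\<lambda>x. c)" by (simp add: smoothI Ck_on_const)
lemma smooth_affine [simp]: "smooth (\<lambda>x. p \<bullet> x + q)" by (simp add: smoothI Ck_on_affine)
lemma smooth_linear [simp]: "smooth (\<lambda>x. p \<bullet> x)" using smooth_affine[of p 0] by simp
lemma smooth_add: "smooth f \<Longrightarrow> smooth g \<Longrightarrow> smooth (\<lambda>x. f x + g x)"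
  by (simp add: smooth_def Ck_on_add)
lemma smooth_mult: "smooth f \<Longrightarrow> smooth g \<Longrightarrow> smooth (\<lambda>x. f x * g x)"
  by (simp add: smooth_def Ck_on_mult)
lemma smooth_diff: "smooth f \<Longrightarrow> smooth g \<Longrightarrow> smooth (\<lambda>x. f x - g x)"
  using smooth_add[of f "\<lambda>x. (-1) * g x"] smooth_mult[of "\<lambda>x. -1" g] by simp
lemma smooth_sum: "(\<And>i. i \<in> I \<Longrightarrow> smooth (f i)) \<Longrightarrow> smooth (\<lambda>x. \<Sum>i\<in>I. f i x)"
  by (induction I rule: infinite_finite_induct) (auto intro: smooth_add)
lemma smooth_prod: "(\<And>i. i \<in> I \<Longrightarrow> smooth (f i)) \<Longrightarrow> smooth (\<lambda>x. \<Prod>i\<in>I. f i x)"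
  by (induction I rule: infinite_finite_induct) (auto intro: smooth_mult)

lemma smooth_component: "smooth (\<lambda>x. x $ i)"
  using smooth_linear[of "axis i 1"] by (simp add: inner_axis')

lemma smooth_exp: "smooth f \<Longrightarrow> smooth (\<lambda>x. exp (f x))"
  by (auto intro!: smoothI Ck_on_comp[of f UNIV exp exp] DERIV_exp dest: smoothD)

lemma smooth_inverse:
  assumes "smooth f" "\<And>x. f x > 0" shows "smooth (\<lambda>x. inverse (f x))"
proof (rule smoothI)
  fix k
  show "Ck_on k UNIV (\<lambda>x. inverse (f x))"
  proof (rule Ck_on_comp[of f "{0<..}" inverse "\<lambda>y. (-1) * (inverse y * inverse y)"])
    show "(inverse has_real_derivative (-1) * (inverse y * inverse y)) (at y)" if "y \<in> {0<..}" for y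
      using that DERIV_inverse[of y UNIV] by simp
    show "Ck_on j UNIV (\<lambda>x. (-1) * (inverse (f x) * inverse (f x)))"
      if "Ck_on j UNIV (\<lambda>x. inverse (f x))" for j
      by (intro Ck_on_mult Ck_on_const that)
  qed (use assms(2) smoothD[OF assms(1)] in simp_all)
qed

lemma smooth_sqrt:
  assumes "smooth f" "\<And>x. f x > 0" shows "smooth (\<lambda>x. sqrt (f x))"
proof (rule smoothI)
  fix k
  show "Ck_on k UNIV (\<lambda>x. sqrt (f x))"
  \<comment> \<open>The derivative of \<open>sqrt\<close> is written as
    \<open>1/2 * (inverse y * sqrt y)\<close>: a smooth factor times \<open>sqrt\<close> itself,
    which is the shape that the last premise of \<open>Ck_on_comp\<close> asks for.\<close>
  proof (rule Ck_on_comp[of f "{0<..}" sqrt "\<lambda>y. 1/2 * (inverse y * sqrt y)"])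
    show "(sqrt has_real_derivative 1/2 * (inverse y * sqrt y)) (at y)" if "y \<in> {0<..}" for y
    proof -
      have "inverse y = inverse (sqrt y) * inverse (sqrt y)"
        using that by (simp flip: inverse_mult_distrib)
      then have "1/2 * (inverse y * sqrt y) = inverse (sqrt y) / 2" using that by simp
      then show ?thesis using DERIV_real_sqrt[of y] that by (metis greaterThan_iff)
    qed
    show "Ck_on j UNIV (\<lambda>x. 1/2 * (inverse (f x) * sqrt (f x)))"
      if "Ck_on j UNIV (\<lambda>x. sqrt (f x))" for j
      by (intro Ck_on_mult Ck_on_const smoothD[OF smooth_inverse[OF assms]] that)
  qed (use assms(2) smoothD[OF assms(1)] in simp_all)
qed

lemma smooth_ln:
  assumes "smooth f" "\<And>x. f x > 0" shows "smooth (\<lambda>x. ln (f x))"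
proof (rule smoothI)
  fix k
  show "Ck_on k UNIV (\<lambda>x. ln (f x))"
  proof (rule Ck_on_comp[of f "{0<..}" ln inverse])
    show "(ln has_real_derivative inverse y) (at y)" if "y \<in> {0<..}" for y
      using that by (simp add: DERIV_ln)
  qed (use assms(2) smoothD[OF assms(1)] smoothD[OF smooth_inverse[OF assms]] in simp_all)
qed

lemma grad_add: "smooth f \<Longrightarrow> smooth g \<Longrightarrow> grad (\<lambda>x. f x + g x) x = grad f x + grad g x"
  by (rule has_derivative_imp_grad(2))
    (auto intro!: derivative_eq_intros smooth_has_derivative simp: inner_add_left)
lemma grad_diff: "smooth f \<Longrightarrow> smooth g \<Longrightarrow> grad (\<lambda>x. f x - g x) x = grad f x - grad g x"
  by (rule has_derivative_imp_grad(2))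
    (auto intro!: derivative_eq_intros smooth_has_derivative simp: inner_diff_left)
lemma grad_mult: "smooth f \<Longrightarrow> smooth g \<Longrightarrow>
    grad (\<lambda>x. f x * g x) x = f x *\<^sub>R grad g x + g x *\<^sub>R grad f x"
  by (rule has_derivative_imp_grad(2))
    (auto intro!: derivative_eq_intros smooth_has_derivative simp: inner_add_left algebra_simps)
lemma grad_const: "grad (\<lambda>x. c) x = 0"
  by (rule has_derivative_imp_grad(2)) auto
lemma grad_cmult: "smooth f \<Longrightarrow> grad (\<lambda>x. c * f x) x = c *\<^sub>R grad f x"
  using grad_mult[of "\<lambda>x. c" f x] by (simp add: grad_const)
lemma grad_comp:
  assumes "smooth f" "(h has_real_derivative h') (at (f x))"
  shows "grad (\<lambda>x. h (f x)) x = h' *\<^sub>R grad f x"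
  by (rule has_derivative_imp_grad(2))
    (use has_derivative_compose[OF smooth_has_derivative[OF assms(1)] assms(2)[unfolded has_field_derivative_def]] in simp)
lemma grad_affine: "grad (\<lambda>x. p \<bullet> x + q) x = p"
  by (rule has_derivative_imp_grad(2)) (auto intro!: derivative_eq_intros)

section \<open>A smooth step function built from \<open>exp (- 1/x)\<close>\<close>

definition flat :: "nat \<Rightarrow> real \<Rightarrow> real" where
  "flat m x = (if x > 0 then (inverse x) ^ m * exp (- inverse x) else 0)"

lemma flat_tendsto_0: "((flat m) \<longlongrightarrow> 0) (at 0)"
proof -
  have 1: "((\<lambda>x. (inverse x) ^ m * exp (- inverse x)) \<longlongrightarrow> (0::real)) (at_right 0)"
  proof -
    have "((\<lambda>y. y ^ m / exp y) \<longlongrightarrow> (0::real)) at_top" by (rule tendsto_power_div_exp_0)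
    then have "((\<lambda>x. (inverse x) ^ m / exp (inverse x)) \<longlongrightarrow> (0::real)) (at_right 0)"
      by (rule filterlim_compose[OF _ filterlim_inverse_at_top_right])
    then show ?thesis by (simp add: exp_minus field_simps)
  qed
  have "(flat m \<longlongrightarrow> 0) (at_right 0)"
    by (rule tendsto_cong[THEN iffD2, OF _ 1])
      (auto simp: flat_def eventually_at_filter)
  moreover have "(flat m \<longlongrightarrow> 0) (at_left 0)"
    by (rule tendsto_cong[THEN iffD2, OF _ tendsto_const])
      (auto simp: flat_def eventually_at_filter)
  ultimately show ?thesis by (simp add: filterlim_at_split)
qed

text \<open>Each differentiation of \<open>exp (- 1/x)\<close> produces powers of 1/x; carrying them
  in \<open>flat m\<close> makes the linear span of the family closed under differentiation. At 0
  the difference quotient of \<open>flat m\<close> is \<open>flat (m + 1)\<close>, which tends to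
  0.\<close>

lemma flat_has_derivative:
  "(flat m has_real_derivative (flat (m+2) x - real m * flat (m+1) x)) (at x)"
proof -
  consider "x > 0" | "x < 0" | "x = 0" by linarith
  then show ?thesis
  proof cases
    case 1
    have i: "(inverse has_real_derivative - (inverse x * inverse x)) (at x)"
      using DERIV_inverse[of x UNIV] 1 by simp
    have p: "real m * (- (inverse x * inverse x) * inverse x ^ (m - Suc 0)) = - real m * inverse x ^ (m + 1)"
      by (cases m) (simp_all add: algebra_simps)
    have "((\<lambda>x. (inverse x) ^ m * exp (- inverse x)) has_real_derivative
        (flat (m+2) x - real m * flat (m+1) x)) (at x)"
      using DERIV_mult[OF DERIV_power[OF i, of m] DERIV_fun_exp[OF DERIV_minus[OF i]]] 1
      unfolding p by (simp add: flat_def ac_simps)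
    then show ?thesis
      by (rule has_field_derivative_transform_within[of _ _ _ _ x]) (use 1 in \<open>auto simp: flat_def dist_real_def\<close>)
  next
    case 2
    have "((\<lambda>x. 0) has_real_derivative (flat (m+2) x - real m * flat (m+1) x)) (at x)"
      using 2 by (auto simp: flat_def)
    then show ?thesis
      by (rule has_field_derivative_transform_within[of _ _ _ _ "-x"]) (use 2 in \<open>auto simp: flat_def dist_real_def\<close>)
  next
    case 3
    have "((\<lambda>h. (flat m (0 + h) - flat m 0) / h) \<longlongrightarrow> 0) (at 0)"
    proof -
      have "(\<lambda>h. (flat m (0 + h) - flat m 0) / h) = flat (Suc m)"
        by (auto simp: flat_def fun_eq_iff field_simps)
      then show ?thesis using flat_tendsto_0[of "Suc m"] by simp
    qed
    then show ?thesis unfolding 3 DERIV_def by (simp add: flat_def)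
  qed
qed

text \<open>The derivative of \<open>flat m\<close> involves other members of the family, so
  \<open>Ck_on_comp\<close> does not fit; instead the induction on \<open>k\<close> treats all
  \<open>m\<close> simultaneously.\<close>

lemma smooth_flat: assumes "smooth f" shows "smooth (\<lambda>x. flat m (f x))"
proof (rule smoothI)
  fix k
  show "Ck_on k UNIV (\<lambda>x. flat m (f x))"
  proof (induction k arbitrary: m)
    case 0
    have "continuous_on UNIV (flat m)"
      by (meson DERIV_isCont continuous_at_imp_continuous_on flat_has_derivative)
    then show ?case using smooth_continuous[OF assms]
      by (auto intro: continuous_on_compose2[of UNIV])
  next
    case (Suc k)
    have "Ck_on k UNIV (\<lambda>x. grad f x $ i)" for i
      using smoothD[OF assms, of "Suc k"] by simp
    then have *: "Ck_on k UNIV (\<lambda>x. (flat (m+2) (f x) + (- real m) * flat (m+1) (f x)) * grad f x $ i)" for i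
      by (intro Ck_on_add Ck_on_mult Ck_on_const Suc)
    have "((\<lambda>x. flat m (f x)) has_derivative
        (\<lambda>t. ((flat (m+2) (f x) + (- real m) * flat (m+1) (f x)) *\<^sub>R grad f x) \<bullet> t)) (at x)" for x
      using has_derivative_compose[OF smooth_has_derivative[OF assms, of x]
          flat_has_derivative[unfolded has_field_derivative_def], of m] by simp
    moreover have "Ck_on k UNIV (\<lambda>x. ((flat (m+2) (f x) + (- real m) * flat (m+1) (f x)) *\<^sub>R grad f x) $ i)" for i
      using *[of i] by simp
    ultimately show ?case unfolding Ck_on_UNIV_Suc_iff
      by (intro exI[of _ "\<lambda>x. (flat (m+2) (f x) + (- real m) * flat (m+1) (f x)) *\<^sub>R grad f x"] conjI allI)
  qed
qed

text \<open>The step rises between 1 and 2 rather than between 0 and 1: after scaling by \<epsilon>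
  it vanishes wherever its argument is at most \<epsilon>, which keeps the supports of the cutoffs
  away from the boundary.\<close>

definition smooth_step :: "real \<Rightarrow> real" where
  "smooth_step t = flat 0 (t - 1) * inverse (flat 0 (t - 1) + flat 0 (2 - t))"

lemma flat_nonneg: "flat m x \<ge> 0" by (simp add: flat_def)
lemma flat_sum_pos: "flat 0 (t - 1) + flat 0 (2 - t) > 0"
  by (cases "t > 1") (auto simp: flat_def add_pos_nonneg)

lemma smooth_step_bounds: "0 \<le> smooth_step t" "smooth_step t \<le> 1"
  using flat_nonneg[of 0 "t-1"] flat_nonneg[of 0 "2-t"] flat_sum_pos[of t]
  by (auto simp: smooth_step_def field_simps)

lemma smooth_step_eq_0: "t \<le> 1 \<Longrightarrow> smooth_step t = 0"
  by (simp add: smooth_step_def flat_def)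

lemma smooth_step_eq_1: "t \<ge> 2 \<Longrightarrow> smooth_step t = 1"
  by (simp add: smooth_step_def flat_def)

lemma smooth_smooth_step: "smooth f \<Longrightarrow> smooth (\<lambda>x. smooth_step (f x))"
  unfolding smooth_step_def
  by (intro smooth_mult smooth_inverse smooth_add smooth_flat smooth_diff smooth_const flat_sum_pos)

text \<open>The quotient rule gives a derivative that is continuous on the compact interval from 1
  to 2, and outside it the step is locally constant. The bound \<open>H\<close> controls all cutoff
  gradients later.\<close>

lemma smooth_step_derivative:
  obtains H d where "H \<ge> 0" "\<And>t. (smooth_step has_real_derivative d t) (at t)" "\<And>t. \<bar>d t\<bar> \<le> H"
    "\<And>t. t > 2 \<Longrightarrow> d t = 0"
proof -
  let ?a = "\<lambda>t. flat 0 (t - 1)" and ?b = "\<lambda>t. flat 0 (2 - t)"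
  let ?a' = "\<lambda>t. flat 2 (t - 1)" and ?b' = "\<lambda>t. - flat 2 (2 - t)"
  define d where "d t = ?a' t * inverse (?a t + ?b t) + ?a t * (- (inverse (?a t + ?b t) * (?a' t + ?b' t) * inverse (?a t + ?b t)))" for t
  have fl: "(flat 0 has_real_derivative flat 2 x) (at x)" for x
    using flat_has_derivative[of 0 x] by (simp add: numeral_2_eq_2)
  have a: "(?a has_real_derivative ?a' t) (at t)" for t
  proof -
    have "(?a has_real_derivative ?a' t * 1) (at t)"
      by (rule DERIV_chain2[OF fl]) (auto intro!: derivative_eq_intros)
    then show ?thesis by simp
  qed
  have b: "(?b has_real_derivative ?b' t) (at t)" for t
  proof -
    have "(?b has_real_derivative flat 2 (2 - t) * (-1)) (at t)"
      by (rule DERIV_chain2[OF fl]) (auto intro!: derivative_eq_intros)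
    then show ?thesis by simp
  qed
  have der: "(smooth_step has_real_derivative d t) (at t)" for t
  proof -
    have ne: "?a t + ?b t \<noteq> 0" using flat_sum_pos[of t] by simp
    show ?thesis
      using DERIV_mult[OF a[of t] DERIV_inverse_fun[OF DERIV_add[OF a[of t] b[of t]] ne]]
      unfolding smooth_step_def[abs_def] d_def by (simp add: ac_simps)
  qed
  have cfl: "continuous_on UNIV (flat m)" for m
    by (meson DERIV_isCont continuous_at_imp_continuous_on flat_has_derivative)
  have c: "continuous_on {1..2} (\<lambda>t. flat m (t - 1))" "continuous_on {1..2} (\<lambda>t. flat m (2 - t))" for m
    by (auto intro!: continuous_on_compose2[OF cfl] continuous_on_diff continuous_on_id continuous_on_const)
  have cont: "continuous_on {1..2} d" unfolding d_def
    by (intro continuous_on_add continuous_on_mult continuous_on_minus continuous_on_inverse c ballI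
        flat_sum_pos[THEN less_imp_neq, symmetric])
  have "compact (d ` {1..2})" using cont by (rule compact_continuous_image) simp
  then obtain B where B: "\<And>t. t \<in> {1..2} \<Longrightarrow> \<bar>d t\<bar> \<le> B"
    using compact_imp_bounded bounded_iff by (metis image_eqI real_norm_def)
  have z: "d t = 0" if "t > 2 \<or> t < 1" for t
  proof -
    have "\<exists>e>0. \<forall>s. \<bar>t - s\<bar> < e \<longrightarrow> smooth_step t = smooth_step s"
    proof (cases "t > 2")
      case True
      then show ?thesis by (intro exI[of _ "t - 2"]) (auto simp: smooth_step_eq_1)
    next
      case False
      then show ?thesis using that by (intro exI[of _ "1 - t"]) (auto simp: smooth_step_eq_0)
    qed
    then obtain e where e: "e > 0" "\<forall>s. \<bar>t - s\<bar> < e \<longrightarrow> smooth_step t = smooth_step s" by blast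
    show ?thesis using DERIV_local_const[OF der e] .
  qed
  show ?thesis
  proof
    show "max B 0 \<ge> 0" by simp
    show "\<bar>d t\<bar> \<le> max B 0" for t using B[of t] z[of t] by (cases "t \<in> {1..2}") auto
  qed (use der z in auto)
qed

section \<open>Test functions\<close>

lemma test_function_mult:
  assumes "test_function K \<phi>" "smooth u" shows "test_function K (\<lambda>x. \<phi> x * u x)"
proof -
  have "closure {x. \<phi> x * u x \<noteq> 0} \<subseteq> closure {x. \<phi> x \<noteq> 0}" by (intro closure_mono) auto
  moreover have "compact (closure {x. \<phi> x * u x \<noteq> 0})"
    using assms(1) calculation unfolding test_function_def
    by (metis (no_types) bounded_subset closed_closure compact_eq_bounded_closed)
  ultimately show ?thesis using assms by (auto simp: test_function_def intro: smooth_mult)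
qed

lemma test_function_smooth: "test_function K \<phi> \<Longrightarrow> smooth \<phi>"
  by (simp add: test_function_def)

lemma test_function_mono: "test_function K \<phi> \<Longrightarrow> K \<subseteq> K' \<Longrightarrow> test_function K' \<phi>"
  by (auto simp: test_function_def)

lemma test_function_zero: "test_function K \<phi> \<Longrightarrow> x \<notin> K \<Longrightarrow> \<phi> x = 0"
  unfolding test_function_def using closure_subset[of "{x. \<phi> x \<noteq> 0}"] by auto

text \<open>The complement of the support is an open neighbourhood of \<open>x\<close>, so \<phi>
  vanishes near \<open>x\<close> and not just at \<open>x\<close>.\<close>

lemma test_function_grad_zero:
  assumes "test_function K \<phi>" "x \<notin> K" shows "grad \<phi> x = 0"
proof -
  let ?S = "- closure {x. \<phi> x \<noteq> 0}"
  have S: "open ?S" "x \<in> ?S" using assms by (auto simp: test_function_def)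
  have "(\<phi> has_derivative (\<lambda>h. 0 \<bullet> h)) (at x)"
    by (rule has_derivative_transform_within_open[of "\<lambda>_. 0", OF _ S])
      (use closure_subset[of "{x. \<phi> x \<noteq> 0}"] in auto)
  then show ?thesis by (rule has_derivative_imp_grad)
qed

section \<open>Square-integrable functions\<close>

lemma L2_measurable: "L2 M f \<Longrightarrow> f \<in> borel_measurable M"
  by (simp add: L2_def)

lemma L2_integrable: "L2 M f \<Longrightarrow> integrable M (\<lambda>x. (norm (f x))\<^sup>2)"
  by (simp add: L2_def)

lemma norm_add_sq_le: "(norm (a + b :: 'a::real_normed_vector))\<^sup>2 \<le> 2 * (norm a)\<^sup>2 + 2 * (norm b)\<^sup>2"
proof -
  have "(norm (a + b))\<^sup>2 \<le> (norm a + norm b)\<^sup>2"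
    by (intro power_mono norm_triangle_ineq) auto
  also have "\<dots> \<le> 2 * (norm a)\<^sup>2 + 2 * (norm b)\<^sup>2"
    using sum_squares_bound[of "norm a" "norm b"] by (simp add: power2_sum)
  finally show ?thesis .
qed

lemma abs_inner_le_sq: "\<bar>a \<bullet> b\<bar> \<le> ((norm a)\<^sup>2 + (norm b)\<^sup>2) / 2" for a b :: "'a::real_inner"
proof -
  have "\<bar>a \<bullet> b\<bar> \<le> norm a * norm b" by (rule Cauchy_Schwarz_ineq2)
  also have "\<dots> \<le> ((norm a)\<^sup>2 + (norm b)\<^sup>2) / 2"
    using sum_squares_bound[of "norm a" "norm b"] by simp
  finally show ?thesis .
qed

lemma L2_inner_integrable:
  assumes "L2 M f" "L2 M g" shows "integrable M (\<lambda>x. f x \<bullet> g x)"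
proof (rule Bochner_Integration.integrable_bound)
  show "integrable M (\<lambda>x. ((norm (f x))\<^sup>2 + (norm (g x))\<^sup>2) / 2)"
    using assms by (auto simp: L2_def)
  show "(\<lambda>x. f x \<bullet> g x) \<in> borel_measurable M"
    using assms by (auto simp: L2_def)
  show "AE x in M. norm (f x \<bullet> g x) \<le> norm (((norm (f x))\<^sup>2 + (norm (g x))\<^sup>2) / 2)"
    using abs_inner_le_sq by (intro AE_I2) (auto intro: order_trans[OF _ abs_ge_self])
qed

lemma L2_mult_integrable:
  fixes f g :: "'a \<Rightarrow> real"
  assumes "L2 M f" "L2 M g" shows "integrable M (\<lambda>x. f x * g x)"
  using L2_inner_integrable[OF assms] by simp

lemma L2_add:
  assumes "L2 M f" "L2 M g" shows "L2 M (\<lambda>x. f x + g x)"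
  unfolding L2_def
proof
  show m: "(\<lambda>x. f x + g x) \<in> borel_measurable M" using assms by (auto simp: L2_def)
  show "integrable M (\<lambda>x. (norm (f x + g x))\<^sup>2)"
  proof (rule Bochner_Integration.integrable_bound)
    show "integrable M (\<lambda>x. 2 * (norm (f x))\<^sup>2 + 2 * (norm (g x))\<^sup>2)"
      using assms by (auto simp: L2_def)
    show "AE x in M. norm ((norm (f x + g x))\<^sup>2) \<le> norm (2 * (norm (f x))\<^sup>2 + 2 * (norm (g x))\<^sup>2)"
      using norm_add_sq_le by (intro AE_I2) (auto intro: order_trans[OF _ abs_ge_self])
  qed (use m in measurable)
qed

lemma L2_bounded_mult:
  assumes "L2 M f" "c \<in> borel_measurable M" "AE x in M. \<bar>c x\<bar> \<le> B"
  shows "L2 M (\<lambda>x. c x *\<^sub>R f x)"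
  unfolding L2_def
proof
  show m: "(\<lambda>x. c x *\<^sub>R f x) \<in> borel_measurable M" using assms by (auto simp: L2_def)
  show "integrable M (\<lambda>x. (norm (c x *\<^sub>R f x))\<^sup>2)"
  proof (rule Bochner_Integration.integrable_bound)
    show "integrable M (\<lambda>x. B\<^sup>2 * (norm (f x))\<^sup>2)"
      using assms by (auto simp: L2_def)
    show "AE x in M. norm ((norm (c x *\<^sub>R f x))\<^sup>2) \<le> norm (B\<^sup>2 * (norm (f x))\<^sup>2)"
      using assms(3) by eventually_elim (auto simp: power_mult_distrib intro!: mult_right_mono abs_le_square_iff[THEN iffD1])
  qed (use m in measurable)
qed

lemma L2_scaleR: "L2 M f \<Longrightarrow> L2 M (\<lambda>x. c *\<^sub>R f x)"
  by (rule L2_bounded_mult[of _ _ _ "\<bar>c\<bar>"]) auto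

lemma L2_diff: "L2 M f \<Longrightarrow> L2 M g \<Longrightarrow> L2 M (\<lambda>x. f x - g x)"
  using L2_add[of M f "\<lambda>x. (-1) *\<^sub>R g x"] L2_scaleR[of M g "-1"] by simp

text \<open>A quadratic polynomial without negative values has nonpositive discriminant; for
  positive \<open>C\<close> its minimum is at \<open>t = - B / C\<close>. This serves both the
  Cauchy-Schwarz inequality and, with \<open>A = 0\<close>, the vanishing of the first variation of
  the energy.\<close>

lemma discriminant_le:
  fixes A B C :: real
  assumes "\<And>t. A + 2 * t * B + t\<^sup>2 * C \<ge> 0" "C \<ge> 0" shows "B\<^sup>2 \<le> A * C"
proof (cases "C = 0")
  case False
  then have "C > 0" using assms by simp
  have "A + 2 * (- B / C) * B + (- B / C)\<^sup>2 * C \<ge> 0" by (rule assms)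
  then have "A - B\<^sup>2 / C \<ge> 0" using False by (simp add: power2_eq_square field_simps)
  then show ?thesis using \<open>C > 0\<close> by (simp add: field_simps)
next
  case True
  have "B = 0"
  proof (rule ccontr)
    assume "B \<noteq> 0"
    \<comment> \<open>For \<open>C = 0\<close> the polynomial is linear, and this \<open>t\<close>
      gives it the value -1.\<close>
    then show False using assms(1)[of "- (A + 1) / (2 * B)"] True by (simp add: field_simps)
  qed
  then show ?thesis using True by simp
qed

lemma L2_Cauchy_Schwarz:
  assumes f: "L2 M f" and g: "L2 M g"
  shows "(\<integral>x. f x \<bullet> g x \<partial>M)\<^sup>2 \<le> (\<integral>x. (norm (f x))\<^sup>2 \<partial>M) * (\<integral>x. (norm (g x))\<^sup>2 \<partial>M)"
proof (rule discriminant_le)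
  fix t :: real
  have "0 \<le> (\<integral>x. (norm (f x + t *\<^sub>R g x))\<^sup>2 \<partial>M)" by simp
  also have "\<dots> = (\<integral>x. (norm (f x))\<^sup>2 + (2 * t * (f x \<bullet> g x) + t\<^sup>2 * (norm (g x))\<^sup>2) \<partial>M)"
    by (intro Bochner_Integration.integral_cong)
      (simp_all add: power2_norm_eq_inner inner_add_left inner_add_right inner_commute power2_eq_square[of t])
  also have "\<dots> = (\<integral>x. (norm (f x))\<^sup>2 \<partial>M) + 2 * t * (\<integral>x. f x \<bullet> g x \<partial>M) + t\<^sup>2 * (\<integral>x. (norm (g x))\<^sup>2 \<partial>M)"
    using L2_integrable[OF f] L2_integrable[OF g] L2_inner_integrable[OF f g] by simp
  finally show "0 \<le> (\<integral>x. (norm (f x))\<^sup>2 \<partial>M) + 2 * t * (\<integral>x. f x \<bullet> g x \<partial>M) + t\<^sup>2 * (\<integral>x. (norm (g x))\<^sup>2 \<partial>M)" .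
qed simp

lemma L2_tendstoD:
  assumes "L2_tendsto M f g"
  shows "L2 M (f n)" "L2 M g" "(\<lambda>n. \<integral>x. (norm (f n x - g x))\<^sup>2 \<partial>M) \<longlonglongrightarrow> 0"
  using assms by (auto simp: L2_tendsto_def)

lemma L2_tendsto_diff:
  assumes f: "L2_tendsto M f F" and g: "L2_tendsto M g G"
  shows "L2_tendsto M (\<lambda>n x. f n x - g n x) (\<lambda>x. F x - G x)"
proof -
  note D = L2_tendstoD[OF f] L2_tendstoD[OF g]
  have "(\<lambda>n. \<integral>x. (norm ((f n x - g n x) - (F x - G x)))\<^sup>2 \<partial>M) \<longlonglongrightarrow> 0"
  proof (rule tendsto_sandwich[of "\<lambda>_. 0"])
    show "\<forall>\<^sub>F n in sequentially. (\<integral>x. (norm ((f n x - g n x) - (F x - G x)))\<^sup>2 \<partial>M)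
        \<le> 2 * (\<integral>x. (norm (f n x - F x))\<^sup>2 \<partial>M) + 2 * (\<integral>x. (norm (g n x - G x))\<^sup>2 \<partial>M)"
    proof (rule always_eventually, rule allI)
      fix n
      have i: "integrable M (\<lambda>x. (norm (f n x - F x))\<^sup>2)" "integrable M (\<lambda>x. (norm (g n x - G x))\<^sup>2)"
        using D by (auto intro!: L2_integrable L2_diff)
      have "(\<integral>x. (norm ((f n x - g n x) - (F x - G x)))\<^sup>2 \<partial>M)
         \<le> (\<integral>x. 2 * (norm (f n x - F x))\<^sup>2 + 2 * (norm (g n x - G x))\<^sup>2 \<partial>M)"
      proof (rule integral_mono)
        show "integrable M (\<lambda>x. (norm ((f n x - g n x) - (F x - G x)))\<^sup>2)"
          using D by (intro L2_integrable L2_diff)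
        show "(norm ((f n x - g n x) - (F x - G x)))\<^sup>2 \<le> 2 * (norm (f n x - F x))\<^sup>2 + 2 * (norm (g n x - G x))\<^sup>2" for x
          using norm_add_sq_le[of "f n x - F x" "G x - g n x"] by (simp add: algebra_simps norm_minus_commute)
      qed (use i in auto)
      then show "(\<integral>x. (norm ((f n x - g n x) - (F x - G x)))\<^sup>2 \<partial>M)
        \<le> 2 * (\<integral>x. (norm (f n x - F x))\<^sup>2 \<partial>M) + 2 * (\<integral>x. (norm (g n x - G x))\<^sup>2 \<partial>M)"
        using i by simp
    qed
    show "(\<lambda>n. 2 * (\<integral>x. (norm (f n x - F x))\<^sup>2 \<partial>M) + 2 * (\<integral>x. (norm (g n x - G x))\<^sup>2 \<partial>M)) \<longlonglongrightarrow> 0"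
      using tendsto_add[OF tendsto_mult_left[OF D(3), of 2] tendsto_mult_left[OF D(6), of 2]] by simp
  qed auto
  then show ?thesis using D by (auto simp: L2_tendsto_def intro!: L2_diff)
qed

text \<open>Strong convergence implies weak convergence, by Cauchy-Schwarz. All passages to the
  limit in linear terms below go through this.\<close>

lemma L2_tendsto_inner_right:
  assumes f: "L2_tendsto M f F" and h: "L2 M h"
  shows "(\<lambda>n. \<integral>x. h x \<bullet> f n x \<partial>M) \<longlonglongrightarrow> (\<integral>x. h x \<bullet> F x \<partial>M)"
proof -
  note D = L2_tendstoD[OF f]
  have "(\<lambda>n. \<integral>x. h x \<bullet> (f n x - F x) \<partial>M) \<longlonglongrightarrow> 0"
  proof (rule tendsto_0_le[where K=1])
    show "(\<lambda>n. sqrt ((\<integral>x. (norm (h x))\<^sup>2 \<partial>M) * (\<integral>x. (norm (f n x - F x))\<^sup>2 \<partial>M))) \<longlonglongrightarrow> 0"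
      using tendsto_real_sqrt[OF tendsto_mult_left[OF D(3)]] by (simp add: real_sqrt_mult)
    show "\<forall>\<^sub>F n in sequentially. norm (\<integral>x. h x \<bullet> (f n x - F x) \<partial>M)
       \<le> norm (sqrt ((\<integral>x. (norm (h x))\<^sup>2 \<partial>M) * (\<integral>x. (norm (f n x - F x))\<^sup>2 \<partial>M))) * 1"
    proof (rule always_eventually, rule allI)
      fix n
      have "(\<integral>x. h x \<bullet> (f n x - F x) \<partial>M)\<^sup>2 \<le> (\<integral>x. (norm (h x))\<^sup>2 \<partial>M) * (\<integral>x. (norm (f n x - F x))\<^sup>2 \<partial>M)"
        using D h by (intro L2_Cauchy_Schwarz L2_diff)
      then show "norm (\<integral>x. h x \<bullet> (f n x - F x) \<partial>M)
       \<le> norm (sqrt ((\<integral>x. (norm (h x))\<^sup>2 \<partial>M) * (\<integral>x. (norm (f n x - F x))\<^sup>2 \<partial>M))) * 1"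
        using real_sqrt_le_mono by fastforce
    qed
  qed
  moreover have "(\<integral>x. h x \<bullet> (f n x - F x) \<partial>M) = (\<integral>x. h x \<bullet> f n x \<partial>M) - (\<integral>x. h x \<bullet> F x \<partial>M)" for n
    using L2_inner_integrable[OF h D(1)[of n]] L2_inner_integrable[OF h D(2)] by (simp add: inner_diff_right)
  ultimately show ?thesis by (simp add: LIM_zero_iff)
qed

text \<open>Expand f . g as (f - F) . (g - G) + F . g + G . f - F . G. The first term is bounded by
  half the sum of the squared errors, and the two middle ones are linear in a convergent
  sequence.\<close>

lemma L2_tendsto_weighted_inner:
  assumes f: "L2_tendsto M f F" and g: "L2_tendsto M g G"
    and c: "c \<in> borel_measurable M" "AE x in M. \<bar>c x\<bar> \<le> B"
  shows "(\<lambda>n. \<integral>x. c x * (f n x \<bullet> g n x) \<partial>M) \<longlonglongrightarrow> (\<integral>x. c x * (F x \<bullet> G x) \<partial>M)"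
proof -
  note D = L2_tendstoD[OF f] L2_tendstoD[OF g]
  have dL: "L2 M (\<lambda>x. f n x - F x)" "L2 M (\<lambda>x. g n x - G x)" for n using D by (auto intro: L2_diff)
  have cL: "L2 M (\<lambda>x. c x *\<^sub>R h x)" if "L2 M h" for h :: "'a \<Rightarrow> 'b"
    by (rule L2_bounded_mult[OF that c])
  have "(\<lambda>n. \<integral>x. (c x *\<^sub>R (f n x - F x)) \<bullet> (g n x - G x) \<partial>M) \<longlonglongrightarrow> 0"
  proof (rule tendsto_0_le[where K=1])
    show "(\<lambda>n. \<bar>B\<bar> / 2 * ((\<integral>x. (norm (f n x - F x))\<^sup>2 \<partial>M) + (\<integral>x. (norm (g n x - G x))\<^sup>2 \<partial>M))) \<longlonglongrightarrow> 0"
      using tendsto_mult_left[OF tendsto_add[OF D(3) D(6)], of "\<bar>B\<bar>/2"] by simp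
    show "\<forall>\<^sub>F n in sequentially. norm (\<integral>x. (c x *\<^sub>R (f n x - F x)) \<bullet> (g n x - G x) \<partial>M)
       \<le> norm (\<bar>B\<bar> / 2 * ((\<integral>x. (norm (f n x - F x))\<^sup>2 \<partial>M) + (\<integral>x. (norm (g n x - G x))\<^sup>2 \<partial>M))) * 1"
    proof (rule always_eventually, rule allI)
      fix n
      note i = L2_integrable[OF dL(1)[of n]] L2_integrable[OF dL(2)[of n]]
      have "norm (\<integral>x. (c x *\<^sub>R (f n x - F x)) \<bullet> (g n x - G x) \<partial>M)
          \<le> (\<integral>x. \<bar>B\<bar> / 2 * ((norm (f n x - F x))\<^sup>2 + (norm (g n x - G x))\<^sup>2) \<partial>M)"
      proof (rule order_trans[OF integral_norm_bound], rule integral_mono_AE)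
        show "integrable M (\<lambda>x. norm ((c x *\<^sub>R (f n x - F x)) \<bullet> (g n x - G x)))"
          by (intro integrable_norm L2_inner_integrable cL dL)
        show "AE x in M. norm ((c x *\<^sub>R (f n x - F x)) \<bullet> (g n x - G x))
            \<le> \<bar>B\<bar> / 2 * ((norm (f n x - F x))\<^sup>2 + (norm (g n x - G x))\<^sup>2)"
          using c(2)
        proof eventually_elim
          case (elim x)
          have "\<bar>c x\<bar> * \<bar>(f n x - F x) \<bullet> (g n x - G x)\<bar> \<le> \<bar>B\<bar> * (((norm (f n x - F x))\<^sup>2 + (norm (g n x - G x))\<^sup>2) / 2)"
            using elim by (intro mult_mono abs_inner_le_sq) auto
          then show ?case by (simp add: abs_mult)
        qed
      qed (use i in auto)
      also have "\<dots> = \<bar>B\<bar> / 2 * ((\<integral>x. (norm (f n x - F x))\<^sup>2 \<partial>M) + (\<integral>x. (norm (g n x - G x))\<^sup>2 \<partial>M))"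
        using i by simp
      finally show "norm (\<integral>x. (c x *\<^sub>R (f n x - F x)) \<bullet> (g n x - G x) \<partial>M)
       \<le> norm (\<bar>B\<bar> / 2 * ((\<integral>x. (norm (f n x - F x))\<^sup>2 \<partial>M) + (\<integral>x. (norm (g n x - G x))\<^sup>2 \<partial>M))) * 1"
        by simp
    qed
  qed
  moreover note L2_tendsto_inner_right[OF g cL[OF D(2)]]
  moreover note L2_tendsto_inner_right[OF f cL[OF D(5)]]
  ultimately have lim: "(\<lambda>n. (\<integral>x. (c x *\<^sub>R (f n x - F x)) \<bullet> (g n x - G x) \<partial>M)
      + (\<integral>x. (c x *\<^sub>R F x) \<bullet> g n x \<partial>M) + (\<integral>x. (c x *\<^sub>R G x) \<bullet> f n x \<partial>M))
      \<longlonglongrightarrow> 0 + (\<integral>x. (c x *\<^sub>R F x) \<bullet> G x \<partial>M) + (\<integral>x. (c x *\<^sub>R G x) \<bullet> F x \<partial>M)"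
    by (intro tendsto_add)
  have "(\<integral>x. (c x *\<^sub>R (f n x - F x)) \<bullet> (g n x - G x) \<partial>M)
      + (\<integral>x. (c x *\<^sub>R F x) \<bullet> g n x \<partial>M) + (\<integral>x. (c x *\<^sub>R G x) \<bullet> f n x \<partial>M)
      - (\<integral>x. (c x *\<^sub>R F x) \<bullet> G x \<partial>M) = (\<integral>x. c x * (f n x \<bullet> g n x) \<partial>M)" for n
  proof -
    note i = L2_inner_integrable[OF cL[OF dL(1)[of n]] dL(2)[of n]]
      L2_inner_integrable[OF cL[OF D(2)] D(4)[of n]] L2_inner_integrable[OF cL[OF D(5)] D(1)[of n]]
      L2_inner_integrable[OF cL[OF D(2)] D(5)]
    have "(\<integral>x. c x * (f n x \<bullet> g n x) \<partial>M) = (\<integral>x. (c x *\<^sub>R (f n x - F x)) \<bullet> (g n x - G x)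
      + (c x *\<^sub>R F x) \<bullet> g n x + (c x *\<^sub>R G x) \<bullet> f n x - (c x *\<^sub>R F x) \<bullet> G x \<partial>M)"
      by (intro Bochner_Integration.integral_cong) (auto simp: algebra_simps inner_commute)
    then show ?thesis by (simp only: Bochner_Integration.integral_diff Bochner_Integration.integral_add i Bochner_Integration.integrable_add)
  qed
  then have eq: "(\<lambda>n. \<integral>x. c x * (f n x \<bullet> g n x) \<partial>M) = (\<lambda>n. (\<integral>x. (c x *\<^sub>R (f n x - F x)) \<bullet> (g n x - G x) \<partial>M)
      + (\<integral>x. (c x *\<^sub>R F x) \<bullet> g n x \<partial>M) + (\<integral>x. (c x *\<^sub>R G x) \<bullet> f n x \<partial>M)
      - (\<integral>x. (c x *\<^sub>R F x) \<bullet> G x \<partial>M))" by (simp add: fun_eq_iff)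
  show ?thesis unfolding eq
    using tendsto_diff[OF lim tendsto_const[of "\<integral>x. (c x *\<^sub>R F x) \<bullet> G x \<partial>M"]]
    by (simp add: inner_commute)
qed

section \<open>Completeness of square-integrable functions\<close>

lemma L2_iff_nn_integral:
  "L2 M f \<longleftrightarrow> f \<in> borel_measurable M \<and> (\<integral>\<^sup>+x. ennreal ((norm (f x))\<^sup>2) \<partial>M) < \<infinity>"
  by (auto simp: L2_def integrable_iff_bounded)

lemma L2_nn_integral:
  "L2 M f \<Longrightarrow> (\<integral>\<^sup>+x. ennreal ((norm (f x))\<^sup>2) \<partial>M) = ennreal (\<integral>x. (norm (f x))\<^sup>2 \<partial>M)"
  by (intro nn_integral_eq_integral) (auto simp: L2_def)

lemma ennreal_le_suminf: "f k \<le> suminf f" for f :: "nat \<Rightarrow> ennreal"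
  using sum_le_suminf[OF summableI, where I="{k}" and f=f] by simp

text \<open>Riesz-Fischer. Along a subsequence the squared increments integrate to less than
  \<open>(1/8)^k\<close>; weighted by \<open>4^k\<close> they remain summable, so almost everywhere
  the k-th increment is at most a constant times \<open>(1/2)^k\<close> and the subsequence
  converges. Fatou's lemma then bounds the distance of the original sequence from the limit.\<close>

lemma L2_complete:
  fixes f :: "nat \<Rightarrow> 'a \<Rightarrow> 'b::euclidean_space"
  assumes L: "\<And>n. L2 M (f n)"
    and C: "\<And>e. e > 0 \<Longrightarrow> \<exists>N. \<forall>m\<ge>N. \<forall>n\<ge>N. (\<integral>x. (norm (f m x - f n x))\<^sup>2 \<partial>M) < e"
  obtains g where "L2_tendsto M f g"
proof -
  note [measurable] = L[THEN L2_measurable]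
  have "\<forall>k. \<exists>N. \<forall>m\<ge>N. \<forall>n\<ge>N. (\<integral>x. (norm (f m x - f n x))\<^sup>2 \<partial>M) < (1/8::real)^k"
    by (intro allI C) simp
  then obtain N where N: "\<And>k m n. m \<ge> N k \<Longrightarrow> n \<ge> N k \<Longrightarrow> (\<integral>x. (norm (f m x - f n x))\<^sup>2 \<partial>M) < (1/8::real)^k"
    by metis
  \<comment> \<open>Summing the thresholds makes both \<open>r k\<close> and
    \<open>r (Suc k)\<close> reach \<open>N k\<close>; the extra \<open>k\<close> makes the indices
    eventually pass any given threshold, as the Fatou argument requires.\<close>
  define r where "r k = (\<Sum>j\<le>k. N j) + k" for k
  have rN: "r k \<ge> N k" "r (Suc k) \<ge> N k" "r k \<ge> k" for k
    using member_le_sum[of k "{..k}" N] by (auto simp: r_def)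
  define d where "d k x = f (r (Suc k)) x - f (r k) x" for k x
  have dL: "L2 M (d k)" for k unfolding d_def[abs_def] by (intro L2_diff L)
  note [measurable] = dL[THEN L2_measurable]
  have d: "(\<integral>\<^sup>+x. ennreal (4^k * (norm (d k x))\<^sup>2) \<partial>M) \<le> ennreal ((1/2)^k)" for k
  proof -
    have "(\<integral>\<^sup>+x. ennreal (4^k * (norm (d k x))\<^sup>2) \<partial>M) = ennreal (\<integral>x. 4^k * (norm (d k x))\<^sup>2 \<partial>M)"
      using L2_integrable[OF dL] by (intro nn_integral_eq_integral) auto
    also have "\<dots> = ennreal (4^k * (\<integral>x. (norm (d k x))\<^sup>2 \<partial>M))" by simp
    also have "\<dots> \<le> ennreal (4^k * (1/8)^k)"
      using N[OF rN(2) rN(1), of k] by (intro ennreal_leI mult_left_mono) (auto simp: d_def)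
    also have "4^k * (1/8::real)^k = (1/2)^k" by (simp flip: power_mult_distrib)
    finally show ?thesis .
  qed
  have "(\<integral>\<^sup>+x. (\<Sum>k. ennreal (4^k * (norm (d k x))\<^sup>2)) \<partial>M) = (\<Sum>k. \<integral>\<^sup>+x. ennreal (4^k * (norm (d k x))\<^sup>2) \<partial>M)"
    by (rule nn_integral_suminf) measurable
  also have "\<dots> \<le> (\<Sum>k. ennreal ((1/2)^k))" by (intro suminf_le d) auto
  also have "\<dots> = ennreal (\<Sum>k. (1/2)^k)" by (intro suminf_ennreal_eq) (auto intro!: summable_sums summable_geometric)
  also have "\<dots> < \<infinity>" by simp
  finally have fin: "(\<integral>\<^sup>+x. (\<Sum>k. ennreal (4^k * (norm (d k x))\<^sup>2)) \<partial>M) < \<infinity>" .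
  have "(\<lambda>x. \<Sum>k. ennreal (4^k * (norm (d k x))\<^sup>2)) \<in> borel_measurable M" by measurable
  then have "AE x in M. (\<Sum>k. ennreal (4^k * (norm (d k x))\<^sup>2)) \<noteq> \<infinity>"
    by (rule nn_integral_noteq_infinite) (rule less_imp_neq[OF fin])
  then have conv: "AE x in M. convergent (\<lambda>k. f (r k) x)"
  proof eventually_elim
    case (elim x)
    define S where "S = (\<Sum>k. ennreal (4^k * (norm (d k x))\<^sup>2))"
    define c where "c = enn2real S"
    have "S \<noteq> top" using elim unfolding S_def infinity_ennreal_def .
    then have c: "S = ennreal c" "c \<ge> 0" unfolding c_def by (simp_all add: less_top)
    have b: "norm (d k x) \<le> sqrt c * (1/2)^k" for k
    proof -
      have "ennreal (4^k * (norm (d k x))\<^sup>2) \<le> ennreal c"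
        unfolding c(1)[symmetric] S_def by (rule ennreal_le_suminf)
      then have "4^k * (norm (d k x))\<^sup>2 \<le> c" using c(2) by simp
      moreover have "(4::real)^k = (2^k)\<^sup>2" by (simp add: power2_eq_square flip: power_mult_distrib)
      ultimately have "(2^k * norm (d k x))\<^sup>2 \<le> c" by (simp add: power_mult_distrib)
      then have "2^k * norm (d k x) \<le> sqrt c" by (rule real_le_rsqrt)
      then show ?thesis by (simp add: power_one_over field_simps)
    qed
    have "summable (\<lambda>k. sqrt c * (1/2)^k)" by (intro summable_mult summable_geometric) auto
    then have "summable (\<lambda>k. d k x)" by (rule summable_comparison_test'[where N=0]) (use b in auto)
    then have "convergent (\<lambda>n. \<Sum>k<n. d k x)" by (simp add: summable_iff_convergent)
    moreover have "(\<Sum>k<n. d k x) = f (r n) x - f (r 0) x" for n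
      unfolding d_def by (rule sum_lessThan_telescope)
    ultimately have "convergent (\<lambda>n. (f (r n) x - f (r 0) x) + f (r 0) x)"
      by (intro convergent_add convergent_const) simp
    then show ?case by simp
  qed
  define g where "g x = lim (\<lambda>k. f (r k) x)" for x
  have [measurable]: "g \<in> borel_measurable M" unfolding g_def[abs_def] by measurable
  have le: "(\<integral>\<^sup>+x. ennreal ((norm (f n x - g x))\<^sup>2) \<partial>M) \<le> ennreal e"
    if n: "\<And>m. m \<ge> K \<Longrightarrow> (\<integral>x. (norm (f n x - f m x))\<^sup>2 \<partial>M) < e" for n K e
  proof -
    have "(\<integral>\<^sup>+x. ennreal ((norm (f n x - g x))\<^sup>2) \<partial>M)
       = (\<integral>\<^sup>+x. liminf (\<lambda>k. ennreal ((norm (f n x - f (r (k + K)) x))\<^sup>2)) \<partial>M)"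
    proof (rule nn_integral_cong_AE)
      show "AE x in M. ennreal ((norm (f n x - g x))\<^sup>2) = liminf (\<lambda>k. ennreal ((norm (f n x - f (r (k + K)) x))\<^sup>2))"
        using conv
      proof eventually_elim
        case (elim x)
        then have "(\<lambda>k. f (r k) x) \<longlonglongrightarrow> g x" by (simp add: g_def convergent_LIMSEQ_iff)
        then have "(\<lambda>k. f (r (k + K)) x) \<longlonglongrightarrow> g x" by (rule LIMSEQ_ignore_initial_segment)
        then have "(\<lambda>k. ennreal ((norm (f n x - f (r (k + K)) x))\<^sup>2)) \<longlonglongrightarrow> ennreal ((norm (f n x - g x))\<^sup>2)"
          by (intro tendsto_intros)
        then show ?case by (rule lim_imp_Liminf[OF trivial_limit_sequentially, symmetric])
      qed
    qed
    also have "\<dots> \<le> liminf (\<lambda>k. \<integral>\<^sup>+x. ennreal ((norm (f n x - f (r (k + K)) x))\<^sup>2) \<partial>M)"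
      by (rule nn_integral_liminf) measurable
    also have "\<dots> \<le> liminf (\<lambda>k. ennreal e)"
    proof (rule Liminf_mono, rule always_eventually, rule allI)
      fix k
      show "(\<integral>\<^sup>+x. ennreal ((norm (f n x - f (r (k + K)) x))\<^sup>2) \<partial>M) \<le> ennreal e"
        unfolding L2_nn_integral[OF L2_diff[OF L L]] using n[of "r (k + K)"] rN(3)[of "k + K"]
        by (intro ennreal_leI less_imp_le) simp
    qed
    also have "\<dots> = ennreal e" by (simp add: Liminf_const)
    finally show ?thesis .
  qed
  have LD: "L2 M (\<lambda>x. f n x - g x)" "(\<integral>x. (norm (f n x - g x))\<^sup>2 \<partial>M) \<le> e"
    if n: "\<And>m. m \<ge> K \<Longrightarrow> (\<integral>x. (norm (f n x - f m x))\<^sup>2 \<partial>M) < e" for n K e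
  proof -
    have e: "e \<ge> 0"
      by (rule order_trans[OF _ less_imp_le[OF n[OF order_refl]]]) simp
    show *: "L2 M (\<lambda>x. f n x - g x)"
      unfolding L2_iff_nn_integral
      using le_less_trans[OF le[of K n e, OF n] ennreal_less_top] by simp
    show "(\<integral>x. (norm (f n x - g x))\<^sup>2 \<partial>M) \<le> e"
      using le[of K n e, OF n] e unfolding L2_nn_integral[OF *] by simp
  qed
  obtain K where K: "\<And>m n. m \<ge> K \<Longrightarrow> n \<ge> K \<Longrightarrow> (\<integral>x. (norm (f m x - f n x))\<^sup>2 \<partial>M) < 1"
    using C[of 1] by auto
  have "L2 M (\<lambda>x. f K x - (f K x - g x))"
    by (intro L2_diff L LD(1)[where e=1 and K=K] K) auto
  then have gL: "L2 M g" by simp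
  have "(\<lambda>n. \<integral>x. (norm (f n x - g x))\<^sup>2 \<partial>M) \<longlonglongrightarrow> 0"
  proof (rule LIMSEQ_I)
    fix e :: real assume "e > 0"
    then obtain K where K: "\<And>m n. m \<ge> K \<Longrightarrow> n \<ge> K \<Longrightarrow> (\<integral>x. (norm (f m x - f n x))\<^sup>2 \<partial>M) < e/2"
      using C[of "e/2"] by auto
    have "norm ((\<integral>x. (norm (f n x - g x))\<^sup>2 \<partial>M) - 0) < e" if "n \<ge> K" for n
      using LD(2)[of K n "e/2"] K[OF that] \<open>e > 0\<close> by fastforce
    then show "\<exists>K. \<forall>n\<ge>K. norm ((\<integral>x. (norm (f n x - g x))\<^sup>2 \<partial>M) - 0) < e" by blast
  qed
  then show ?thesis using that L gL by (auto simp: L2_tendsto_def)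
qed

section \<open>Weak gradients of limits of smooth functions\<close>

lemma bounded_on_compact:
  assumes "compact S" "continuous_on S f"
  obtains B where "\<And>x. x \<in> S \<Longrightarrow> norm (f x) \<le> B"
proof -
  have "bounded (f ` S)" by (intro compact_imp_bounded compact_continuous_image assms)
  then obtain B where "\<forall>y\<in>f ` S. norm y \<le> B" unfolding bounded_iff by blast
  then show ?thesis using that by blast
qed

lemma finite_measure_lebesgue_on_bounded:
  assumes "open K" "bounded K" shows "finite_measure (lebesgue_on (K::R3 set))"
  using assms by (intro finite_measure_lebesgue_on lmeasurable_open)

lemma L2_continuous:
  fixes f :: "R3 \<Rightarrow> 'b::euclidean_space"
  assumes K: "open K" "bounded K" and f: "continuous_on UNIV f"
  shows "L2 (lebesgue_on K) f"
proof -
  interpret finite_measure "lebesgue_on K" by (rule finite_measure_lebesgue_on_bounded[OF K])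
  have m: "f \<in> borel_measurable (lebesgue_on K)"
    using f K by (intro continuous_imp_measurable_on_sets_lebesgue) (auto intro: continuous_on_subset)
  have "compact (closure K)" using K by simp
  then obtain B where B: "\<And>x. x \<in> closure K \<Longrightarrow> norm (f x) \<le> B"
    using continuous_on_subset[OF f subset_UNIV] by (rule bounded_on_compact) blast
  have "integrable (lebesgue_on K) (\<lambda>x. (norm (f x))\<^sup>2)"
  proof (rule integrable_const_bound[of _ "B\<^sup>2"])
    show "AE x in lebesgue_on K. norm ((norm (f x))\<^sup>2) \<le> B\<^sup>2"
      using B closure_subset[of K] by (intro AE_I2) (auto intro!: power_mono)
  qed (use m in measurable)
  with m show ?thesis by (simp add: L2_def)
qed

lemma smooth_measurable: "smooth u \<Longrightarrow> u \<in> borel_measurable borel"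
  by (intro borel_measurable_continuous_onI smooth_continuous)

lemma L2_smooth: "open K \<Longrightarrow> bounded K \<Longrightarrow> smooth u \<Longrightarrow> L2 (lebesgue_on K) u"
  by (intro L2_continuous smooth_continuous)

lemma L2_smooth_grad: "open K \<Longrightarrow> bounded K \<Longrightarrow> smooth u \<Longrightarrow> L2 (lebesgue_on K) (grad u)"
  by (intro L2_continuous smooth_grad_continuous)

text \<open>Leads from \<open>lebesgue_on K\<close> to \<open>lborel\<close> on the whole space,
  where translation invariance can be used.\<close>

lemma integral_lebesgue_on_supported:
  fixes f :: "R3 \<Rightarrow> real"
  assumes "open K" "f \<in> borel_measurable borel" "\<And>x. x \<notin> K \<Longrightarrow> f x = 0"
  shows "(\<integral>x. f x \<partial>lebesgue_on K) = (\<integral>x. f x \<partial>lborel)"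
proof -
  have "(\<integral>x. f x \<partial>lebesgue_on K) = (\<integral>x. indicator K x *\<^sub>R f x \<partial>lebesgue)"
    using assms(1) by (intro integral_restrict_space) auto
  also have "(\<lambda>x. indicator K x *\<^sub>R f x) = f"
    using assms(3) by (auto simp: indicator_def fun_eq_iff)
  also have "(\<integral>x. f x \<partial>lebesgue) = (\<integral>x. f x \<partial>lborel)"
    using assms(2) by (intro integral_completion) simp
  finally show ?thesis .
qed

lemma smooth_lipschitz:
  assumes "smooth f" "\<And>x. norm (grad f x) \<le> B"
  shows "\<bar>f x - f y\<bar> \<le> B * norm (x - y)"
proof -
  have "norm (f x - f y) \<le> B * norm (x - y)"
  proof (rule differentiable_bound[of UNIV f "\<lambda>x h. grad f x \<bullet> h"])
    show "onorm (\<lambda>h. grad f x \<bullet> h) \<le> B" for x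
      by (rule onorm_le) (metis Cauchy_Schwarz_ineq2 assms(2) mult_right_mono norm_ge_zero order_trans real_norm_def)
  qed (use smooth_has_derivative[OF assms(1)] in auto)
  then show ?thesis by simp
qed

lemma smooth_directional_limit:
  assumes "smooth f"
  shows "(\<lambda>n. (f (x + inverse (real (Suc n)) *\<^sub>R e) - f x) / inverse (real (Suc n))) \<longlonglongrightarrow> grad f x \<bullet> e"
proof -
  have "((\<lambda>t. x + t *\<^sub>R e) has_derivative (\<lambda>t. t *\<^sub>R e)) (at 0)"
    by (auto intro!: derivative_eq_intros)
  from has_derivative_compose[OF this, of f "\<lambda>h. grad f x \<bullet> h"]
  have "((\<lambda>t. f (x + t *\<^sub>R e)) has_real_derivative (grad f x \<bullet> e)) (at 0)"
    using smooth_has_derivative[OF assms, of x] by (simp add: has_field_derivative_def mult_commute_abs)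
  then have "((\<lambda>t. (f (x + t *\<^sub>R e) - f x) / t) \<longlongrightarrow> grad f x \<bullet> e) (at 0)"
    by (simp add: DERIV_def)
  then show ?thesis
    by (rule filterlim_compose, intro filterlim_atI LIMSEQ_inverse_real_of_nat) auto
qed

text \<open>Difference quotients have integral zero by translation invariance.\<close>

lemma integral_grad_zero:
  assumes f: "smooth f" and supp: "\<And>x. R < norm x \<Longrightarrow> f x = 0" "\<And>x. R < norm x \<Longrightarrow> grad f x = 0"
  shows "(\<integral>x. grad f x \<bullet> e \<partial>lborel) = 0"
proof -
  have [measurable]: "f \<in> borel_measurable borel" by (rule smooth_measurable[OF f])
  obtain B where B: "\<And>x. x \<in> cball 0 R \<Longrightarrow> norm (grad f x) \<le> B"
    by (rule bounded_on_compact[OF compact_cball smooth_grad_continuous[OF f]]) blast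
  define L where "L = max B 0"
  have L: "norm (grad f x) \<le> L" for x
    using B[of x] supp(2)[of x] by (cases "R < norm x") (auto simp: L_def)
  obtain B' where B': "\<And>x. x \<in> cball 0 R \<Longrightarrow> norm (f x) \<le> B'"
    by (rule bounded_on_compact[OF compact_cball smooth_continuous[OF f]]) blast
  have fin: "emeasure lborel (cball (0::R3) r) < \<infinity>" for r
    by (rule emeasure_bounded_finite) simp
  have int: "integrable lborel f"
  proof (rule Bochner_Integration.integrable_bound)
    show "integrable lborel (\<lambda>x. \<bar>B'\<bar> * indicator (cball (0::R3) R) x)"
      by (intro integrable_mult_right integrable_real_indicator) (use fin in auto)
    show "AE x in lborel. norm (f x) \<le> norm (\<bar>B'\<bar> * indicator (cball (0::R3) R) x)"
    proof (rule AE_I2)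
      fix x show "norm (f x) \<le> norm (\<bar>B'\<bar> * indicator (cball (0::R3) R) x)"
        using B'[of x] supp(1)[of x] by (cases "R < norm x") (auto simp: indicator_def)
    qed
  qed simp
  define h where "h n = inverse (real (Suc n))" for n
  have h: "0 < h n" "h n \<le> 1" for n by (auto simp: h_def field_simps)
  define D where "D n x = (f (x + h n *\<^sub>R e) - f x) / h n" for n x
  have [measurable]: "D n \<in> borel_measurable borel" for n unfolding D_def[abs_def] by measurable
  have tr: "integrable lborel (\<lambda>x. f (x + a))" "(\<integral>x. f (x + a) \<partial>lborel) = (\<integral>x. f x \<partial>lborel)" for a
  proof -
    have "integrable (distr lborel borel ((+) a)) f" using int by (simp add: lborel_distr_plus)
    then show "integrable lborel (\<lambda>x. f (x + a))" by (simp add: integrable_distr_eq add.commute)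
    have "(\<integral>x. f x \<partial>distr lborel borel ((+) a)) = (\<integral>x. f (x + a) \<partial>lborel)"
      by (subst integral_distr) (simp_all add: add.commute)
    then show "(\<integral>x. f (x + a) \<partial>lborel) = (\<integral>x. f x \<partial>lborel)" by (simp add: lborel_distr_plus)
  qed
  have D0: "(\<integral>x. D n x \<partial>lborel) = 0" for n
    unfolding D_def using tr int by simp
  have "(\<lambda>n. \<integral>x. D n x \<partial>lborel) \<longlonglongrightarrow> (\<integral>x. grad f x \<bullet> e \<partial>lborel)"
  \<comment> \<open>The quotients are at most \<open>L * norm e\<close> because \<open>f\<close> is
    \<open>L\<close>-Lipschitz. Since \<open>h n \<le> 1\<close>, both \<open>x\<close> and its
    translate have norm above \<open>R\<close> when \<open>x\<close> lies outside the ball of radius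
    \<open>R + norm e\<close>.\<close>
  proof (rule integral_dominated_convergence[where w="\<lambda>x. L * norm e * indicator (cball 0 (R + norm e)) x"])
    show "(\<lambda>x. grad f x \<bullet> e) \<in> borel_measurable lborel"
      using smooth_grad_continuous[OF f] by (auto intro!: borel_measurable_continuous_onI continuous_intros)
    show "integrable lborel (\<lambda>x. L * norm e * indicator (cball (0::R3) (R + norm e)) x)"
      by (intro integrable_mult_right integrable_real_indicator) (use fin in auto)
    show "AE x in lborel. (\<lambda>n. D n x) \<longlonglongrightarrow> grad f x \<bullet> e"
      unfolding D_def h_def by (intro AE_I2 smooth_directional_limit f)
    show "AE x in lborel. norm (D n x) \<le> L * norm e * indicator (cball 0 (R + norm e)) x" for n
    proof (rule AE_I2)
      fix x
      show "norm (D n x) \<le> L * norm e * indicator (cball 0 (R + norm e)) x"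
      proof (cases "x \<in> cball 0 (R + norm e)")
        case True
        have "\<bar>f (x + h n *\<^sub>R e) - f x\<bar> \<le> L * norm (x + h n *\<^sub>R e - x)"
          by (rule smooth_lipschitz[OF f L])
        then show ?thesis using True h[of n] by (simp add: D_def field_simps)
      next
        case False
        then have 1: "R + norm e < norm x" by simp
        have "h n * norm e \<le> 1 * norm e" using h[of n] by (intro mult_right_mono) auto
        moreover have "norm x \<le> norm (x + h n *\<^sub>R e) + norm (h n *\<^sub>R e)"
          using norm_triangle_ineq4[of "x + h n *\<^sub>R e" "h n *\<^sub>R e"] by simp
        ultimately have "R < norm (x + h n *\<^sub>R e)" using 1 h[of n] by simp
        moreover have "R < norm x" using 1 norm_ge_zero[of e] by linarith
        ultimately show ?thesis using False by (simp add: D_def supp(1))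
      qed
    qed
  qed (auto)
  then show ?thesis by (simp add: D0 LIMSEQ_const_iff)
qed

text \<open>The product of \<open>u\<close> and \<phi> is smooth and vanishes off the bounded set
  \<open>K\<close> together with its gradient, so its partial derivatives integrate to zero; the
  product rule does the rest.\<close>

lemma integration_by_parts_test_function:
  assumes K: "open K" "bounded K" and u: "smooth u" and phi: "test_function K \<phi>"
  shows "(\<integral>x. u x * grad \<phi> x $ i \<partial>lebesgue_on K) = - (\<integral>x. grad u x $ i * \<phi> x \<partial>lebesgue_on K)"
proof -
  have sphi: "smooth \<phi>" by (rule test_function_smooth[OF phi])
  let ?f = "\<lambda>x. u x * \<phi> x"
  obtain R where R: "\<And>x. x \<in> K \<Longrightarrow> norm x \<le> R" using K(2) bounded_iff by blast
  have g: "grad ?f x = u x *\<^sub>R grad \<phi> x + \<phi> x *\<^sub>R grad u x" for x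
    by (rule grad_mult[OF u sphi])
  have out: "\<phi> x = 0" "grad \<phi> x = 0" if "x \<notin> K" for x
    using that test_function_zero[OF phi] test_function_grad_zero[OF phi] by auto
  have c: "continuous_on UNIV (\<lambda>x. grad ?f x $ i)"
    using smooth_grad_continuous[OF smooth_mult[OF u sphi]] by (intro continuous_intros)
  have "(\<integral>x. grad ?f x \<bullet> axis i 1 \<partial>lborel) = 0"
  proof (rule integral_grad_zero[of _ R])
    show "smooth ?f" by (rule smooth_mult[OF u sphi])
    show "u x * \<phi> x = 0" if "R < norm x" for x using R[of x] that out(1)[of x] by force
    show "grad ?f x = 0" if "R < norm x" for x
      unfolding g using R[of x] that out[of x] by force
  qed
  then have "0 = (\<integral>x. grad ?f x $ i \<partial>lborel)" by (simp add: inner_axis)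
  also have "\<dots> = (\<integral>x. grad ?f x $ i \<partial>lebesgue_on K)"
    by (rule integral_lebesgue_on_supported[symmetric, OF K(1) borel_measurable_continuous_onI[OF c]])
      (simp add: g out)
  also have "\<dots> = (\<integral>x. u x * grad \<phi> x $ i + grad u x $ i * \<phi> x \<partial>lebesgue_on K)"
    unfolding g by (simp add: mult.commute)
  also have "\<dots> = (\<integral>x. u x * grad \<phi> x $ i \<partial>lebesgue_on K) + (\<integral>x. grad u x $ i * \<phi> x \<partial>lebesgue_on K)"
    by (intro Bochner_Integration.integral_add L2_mult_integrable L2_continuous K
        continuous_intros smooth_grad_continuous smooth_continuous u sphi)
  finally show ?thesis by simp
qed

text \<open>For a fixed test function both sides of the integration by parts formula are continuous
  under \<open>L2\<close> convergence of the function and of its gradient.\<close>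

lemma weak_grad_limit:
  assumes K: "open K" "bounded K" and u: "\<And>n. smooth (u n)"
    and v: "L2_tendsto (lebesgue_on K) u v" and G: "L2_tendsto (lebesgue_on K) (\<lambda>n. grad (u n)) G"
  shows "weak_grad K v G"
  unfolding weak_grad_def
proof (intro conjI allI impI)
  show "L2 (lebesgue_on K) v" "L2 (lebesgue_on K) G"
    using L2_tendstoD[OF v] L2_tendstoD[OF G] by auto
  fix \<phi> i assume phi: "test_function K \<phi>"
  have sphi: "smooth \<phi>" by (rule test_function_smooth[OF phi])
  have "(\<lambda>n. \<integral>x. grad \<phi> x $ i \<bullet> u n x \<partial>lebesgue_on K) \<longlonglongrightarrow> (\<integral>x. grad \<phi> x $ i \<bullet> v x \<partial>lebesgue_on K)"
    by (intro L2_tendsto_inner_right[OF v] L2_continuous K continuous_intros smooth_grad_continuous sphi)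
  then have 1: "(\<lambda>n. \<integral>x. u n x * grad \<phi> x $ i \<partial>lebesgue_on K) \<longlonglongrightarrow> (\<integral>x. v x * grad \<phi> x $ i \<partial>lebesgue_on K)"
    by (simp add: mult.commute)
  have "(\<lambda>n. \<integral>x. (\<phi> x *\<^sub>R axis i 1) \<bullet> grad (u n) x \<partial>lebesgue_on K)
      \<longlonglongrightarrow> (\<integral>x. (\<phi> x *\<^sub>R axis i 1) \<bullet> G x \<partial>lebesgue_on K)"
    by (intro L2_tendsto_inner_right[OF G] L2_continuous K continuous_intros smooth_continuous sphi)
  then have 2: "(\<lambda>n. - (\<integral>x. grad (u n) x $ i * \<phi> x \<partial>lebesgue_on K)) \<longlonglongrightarrow> - (\<integral>x. G x $ i * \<phi> x \<partial>lebesgue_on K)"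
    by (intro tendsto_minus) (simp add: inner_axis' mult.commute)
  show "(\<integral>x. v x * grad \<phi> x $ i \<partial>lebesgue_on K) = - (\<integral>x. G x $ i * \<phi> x \<partial>lebesgue_on K)"
    using LIMSEQ_unique[OF 1[unfolded integration_by_parts_test_function[OF K u phi]] 2] .
qed

section \<open>Cutoff functions for polytopes\<close>

text \<open>A pair stands for an affine form. Intersecting two polytopes amounts to taking the union
  of their sets of forms, so tetrahedra, boxes and intersections of both share one cutoff
  construction.\<close>

definition halfspaces :: "(R3 \<times> real) set \<Rightarrow> R3 set" where
  "halfspaces P = {x. \<forall>(p, q)\<in>P. 0 < p \<bullet> x + q}"

definition cutoff :: "(R3 \<times> real) set \<Rightarrow> real \<Rightarrow> R3 \<Rightarrow> real" where
  "cutoff P \<epsilon> x = (\<Prod>(p, q)\<in>P. smooth_step ((p \<bullet> x + q) / \<epsilon>))"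

lemma halfspaces_Un: "halfspaces (P \<union> Q) = halfspaces P \<inter> halfspaces Q"
  by (auto simp: halfspaces_def)

lemma open_halfspaces: assumes "finite P" shows "open (halfspaces P)"
proof -
  have "halfspaces P = (\<Inter>z\<in>P. {x. 0 < fst z \<bullet> x + snd z})"
    by (auto simp: halfspaces_def case_prod_beta)
  moreover have "open {x. 0 < fst z \<bullet> x + snd z}" for z :: "R3 \<times> real"
    by (intro open_Collect_less continuous_intros)
  ultimately show ?thesis using assms by auto
qed

lemma box_halfspaces: "\<exists>P. finite P \<and> box l u = halfspaces P" for l u :: R3
proof -
  define P where "P = (\<lambda>e. (e, - (l \<bullet> e))) ` (Basis :: R3 set) \<union> (\<lambda>e. (- e, u \<bullet> e)) ` Basis"
  have "finite P" by (simp add: P_def)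
  moreover have "box l u = halfspaces P"
    unfolding P_def halfspaces_def box_def ball_Un ball_simps(9)
    by (auto simp: inner_commute)
  ultimately show ?thesis by blast
qed

lemma cutoff_bounds: "0 \<le> cutoff P \<epsilon> x" "cutoff P \<epsilon> x \<le> 1"
  unfolding cutoff_def
  by (auto intro!: prod_nonneg prod_le_1 simp: smooth_step_bounds split: prod.splits)

lemma smooth_scaled_step: "smooth (\<lambda>x. smooth_step ((p \<bullet> x + q) / \<epsilon>))"
proof -
  have "(p \<bullet> x + q) / \<epsilon> = (p /\<^sub>R \<epsilon>) \<bullet> x + q / \<epsilon>" for x
    by (simp add: add_divide_distrib divide_inverse algebra_simps)
  then show ?thesis using smooth_smooth_step[OF smooth_affine, of "p /\<^sub>R \<epsilon>" "q / \<epsilon>"] by (simp only:)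
qed

lemma smooth_cutoff: "smooth (cutoff P \<epsilon>)"
  unfolding cutoff_def[abs_def] by (intro smooth_prod) (auto simp: smooth_scaled_step split: prod.splits)

lemma cutoff_nonzero: "cutoff P \<epsilon> x \<noteq> 0 \<Longrightarrow> 0 < \<epsilon> \<Longrightarrow> finite P \<Longrightarrow> (p, q) \<in> P \<Longrightarrow> \<epsilon> \<le> p \<bullet> x + q"
proof (rule ccontr)
  assume *: "cutoff P \<epsilon> x \<noteq> 0" "0 < \<epsilon>" "finite P" "(p, q) \<in> P" "\<not> \<epsilon> \<le> p \<bullet> x + q"
  then have "smooth_step ((p \<bullet> x + q) / \<epsilon>) = 0" by (intro smooth_step_eq_0) simp
  then show False using * by (auto simp: cutoff_def intro!: prod_zero)
qed

text \<open>The support is a closure, so it does not suffice that the forms are positive where the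
  cutoff is nonzero: there they are at least \<epsilon>, and this is a closed condition.\<close>

lemma test_function_cutoff:
  assumes P: "finite P" "bounded (halfspaces P)" and "0 < \<epsilon>"
  shows "test_function (halfspaces P) (cutoff P \<epsilon>)"
proof -
  define C where "C = (\<Inter>z\<in>P. {x. \<epsilon> \<le> fst z \<bullet> x + snd z})"
  have "closed C" unfolding C_def
    by (intro closed_INT ballI closed_Collect_le continuous_intros)
  moreover have "{x. cutoff P \<epsilon> x \<noteq> 0} \<subseteq> C"
    using cutoff_nonzero[of P \<epsilon>] assms by (auto simp: C_def)
  ultimately have "closure {x. cutoff P \<epsilon> x \<noteq> 0} \<subseteq> C" by (rule closure_minimal[rotated])
  also have "C \<subseteq> halfspaces P" using \<open>0 < \<epsilon>\<close> by (force simp: C_def halfspaces_def)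
  finally have *: "closure {x. cutoff P \<epsilon> x \<noteq> 0} \<subseteq> halfspaces P" .
  moreover have "compact (closure {x. cutoff P \<epsilon> x \<noteq> 0})"
    using bounded_subset[OF P(2) *] by (simp add: compact_eq_bounded_closed)
  ultimately show ?thesis by (simp add: test_function_def smooth_cutoff)
qed

lemma cutoff_eq_1:
  assumes "0 < \<epsilon>" "\<And>p q. (p, q) \<in> P \<Longrightarrow> 2 * \<epsilon> \<le> p \<bullet> x + q" shows "cutoff P \<epsilon> x = 1"
  unfolding cutoff_def
proof (rule prod.neutral, rule ballI)
  fix z assume "z \<in> P"
  then show "(case z of (p, q) \<Rightarrow> smooth_step ((p \<bullet> x + q) / \<epsilon>)) = 1"
    using assms by (auto intro!: smooth_step_eq_1 simp: field_simps split: prod.splits)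
qed

lemma halfspaces_margin:
  assumes "finite P" "x \<in> halfspaces P"
  obtains d where "0 < d" "\<And>p q. (p, q) \<in> P \<Longrightarrow> d \<le> p \<bullet> x + q"
proof (cases "P = {}")
  case False
  let ?V = "(\<lambda>(p, q). p \<bullet> x + q) ` P"
  have V: "finite ?V" "?V \<noteq> {}" using assms False by auto
  then have "Min ?V \<in> ?V" by (rule Min_in)
  then have "0 < Min ?V" using assms(2) by (auto simp: halfspaces_def)
  then show ?thesis using that[of "Min ?V"] Min_le[OF V(1)] by force
qed (use that[of 1] in auto)

lemma cutoff_tendsto_1:
  assumes "finite P" "x \<in> halfspaces P"
  shows "(\<lambda>n. cutoff P (inverse (real (Suc n))) x) \<longlonglongrightarrow> 1"
proof -
  obtain d where d: "d > 0" "\<And>p q. (p, q) \<in> P \<Longrightarrow> d \<le> p \<bullet> x + q"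
    using halfspaces_margin[OF assms] by blast
  have "\<forall>\<^sub>F n in sequentially. inverse (real (Suc n)) < d / 2"
    using order_tendstoD(2)[OF LIMSEQ_inverse_real_of_nat, of "d/2"] d(1) by simp
  then have "\<forall>\<^sub>F n in sequentially. cutoff P (inverse (real (Suc n))) x = 1"
  proof eventually_elim
    case (elim n)
    show ?case
    proof (rule cutoff_eq_1)
      fix p q assume "(p, q) \<in> P"
      then show "2 * inverse (real (Suc n)) \<le> p \<bullet> x + q" using d(2)[of p q] elim by linarith
    qed simp
  qed
  then show ?thesis by (rule tendsto_eventually)
qed

text \<open>The product rule is applied form by form. All other factors lie between 0 and 1, so each
  form contributes at most \<open>H / \<epsilon> * norm p\<close>, with an \<open>H\<close> that
  depends only on the step. The last clause confines the gradient to the layers where some form is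
  at most 2\<epsilon>.\<close>

lemma cutoff_grad:
  obtains H where "H \<ge> 0"
    "\<And>P \<epsilon> x. finite P \<Longrightarrow> 0 < \<epsilon> \<Longrightarrow> norm (grad (cutoff P \<epsilon>) x) \<le> H / \<epsilon> * (\<Sum>(p, q)\<in>P. norm p)"
    "\<And>P \<epsilon> x. finite P \<Longrightarrow> 0 < \<epsilon> \<Longrightarrow> (\<And>p q. (p, q) \<in> P \<Longrightarrow> 2 * \<epsilon> < p \<bullet> x + q) \<Longrightarrow> grad (cutoff P \<epsilon>) x = 0"
proof -
  obtain H d where H: "H \<ge> 0" "\<And>t. (smooth_step has_real_derivative d t) (at t)" "\<And>t. \<bar>d t\<bar> \<le> H"
    "\<And>t. t > 2 \<Longrightarrow> d t = 0" using smooth_step_derivative by blast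
  have g: "grad (\<lambda>x. smooth_step ((p \<bullet> x + q) / \<epsilon>)) x = (d ((p \<bullet> x + q) / \<epsilon>) / \<epsilon>) *\<^sub>R p" for p q \<epsilon> x
  proof -
    have e: "(p \<bullet> x + q) / \<epsilon> = (p /\<^sub>R \<epsilon>) \<bullet> x + q / \<epsilon>" for x
      by (simp add: add_divide_distrib divide_inverse algebra_simps)
    show ?thesis unfolding e
      unfolding grad_comp[OF smooth_affine H(2)] grad_affine by (simp add: divide_inverse)
  qed
  have ins: "cutoff (insert (p, q) P) \<epsilon> = (\<lambda>x. smooth_step ((p \<bullet> x + q) / \<epsilon>) * cutoff P \<epsilon> x)"
    if "finite P" "(p, q) \<notin> P" for p q P \<epsilon>
    using that by (auto simp: cutoff_def fun_eq_iff)
  have gins: "grad (cutoff (insert (p, q) P) \<epsilon>) x = smooth_step ((p \<bullet> x + q) / \<epsilon>) *\<^sub>R grad (cutoff P \<epsilon>) x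
      + (cutoff P \<epsilon> x * (d ((p \<bullet> x + q) / \<epsilon>) / \<epsilon>)) *\<^sub>R p"
    if "finite P" "(p, q) \<notin> P" for p q P \<epsilon> x
    unfolding ins[OF that] grad_mult[OF smooth_scaled_step smooth_cutoff] g by simp
  have g0: "grad (cutoff {} \<epsilon>) x = 0" for \<epsilon> x
    by (simp add: cutoff_def[abs_def] grad_const)
  show ?thesis
  proof (rule that[OF H(1)])
    fix P :: "(R3 \<times> real) set" and \<epsilon> :: real and x :: R3 assume "finite P" "0 < \<epsilon>"
    then show "norm (grad (cutoff P \<epsilon>) x) \<le> H / \<epsilon> * (\<Sum>(p, q)\<in>P. norm p)"
    proof (induction P rule: finite_induct)
      case empty then show ?case by (simp add: g0)
    next
      case (insert z P)
      obtain p q where z: "z = (p, q)" by (cases z)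
      have pq: "finite P" "(p, q) \<notin> P" using insert z by auto
      have 1: "norm (smooth_step ((p \<bullet> x + q) / \<epsilon>) *\<^sub>R grad (cutoff P \<epsilon>) x) \<le> 1 * norm (grad (cutoff P \<epsilon>) x)"
        unfolding norm_scaleR using smooth_step_bounds[of "(p \<bullet> x + q) / \<epsilon>"] by (intro mult_right_mono) auto
      have "\<bar>cutoff P \<epsilon> x\<bar> * \<bar>d ((p \<bullet> x + q) / \<epsilon>) / \<epsilon>\<bar> \<le> 1 * (H / \<epsilon>)"
        using cutoff_bounds[of P \<epsilon> x] H(3)[of "(p \<bullet> x + q) / \<epsilon>"] insert.prems
        by (intro mult_mono) (auto simp: divide_right_mono)
      then have 2: "norm ((cutoff P \<epsilon> x * (d ((p \<bullet> x + q) / \<epsilon>) / \<epsilon>)) *\<^sub>R p) \<le> H / \<epsilon> * norm p"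
        unfolding norm_scaleR abs_mult by (intro mult_right_mono) auto
      have "norm (grad (cutoff (insert z P) \<epsilon>) x) \<le> norm (grad (cutoff P \<epsilon>) x) + H / \<epsilon> * norm p"
        unfolding z gins[OF pq] using norm_triangle_mono[OF 1 2] by simp
      also have "\<dots> \<le> H / \<epsilon> * (\<Sum>(p, q)\<in>P. norm p) + H / \<epsilon> * norm p"
        using insert.IH insert.prems by simp
      also have "\<dots> = H / \<epsilon> * (\<Sum>(p, q)\<in>insert z P. norm p)"
        using pq z by (simp add: algebra_simps)
      finally show ?case .
    qed
  next
    fix P :: "(R3 \<times> real) set" and \<epsilon> :: real and x :: R3
    assume "finite P" "0 < \<epsilon>" "\<And>p q. (p, q) \<in> P \<Longrightarrow> 2 * \<epsilon> < p \<bullet> x + q"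
    then show "grad (cutoff P \<epsilon>) x = 0"
    proof (induction P rule: finite_induct)
      case empty then show ?case by (simp add: g0)
    next
      case (insert z P)
      obtain p q where z: "z = (p, q)" by (cases z)
      have pq: "finite P" "(p, q) \<notin> P" using insert z by auto
      have "2 * \<epsilon> < p \<bullet> x + q" using insert.prems z by simp
      then have "d ((p \<bullet> x + q) / \<epsilon>) = 0" using insert.prems by (intro H(4)) (simp add: field_simps)
      then show ?case using insert unfolding z gins[OF pq] by simp
    qed
  qed
qed

lemma integral_halfspaces_zero:
  fixes h :: "R3 \<Rightarrow> real"
  assumes P: "finite P" "bounded (halfspaces P)" and h: "integrable lborel h"
    and zero: "\<And>\<phi>. test_function (halfspaces P) \<phi> \<Longrightarrow> (\<integral>x. h x * \<phi> x \<partial>lborel) = 0"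
  shows "(LINT x:halfspaces P|lborel. h x) = 0"
proof -
  have "(\<lambda>n. \<integral>x. h x * cutoff P (inverse (real (Suc n))) x \<partial>lborel) \<longlonglongrightarrow> (\<integral>x. indicator (halfspaces P) x * h x \<partial>lborel)"
  proof (rule integral_dominated_convergence[where w="\<lambda>x. \<bar>h x\<bar>"])
    show "(\<lambda>x. indicator (halfspaces P) x * h x) \<in> borel_measurable lborel"
      using h open_halfspaces[OF P(1)] by auto
    show "(\<lambda>x. h x * cutoff P (inverse (real (Suc n))) x) \<in> borel_measurable lborel" for n
      using h smooth_measurable[OF smooth_cutoff] by auto
    show "AE x in lborel. (\<lambda>n. h x * cutoff P (inverse (real (Suc n))) x) \<longlonglongrightarrow> indicator (halfspaces P) x * h x"
    proof (rule AE_I2)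
      fix x
      show "(\<lambda>n. h x * cutoff P (inverse (real (Suc n))) x) \<longlonglongrightarrow> indicator (halfspaces P) x * h x"
      proof (cases "x \<in> halfspaces P")
        case True
        then show ?thesis using tendsto_mult_left[OF cutoff_tendsto_1[OF P(1) True], of "h x"] by simp
      next
        case False
        have "cutoff P (inverse (real (Suc n))) x = 0" for n
          using test_function_zero[OF test_function_cutoff[OF P] False] by simp
        then show ?thesis using False by simp
      qed
    qed
    show "AE x in lborel. norm (h x * cutoff P (inverse (real (Suc n))) x) \<le> \<bar>h x\<bar>" for n
      using cutoff_bounds by (intro AE_I2) (simp add: abs_mult mult_left_le)
  qed (use h in auto)
  moreover have "(\<integral>x. h x * cutoff P (inverse (real (Suc n))) x \<partial>lborel) = 0" for n
    by (intro zero test_function_cutoff P) simp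
  ultimately show ?thesis by (simp add: set_lebesgue_integral_def LIMSEQ_const_iff)
qed

text \<open>Fundamental lemma of the calculus of variations: cutoffs to \<open>K \<inter> box\<close> converge to its
  indicator, so \<open>h\<close> integrates to zero over all boxes.\<close>

lemma AE_zero_of_test_integrals:
  fixes h :: "R3 \<Rightarrow> real"
  assumes P: "finite P" "bounded (halfspaces P)" and h: "L2 (lebesgue_on (halfspaces P)) h"
    and zero: "\<And>\<phi>. test_function (halfspaces P) \<phi> \<Longrightarrow> (\<integral>x. h x * \<phi> x \<partial>lebesgue_on (halfspaces P)) = 0"
  shows "AE x in lebesgue_on (halfspaces P). h x = 0"
proof -
  let ?K = "halfspaces P"
  have oK: "open ?K" by (rule open_halfspaces[OF P(1)])
  have sK: "?K \<inter> space lebesgue \<in> sets lebesgue" using oK by auto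
  have "integrable (lebesgue_on ?K) h"
    using L2_mult_integrable[OF h L2_continuous[OF oK P(2), of "\<lambda>_. 1::real"]] by simp
  then have ih: "integrable lebesgue (\<lambda>x. indicator ?K x * h x)"
    using integrable_restrict_space[OF sK, of h] by simp
  \<comment> \<open>\<open>h\<close> is only Lebesgue measurable on \<open>K\<close>. A Borel
    representative of its extension by zero allows an argument over all Borel sets of the whole
    space.\<close>
  obtain g where g[measurable]: "g \<in> borel_measurable lborel"
    and AEg: "AE x in lborel. indicator ?K x * h x = g x"
    using completion_ex_borel_measurable_real[of "\<lambda>x. indicator ?K x * h x" lborel] ih by auto
  have AEg': "AE x in lebesgue. indicator ?K x * h x = g x" using AEg by (rule AE_completion)
  have hm: "(\<lambda>x. indicator ?K x * h x) \<in> borel_measurable lebesgue"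
    using ih by (rule borel_measurable_integrable)
  have gm: "g \<in> borel_measurable lebesgue" using g by (rule measurable_completion)
  have "integrable lebesgue g" using integrable_cong_AE[OF hm gm AEg'] ih by simp
  then have ig: "integrable lborel g" using integrable_completion[OF g] by simp
  have g0: "AE x in lborel. x \<notin> ?K \<longrightarrow> g x = 0"
    using AEg by eventually_elim (auto simp: indicator_def split: if_splits)
  have int0: "(\<integral>x. g x * \<phi> x \<partial>lborel) = 0" if phi: "test_function ?K \<phi>" for \<phi>
  proof -
    have [measurable]: "\<phi> \<in> borel_measurable borel"
      by (intro smooth_measurable test_function_smooth[OF phi])
    have "(\<integral>x. g x * \<phi> x \<partial>lborel) = (\<integral>x. g x * \<phi> x \<partial>lebesgue)"
      by (rule integral_completion[symmetric]) measurable
    also have "\<dots> = (\<integral>x. indicator ?K x * h x * \<phi> x \<partial>lebesgue)"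
    proof (rule integral_cong_AE)
      show "AE x in lebesgue. g x * \<phi> x = indicator ?K x * h x * \<phi> x"
        using AEg' by eventually_elim simp
      show "(\<lambda>x. g x * \<phi> x) \<in> borel_measurable lebesgue" by (rule measurable_completion) measurable
      have "\<phi> \<in> borel_measurable lebesgue" by (rule measurable_completion) measurable
      then show "(\<lambda>x. indicator ?K x * h x * \<phi> x) \<in> borel_measurable lebesgue"
        by (rule borel_measurable_times[OF hm])
    qed
    also have "\<dots> = (\<integral>x. h x * \<phi> x \<partial>lebesgue_on ?K)"
      by (subst integral_restrict_space[OF sK]) (simp add: mult.assoc)
    finally show ?thesis using zero[OF phi] by simp
  qed
  have box0: "(LINT x:box l u|lborel. g x) = 0" for l u
  proof -
    obtain Q where Q: "finite Q" "box l u = halfspaces Q" using box_halfspaces by blast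
    have "(LINT x:halfspaces (P \<union> Q)|lborel. g x) = 0"
      by (rule integral_halfspaces_zero[OF _ _ ig])
        (use P Q in \<open>auto simp: halfspaces_Un intro: int0 test_function_mono\<close>)
    moreover have "(LINT x:halfspaces (P \<union> Q)|lborel. g x) = (LINT x:box l u|lborel. g x)"
      unfolding set_lebesgue_integral_def
    proof (rule integral_cong_AE)
      show "AE x in lborel. indicator (halfspaces (P \<union> Q)) x *\<^sub>R g x = indicator (box l u) x *\<^sub>R g x"
        using g0 by eventually_elim (auto simp: halfspaces_Un Q indicator_def)
    qed (use open_halfspaces P Q in auto)
    ultimately show ?thesis by simp
  qed
  have univ0: "(\<integral>x. g x \<partial>lborel) = 0"
  proof -
    have "(LINT x:?K|lborel. g x) = 0" by (rule integral_halfspaces_zero[OF P ig int0])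
    moreover have "(LINT x:?K|lborel. g x) = (\<integral>x. g x \<partial>lborel)"
      unfolding set_lebesgue_integral_def
    proof (rule integral_cong_AE)
      show "AE x in lborel. indicator ?K x *\<^sub>R g x = g x"
        using g0 by eventually_elim (auto simp: indicator_def)
    qed (use oK in auto)
    ultimately show ?thesis by simp
  qed
  have si: "set_integrable lborel A g" if "A \<in> sets borel" for A
    using that ig by (intro integrable_mult_indicator[folded set_integrable_def]) auto
  \<comment> \<open>Boxes are stable under intersection and generate the Borel sets, so the
    vanishing integrals spread from boxes by Dynkin's argument; \<open>univ0\<close> is what handles
    complements.\<close>
  have set0: "(LINT x:A|lborel. g x) = 0" if "A \<in> sets borel" for A
  proof -
    let ?G = "range (\<lambda>(a, b). box a b :: R3 set)"
    have A: "A \<in> sigma_sets UNIV ?G" using that by (simp add: borel_eq_box)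
    have "Int_stable ?G"
    proof (rule Int_stableI)
      fix B C assume "B \<in> ?G" "C \<in> ?G"
      then obtain a b c d where "B = box a b" "C = box c d" by auto
      then have "B \<inter> C = box (\<Sum>i\<in>Basis. max (a\<bullet>i) (c\<bullet>i) *\<^sub>R i) (\<Sum>i\<in>Basis. min (b\<bullet>i) (d\<bullet>i) *\<^sub>R i)"
        by (auto simp: box_def)
      then show "B \<inter> C \<in> ?G" by auto
    qed
    moreover have "?G \<subseteq> Pow UNIV" by simp
    ultimately show ?thesis using A
    proof (induction A rule: sigma_sets_induct_disjoint)
      case (basic A) then show ?case using box0 by auto
    next
      case empty show ?case by (simp add: set_lebesgue_integral_def)
    next
      case (compl A)
      then have A: "A \<in> sets borel" by (simp add: borel_eq_box)
      have "(\<integral>x. g x \<partial>lborel) = (LINT x:A \<union> (UNIV - A)|lborel. g x)"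
        by (simp add: set_lebesgue_integral_def)
      also have "\<dots> = (LINT x:A|lborel. g x) + (LINT x:UNIV - A|lborel. g x)"
        using A by (intro set_integral_Un si) auto
      finally show ?case using univ0 compl by simp
    next
      case (union A)
      then have A: "A i \<in> sets borel" for i by (auto simp: borel_eq_box)
      have "(LINT x:(\<Union>i. A i)|lborel. g x) = (\<Sum>i. LINT x:A i|lborel. g x)"
        using A union(1) by (intro lebesgue_integral_countable_add si) (auto simp: disjoint_family_on_def)
      then show ?case using union by simp
    qed
  qed
  have "AE x in lborel. g x = 0"
    by (rule density_unique_real[OF ig]) (use set0 in \<open>auto simp: set_lebesgue_integral_def\<close>)
  then have "AE x in lebesgue. g x = 0" by (rule AE_completion)
  with AEg' have "AE x in lebesgue. x \<in> ?K \<longrightarrow> h x = 0"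
    by eventually_elim auto
  then show ?thesis by (subst AE_restrict_space_iff[OF sK])
qed

text \<open>Each component of \<open>G - G'\<close> is orthogonal to all test functions.
  \<open>has_trace\<close> and \<open>V_space\<close> each produce a gradient of their own, and this
  is what identifies them.\<close>

lemma weak_grad_unique:
  assumes P: "finite P" "bounded (halfspaces P)"
    and G: "weak_grad (halfspaces P) v G" "weak_grad (halfspaces P) v G'"
  shows "AE x in lebesgue_on (halfspaces P). G x = G' x"
proof -
  let ?M = "lebesgue_on (halfspaces P)"
  have oK: "open (halfspaces P)" by (rule open_halfspaces[OF P(1)])
  have L: "L2 ?M G" "L2 ?M G'" using G by (auto simp: weak_grad_def)
  have Li: "L2 ?M (\<lambda>x. F x $ i)" if "L2 ?M F" for F :: "R3 \<Rightarrow> R3" and i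
  proof -
    have m: "(\<lambda>x. F x $ i) \<in> borel_measurable ?M"
    proof -
      have "(\<lambda>x. F x \<bullet> axis i 1) \<in> borel_measurable ?M" using L2_measurable[OF that] by measurable
      then show ?thesis by (simp add: inner_axis)
    qed
    have "integrable ?M (\<lambda>x. (norm (F x $ i))\<^sup>2)"
    proof (rule Bochner_Integration.integrable_bound[OF L2_integrable[OF that]])
      show "AE x in ?M. norm ((norm (F x $ i))\<^sup>2) \<le> norm ((norm (F x))\<^sup>2)"
      proof (rule AE_I2)
        fix x
        have "(norm (F x $ i))\<^sup>2 \<le> (norm (F x))\<^sup>2"
          by (intro power_mono) (auto simp: component_le_norm_cart)
        then show "norm ((norm (F x $ i))\<^sup>2) \<le> norm ((norm (F x))\<^sup>2)" by simp
      qed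
    qed (use m in measurable)
    with m show ?thesis by (simp add: L2_def)
  qed
  have "AE x in ?M. G x $ i - G' x $ i = 0" for i
  proof (rule AE_zero_of_test_integrals[OF P])
    show "L2 ?M (\<lambda>x. G x $ i - G' x $ i)" by (intro L2_diff Li L)
    fix \<phi> assume phi: "test_function (halfspaces P) \<phi>"
    have Lphi: "L2 ?M \<phi>" by (intro L2_smooth oK P test_function_smooth[OF phi])
    have "(\<integral>x. (G x $ i - G' x $ i) * \<phi> x \<partial>?M) = (\<integral>x. G x $ i * \<phi> x \<partial>?M) - (\<integral>x. G' x $ i * \<phi> x \<partial>?M)"
      unfolding left_diff_distrib by (intro Bochner_Integration.integral_diff L2_mult_integrable Li L Lphi)
    also have "\<dots> = 0" using G phi by (simp add: weak_grad_def)
    finally show "(\<integral>x. (G x $ i - G' x $ i) * \<phi> x \<partial>?M) = 0" .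
  qed
  then have "AE x in ?M. \<forall>i. G x $ i - G' x $ i = 0" by (simp add: AE_all_countable)
  then show ?thesis by eventually_elim (simp add: vec_eq_iff)
qed

section \<open>Integration along fibers of a tetrahedron\<close>

lemma Basis_R3: "(Basis :: R3 set) = {axis 1 1, axis 2 1, axis 3 1}"
  by (auto simp: Basis_vec_def UNIV_3)

lemma triple_measurable: "(\<lambda>((s, t), r). vector [s, t, r] :: R3) \<in> borel_measurable borel"
proof -
  have e: "(\<lambda>((s, t), r). vector [s, t, r] :: R3) = (\<lambda>z. s3 z)"
    if "s3 = (\<lambda>z. \<chi> i. if i = 1 then fst (fst z) else if i = 2 then snd (fst z) else snd z)" for s3
    by (auto simp: that fun_eq_iff vec_eq_iff forall_3)
  have "continuous_on UNIV (\<lambda>z::(real \<times> real) \<times> real. if i = 1 then fst (fst z) else if i = 2 then snd (fst z) else snd z)"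
    for i :: 3 by (cases "i = 1"; cases "i = 2") (auto intro!: continuous_intros)
  then show ?thesis unfolding e[OF refl]
    by (intro borel_measurable_continuous_onI continuous_on_vec_lambda)
qed

text \<open>Identifies three-space with nested pairs, so that Tonelli's theorem can split off one
  coordinate. It suffices to compare the measures on boxes, whose preimages are products of
  intervals.\<close>

lemma lborel_distr_triple:
  "distr lborel borel (\<lambda>((s, t), r). vector [s, t, r] :: R3) = lborel"
proof (rule lborel_eqI[symmetric])
  let ?e = "\<lambda>((s, t), r). vector [s, t, r] :: R3"
  note [measurable] = triple_measurable
  fix l u :: R3 assume lu: "\<And>b. b \<in> Basis \<Longrightarrow> l \<bullet> b \<le> u \<bullet> b"
  have le: "l $ i \<le> u $ i" for i using lu[OF axis_basis[of i]] by (simp add: inner_axis)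
  have "?e -` box l u = ({l$1<..<u$1} \<times> {l$2<..<u$2}) \<times> {l$3<..<u$3}"
    by (auto simp: mem_box_cart forall_3)
  then have "emeasure (distr lborel borel ?e) (box l u)
      = emeasure (lborel :: ((real \<times> real) \<times> real) measure) (({l$1<..<u$1} \<times> {l$2<..<u$2}) \<times> {l$3<..<u$3})"
    by (simp add: emeasure_distr)
  also have "\<dots> = ennreal (u$1 - l$1) * ennreal (u$2 - l$2) * ennreal (u$3 - l$3)"
    by (simp add: lborel_prod[symmetric] lborel.emeasure_pair_measure_Times le)
  also have "\<dots> = ennreal (\<Prod>b\<in>Basis. (u - l) \<bullet> b)"
    using le by (simp add: Basis_R3 axis_eq_axis inner_axis ennreal_mult[symmetric] mult.assoc)
  finally show "emeasure (distr lborel borel ?e) (box l u) = ennreal (\<Prod>b\<in>Basis. (u - l) \<bullet> b)" .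
qed simp

lemma nn_integral_linear_change:
  fixes A :: "R3 \<Rightarrow> R3"
  assumes A: "linear A" "inj A"
  obtains \<kappa> :: real where "0 < \<kappa>"
    "\<And>f. f \<in> borel_measurable borel \<Longrightarrow> (\<integral>\<^sup>+x. f x \<partial>lborel) = ennreal \<kappa> * (\<integral>\<^sup>+x. f (A x) \<partial>lborel)"
proof -
  obtain B where B: "linear B" "\<And>x. B (A x) = x" "\<And>x. A (B x) = x"
    using linear_injective_isomorphism[OF A] by blast
  have injB: "inj B" by (metis B(3) injI)
  define m where "m = \<bar>det (matrix B)\<bar>"
  have m: "m > 0" using det_nz_iff_inj[OF B(1)] injB by (simp add: m_def)
  have [measurable]: "A \<in> borel_measurable borel"
    using A(1) by (intro borel_measurable_continuous_onI linear_continuous_on) (simp add: linear_conv_bounded_linear)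
  define M where "M = scale_measure (ennreal (1 / m)) (distr lborel borel A)"
  have "lborel = M"
  proof (rule lborel_eqI)
    show "sets M = sets borel" by (simp add: M_def)
    fix l u :: R3 assume lu: "\<And>b. b \<in> Basis \<Longrightarrow> l \<bullet> b \<le> u \<bullet> b"
    have im: "A -` box l u = B ` box l u" using B by (auto simp: image_iff) (metis B(2))
    have bl: "box l u \<in> lmeasurable" by simp
    have meas: "B ` box l u \<in> lmeasurable" by (rule measurable_linear_image[OF B(1) bl])
    have bo: "B ` box l u \<in> sets borel"
      unfolding im[symmetric] using measurable_sets_borel[OF \<open>A \<in> borel_measurable borel\<close>] by simp
    have "emeasure M (box l u) = ennreal (1 / m) * emeasure lborel (B ` box l u)"
      by (simp add: M_def emeasure_distr im)
    also have "emeasure lborel (B ` box l u) = emeasure lebesgue (B ` box l u)"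
      using bo by (simp add: emeasure_completion)
    also have "\<dots> = ennreal (measure lebesgue (B ` box l u))"
      using meas by (simp add: emeasure_eq_measure2 fmeasurableD2 emeasure_eq_ennreal_measure)
    also have "measure lebesgue (B ` box l u) = m * measure lebesgue (box l u)"
      unfolding m_def by (rule measure_linear_image[OF B(1) bl])
    also have "ennreal (1 / m) * ennreal (m * measure lebesgue (box l u)) = ennreal (measure lebesgue (box l u))"
      using m by (simp add: ennreal_mult'[symmetric])
    also have "\<dots> = ennreal (\<Prod>b\<in>Basis. (u - l) \<bullet> b)"
      using lu by (simp add: measure_lborel_box_eq)
    finally show "emeasure M (box l u) = ennreal (\<Prod>b\<in>Basis. (u - l) \<bullet> b)" .
  qed
  have "(\<integral>\<^sup>+x. f x \<partial>lborel) = ennreal (1 / m) * (\<integral>\<^sup>+x. f (A x) \<partial>lborel)"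
    if [measurable]: "f \<in> borel_measurable borel" for f
  proof -
    have "(\<integral>\<^sup>+x. f x \<partial>M) = ennreal (1 / m) * (\<integral>\<^sup>+x. f x \<partial>distr lborel borel A)"
      unfolding M_def by (rule nn_integral_scale_measure) simp
    also have "\<dots> = ennreal (1 / m) * (\<integral>\<^sup>+x. f (A x) \<partial>lborel)"
      by (simp add: nn_integral_distr)
    finally show ?thesis using \<open>lborel = M\<close> by simp
  qed
  from that[OF _ this] m show ?thesis by simp
qed

text \<open>Affine coordinates of a tetrahedron seen from the face \<open>abc\<close>: the inner
  pair moves in the plane of the face, the outer coordinate moves along the edge direction
  \<open>d - a\<close>. The nesting makes the face the outer integral and the fibre the inner
  one.\<close>

definition Phi :: "R3 \<Rightarrow> R3 \<Rightarrow> R3 \<Rightarrow> R3 \<Rightarrow> (real \<times> real) \<times> real \<Rightarrow> R3" where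
  "Phi a b c d = (\<lambda>((s, t), r). a + s *\<^sub>R (b - a) + t *\<^sub>R (c - a) + r *\<^sub>R (d - a))"

definition nondegenerate :: "R3 \<Rightarrow> R3 \<Rightarrow> R3 \<Rightarrow> R3 \<Rightarrow> bool" where
  "nondegenerate a b c d \<longleftrightarrow> (\<forall>s t r. s *\<^sub>R (b - a) + t *\<^sub>R (c - a) + r *\<^sub>R (d - a) = 0 \<longrightarrow> s = 0 \<and> t = 0 \<and> r = 0)"

lemma continuous_Phi: "continuous_on S (Phi a b c d)"
  unfolding Phi_def case_prod_beta by (intro continuous_intros)

lemma Phi_measurable: "Phi a b c d \<in> borel_measurable borel"
  by (intro borel_measurable_continuous_onI continuous_Phi)

lemma Phi_decompose:
  assumes "nondegenerate a b c d"
  obtains A where "linear A" "inj A"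
    "\<And>z. Phi a b c d z = a + A ((\<lambda>((s, t), r). vector [s, t, r] :: R3) z)"
proof -
  define A where "A x = x $ 1 *\<^sub>R (b - a) + x $ 2 *\<^sub>R (c - a) + x $ 3 *\<^sub>R (d - a)" for x :: R3
  have lin: "linear A" by (rule linearI) (auto simp: A_def algebra_simps)
  have "inj A"
    unfolding linear_injective_0[OF lin]
  proof (intro allI impI)
    fix x assume "A x = 0"
    then have "x $ 1 = 0 \<and> x $ 2 = 0 \<and> x $ 3 = 0"
      using assms unfolding nondegenerate_def A_def by blast
    then show "x = 0" by (simp add: vec_eq_iff forall_3)
  qed
  moreover have "Phi a b c d z = a + A ((\<lambda>((s, t), r). vector [s, t, r] :: R3) z)" for z
    by (cases z; cases "fst z") (simp add: Phi_def A_def)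
  ultimately show ?thesis using that lin by blast
qed

text \<open>The height above the face is itself an affine form, so the layers of the fibre estimates
  are the layers in which \<open>cutoff\<close> varies. Its linear part is the dual vector to
  \<open>d - a\<close>, obtained by the adjoint of the inverse chart.\<close>

lemma Phi_form:
  assumes "nondegenerate a b c d"
  obtains p q where "\<And>s t r. p \<bullet> Phi a b c d ((s, t), r) + q = r"
proof -
  obtain A where A: "linear A" "inj A"
    "\<And>z. Phi a b c d z = a + A ((\<lambda>((s, t), r). vector [s, t, r] :: R3) z)"
    using Phi_decompose[OF assms] by blast
  obtain B where B: "linear B" "\<And>x. B (A x) = x" "\<And>x. A (B x) = x"
    using linear_injective_isomorphism[OF A(1,2)] by blast
  define p where "p = adjoint B (axis 3 1)"
  have "p \<bullet> A x = x $ 3" for x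
    unfolding p_def inner_commute[of _ "A x"] adjoint_works[OF B(1)] B(2)
    by (simp add: inner_axis)
  then have "p \<bullet> Phi a b c d ((s, t), r) + (- (p \<bullet> a)) = r" for s t r
    by (simp add: A(3) inner_add_right)
  then show ?thesis by (rule that)
qed

lemma Phi_surj:
  assumes "nondegenerate a b c d"
  obtains s t r where "x = Phi a b c d ((s, t), r)"
proof -
  obtain A where A: "linear A" "inj A"
    "\<And>z. Phi a b c d z = a + A ((\<lambda>((s, t), r). vector [s, t, r] :: R3) z)"
    using Phi_decompose[OF assms] by blast
  obtain B where B: "linear B" "\<And>x. B (A x) = x" "\<And>x. A (B x) = x"
    using linear_injective_isomorphism[OF A(1,2)] by blast
  have "vector [B (x - a) $ 1, B (x - a) $ 2, B (x - a) $ 3] = B (x - a)"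
    by (simp add: vec_eq_iff forall_3)
  then have "x = Phi a b c d ((B (x - a) $ 1, B (x - a) $ 2), B (x - a) $ 3)"
    by (simp add: A(3) B(3))
  then show ?thesis by (rule that)
qed

lemma nn_integral_Phi:
  assumes "nondegenerate a b c d"
  obtains \<kappa> :: real where "0 < \<kappa>"
    "\<And>f. f \<in> borel_measurable borel \<Longrightarrow>
      (\<integral>\<^sup>+x. f x \<partial>lborel) = ennreal \<kappa> * (\<integral>\<^sup>+z. \<integral>\<^sup>+r. f (Phi a b c d (z, r)) \<partial>lborel \<partial>lborel)"
proof -
  obtain A where A: "linear A" "inj A"
    "\<And>z. Phi a b c d z = a + A ((\<lambda>((s, t), r). vector [s, t, r] :: R3) z)"
    using Phi_decompose[OF assms] by blast
  obtain \<kappa> where k: "0 < \<kappa>"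
    "\<And>f. f \<in> borel_measurable borel \<Longrightarrow> (\<integral>\<^sup>+x. f x \<partial>lborel) = ennreal \<kappa> * (\<integral>\<^sup>+x. f (A x) \<partial>lborel)"
    using nn_integral_linear_change[OF A(1,2)] by blast
  have Am[measurable]: "A \<in> borel_measurable borel"
    using A(1) by (intro borel_measurable_continuous_onI linear_continuous_on) (simp add: linear_conv_bounded_linear)
  let ?e = "\<lambda>((s, t), r). vector [s, t, r] :: R3"
  note em = triple_measurable
  show ?thesis
  proof (rule that[OF k(1)])
    fix f :: "R3 \<Rightarrow> ennreal" assume f[measurable]: "f \<in> borel_measurable borel"
    have "(\<integral>\<^sup>+x. f x \<partial>lborel) = (\<integral>\<^sup>+x. f x \<partial>distr lborel borel ((+) a))"
      by (simp add: lborel_distr_plus)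
    also have "\<dots> = (\<integral>\<^sup>+x. f (a + x) \<partial>lborel)" by (simp add: nn_integral_distr)
    also have "\<dots> = ennreal \<kappa> * (\<integral>\<^sup>+x. f (a + A x) \<partial>lborel)" by (rule k(2)) measurable
    also have "(\<integral>\<^sup>+x. f (a + A x) \<partial>lborel) = (\<integral>\<^sup>+x. f (a + A x) \<partial>distr lborel borel ?e)"
      by (simp only: lborel_distr_triple)
    also have "\<dots> = (\<integral>\<^sup>+z. f (a + A (?e z)) \<partial>lborel)"
      by (rule nn_integral_distr) (use em in \<open>simp, measurable\<close>)
    also have "\<dots> = (\<integral>\<^sup>+z. f (Phi a b c d z) \<partial>(lborel \<Otimes>\<^sub>M lborel))"
      by (simp only: A(3) lborel_prod)
    also have "\<dots> = (\<integral>\<^sup>+z. \<integral>\<^sup>+r. f (Phi a b c d (z, r)) \<partial>lborel \<partial>lborel)"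
    proof (rule lborel.nn_integral_fst[symmetric])
      have "(\<lambda>z. f (Phi a b c d z)) \<in> borel_measurable borel"
        using measurable_compose[OF Phi_measurable f] .
      then show "(\<lambda>z. f (Phi a b c d z)) \<in> borel_measurable (lborel \<Otimes>\<^sub>M lborel)"
        by (simp add: lborel_prod)
    qed
    finally show "(\<integral>\<^sup>+x. f x \<partial>lborel) = ennreal \<kappa> * (\<integral>\<^sup>+z. \<integral>\<^sup>+r. f (Phi a b c d (z, r)) \<partial>lborel \<partial>lborel)" .
  qed
qed

text \<open>The difference is the integral of the directional derivative along the segment.
  Cauchy-Schwarz against the constant field \<open>e\<close> on an interval of length
  \<open>r\<close> yields the factor \<open>r * (norm e)\<^sup>2\<close>.\<close>

lemma fiber_estimate:
  assumes u: "smooth u" and "0 \<le> r"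
  shows "ennreal ((u (y + r *\<^sub>R e) - u y)\<^sup>2)
    \<le> ennreal (r * (norm e)\<^sup>2) * (\<integral>\<^sup>+\<rho>\<in>{0..r}. ennreal ((norm (grad u (y + \<rho> *\<^sub>R e)))\<^sup>2) \<partial>lborel)"
proof -
  let ?g = "\<lambda>\<rho>. grad u (y + \<rho> *\<^sub>R e)"
  let ?I = "{0..r}" let ?M = "restrict_space lborel ?I"
  have cg: "continuous_on UNIV ?g"
    by (intro continuous_on_compose2[OF smooth_grad_continuous[OF u]] continuous_intros) auto
  have Ispace: "?I \<inter> space lborel \<in> sets lborel" by simp
  have der: "((\<lambda>\<rho>. u (y + \<rho> *\<^sub>R e)) has_vector_derivative ?g \<rho> \<bullet> e) (at \<rho> within ?I)" for \<rho>
  proof -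
    have "((\<lambda>t. y + t *\<^sub>R e) has_derivative (\<lambda>t. t *\<^sub>R e)) (at \<rho> within ?I)"
      by (auto intro!: derivative_eq_intros)
    from has_derivative_compose[OF this smooth_has_derivative[OF u]]
    show ?thesis by (simp add: has_vector_derivative_def)
  qed
  have ftc: "(\<integral>\<rho>. indicator ?I \<rho> *\<^sub>R (?g \<rho> \<bullet> e) \<partial>lborel) = u (y + r *\<^sub>R e) - u (y + 0 *\<^sub>R e)"
    by (rule integral_FTC_atLeastAtMost[OF \<open>0 \<le> r\<close> der])
      (auto intro!: continuous_intros continuous_on_subset[OF cg])
  have fin: "emeasure lborel ?I < \<infinity>" using \<open>0 \<le> r\<close> by simp
  interpret finite_measure ?M
    by (rule finite_measureI) (use fin in \<open>simp add: emeasure_restrict_space space_restrict_space\<close>)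
  have mg: "?g \<in> borel_measurable ?M"
    by (intro measurable_restrict_space1) (use cg in \<open>simp add: borel_measurable_continuous_onI\<close>)
  obtain B where B: "\<And>\<rho>. \<rho> \<in> ?I \<Longrightarrow> norm (?g \<rho>) \<le> B"
    using bounded_on_compact[OF compact_Icc continuous_on_subset[OF cg subset_UNIV]] by metis
  have Lg: "L2 ?M (\<lambda>\<rho>. ?g \<rho>)"
    unfolding L2_def
  proof
    show "integrable ?M (\<lambda>\<rho>. (norm (?g \<rho>))\<^sup>2)"
    proof (rule integrable_const_bound[of _ "B\<^sup>2"])
      show "AE \<rho> in ?M. norm ((norm (?g \<rho>))\<^sup>2) \<le> B\<^sup>2"
        using B by (intro AE_I2) (auto simp: space_restrict_space intro!: power_mono)
    qed (use mg in measurable)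
  qed (rule mg)
  have Le: "L2 ?M (\<lambda>\<rho>. e)" by (simp add: L2_def)
  have "(u (y + r *\<^sub>R e) - u y)\<^sup>2 = (\<integral>\<rho>. ?g \<rho> \<bullet> e \<partial>?M)\<^sup>2"
    using ftc by (simp add: integral_restrict_space[OF Ispace])
  also have "\<dots> \<le> (\<integral>\<rho>. (norm (?g \<rho>))\<^sup>2 \<partial>?M) * (\<integral>\<rho>. (norm e)\<^sup>2 \<partial>?M)"
    by (rule L2_Cauchy_Schwarz[OF Lg Le])
  also have "(\<integral>\<rho>. (norm e)\<^sup>2 \<partial>?M) = r * (norm e)\<^sup>2"
    using \<open>0 \<le> r\<close> by (simp add: measure_restrict_space space_restrict_space)
  finally have "ennreal ((u (y + r *\<^sub>R e) - u y)\<^sup>2)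
      \<le> ennreal (r * (norm e)\<^sup>2) * ennreal (\<integral>\<rho>. (norm (?g \<rho>))\<^sup>2 \<partial>?M)"
    using \<open>0 \<le> r\<close> by (simp add: ennreal_mult[symmetric] mult.commute ennreal_leI)
  also have "ennreal (\<integral>\<rho>. (norm (?g \<rho>))\<^sup>2 \<partial>?M) = (\<integral>\<^sup>+\<rho>\<in>?I. ennreal ((norm (?g \<rho>))\<^sup>2) \<partial>lborel)"
    unfolding L2_nn_integral[OF Lg, symmetric] by (rule nn_integral_restrict_space[OF Ispace])
  finally show ?thesis .
qed

section \<open>Faces as parametrized triangles\<close>

definition unit_triangle :: "(real \<times> real) set" where
  "unit_triangle = {(s, t). 0 \<le> s \<and> 0 \<le> t \<and> s + t \<le> 1}"

lemma closed_unit_triangle: "closed unit_triangle"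
  unfolding unit_triangle_def case_prod_beta
  by (intro closed_Collect_conj closed_Collect_le continuous_intros)

lemma unit_triangle_borel [measurable]: "unit_triangle \<in> sets borel"
  by (rule borel_closed[OF closed_unit_triangle])

lemma Phi_face: "Phi a b c d (z, 0) = (\<lambda>(s, t). a + s *\<^sub>R (b - a) + t *\<^sub>R (c - a)) z"
  by (auto simp: Phi_def split: prod.splits)

lemma Phi_step: "Phi a b c d (z, r) = Phi a b c d (z, 0) + r *\<^sub>R (d - a)"
  by (auto simp: Phi_def split: prod.splits)

lemma Phi_face_in_hull: "z \<in> unit_triangle \<Longrightarrow> Phi a b c d (z, 0) \<in> convex hull {a, b, c}"
proof -
  assume "z \<in> unit_triangle"
  then obtain s t where z: "z = (s, t)" "0 \<le> s" "0 \<le> t" "s + t \<le> 1" by (auto simp: unit_triangle_def)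
  have "Phi a b c d (z, 0) = (1 - s - t) *\<^sub>R a + s *\<^sub>R b + t *\<^sub>R c"
    by (simp add: z Phi_def algebra_simps)
  then show ?thesis unfolding convex_hull_3 using z(2-)
    by (intro CollectI exI[of _ "1 - s - t"] exI[of _ s] exI[of _ t]) auto
qed

lemma hull_in_Phi_face:
  assumes "x \<in> convex hull {a, b, c}"
  obtains z where "z \<in> unit_triangle" "x = Phi a b c d (z, 0)"
proof -
  obtain u v w where "0 \<le> u" "0 \<le> v" "0 \<le> w" "u + v + w = 1" "x = u *\<^sub>R a + v *\<^sub>R b + w *\<^sub>R c"
    using assms unfolding convex_hull_3 by auto
  moreover from this have "u = 1 - v - w" by simp
  ultimately show ?thesis
    by (intro that[of "(v, w)"]) (auto simp: unit_triangle_def Phi_def algebra_simps)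
qed

lemma sets_triangle_measure: "sets (triangle_measure a b c) = sets (restrict_space borel (convex hull {a, b, c}))"
  by (simp add: triangle_measure_def)

lemma space_triangle_measure: "space (triangle_measure a b c) = convex hull {a, b, c}"
  using sets_eq_imp_space_eq[OF sets_triangle_measure[of a b c]] by (simp add: space_restrict_space)

lemma measurable_triangle_measure:
  "continuous_on (convex hull {a, b, c}) g \<Longrightarrow> g \<in> borel_measurable (triangle_measure a b c)"
  for g :: "R3 \<Rightarrow> real"
  using borel_measurable_continuous_on_restrict[of "convex hull {a, b, c}" g]
  by (simp add: measurable_cong_sets[OF sets_triangle_measure refl])

text \<open>At height 0 the vertex \<open>d\<close> drops out of \<open>Phi\<close>, so the chart of
  the solid also parametrizes the face; surface integrals and fibre integrals thus share the
  variable \<open>z\<close>.\<close>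

lemma nn_integral_triangle_measure:
  assumes "f \<in> borel_measurable (triangle_measure a b c)"
  shows "(\<integral>\<^sup>+x. f x \<partial>triangle_measure a b c)
    = ennreal (norm (cross3 (b - a) (c - a))) * (\<integral>\<^sup>+z\<in>unit_triangle. f (Phi a b c d (z, 0)) \<partial>lborel)"
proof -
  let ?P = "\<lambda>(s, t). a + s *\<^sub>R (b - a) + t *\<^sub>R (c - a)"
  let ?R = "restrict_space borel (convex hull {a, b, c})"
  have f: "f \<in> borel_measurable ?R"
    using assms by (simp add: measurable_cong_sets[OF sets_triangle_measure refl])
  have P: "?P \<in> measurable (restrict_space lborel unit_triangle) ?R"
  proof (rule measurable_restrict_space2)
    show "?P \<in> space (restrict_space lborel unit_triangle) \<rightarrow> convex hull {a, b, c}"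
      using Phi_face_in_hull[of _ a b c] by (auto simp: space_restrict_space Phi_face)
    have "continuous_on UNIV ?P" unfolding case_prod_beta by (intro continuous_intros)
    then show "?P \<in> borel_measurable (restrict_space lborel unit_triangle)"
      by (intro measurable_restrict_space1) (simp add: borel_measurable_continuous_onI)
  qed
  have "(\<integral>\<^sup>+x. f x \<partial>triangle_measure a b c)
     = ennreal (norm (cross3 (b - a) (c - a))) * (\<integral>\<^sup>+x. f x \<partial>distr (restrict_space lborel unit_triangle) ?R ?P)"
    unfolding triangle_measure_def unit_triangle_def[symmetric]
    by (rule nn_integral_scale_measure) (use f in simp)
  also have "(\<integral>\<^sup>+x. f x \<partial>distr (restrict_space lborel unit_triangle) ?R ?P)
     = (\<integral>\<^sup>+z. f (?P z) \<partial>restrict_space lborel unit_triangle)"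
    by (rule nn_integral_distr[OF P]) (use f in simp)
  also have "\<dots> = (\<integral>\<^sup>+z\<in>unit_triangle. f (?P z) \<partial>lborel)"
    by (rule nn_integral_restrict_space) simp
  finally show ?thesis by (simp only: Phi_face)
qed

lemma emeasure_unit_triangle_finite: "emeasure lborel unit_triangle < \<infinity>"
proof (rule emeasure_bounded_finite)
  have "unit_triangle \<subseteq> cbox (0, 0) (1, 1)" by (auto simp: unit_triangle_def)
  then show "bounded unit_triangle" by (rule bounded_subset[OF bounded_cbox])
qed

lemma L2_triangle_continuous:
  fixes g :: "R3 \<Rightarrow> real"
  assumes g: "continuous_on (convex hull {a, b, c}) g" and "\<And>x. x \<in> convex hull {a, b, c} \<Longrightarrow> \<bar>g x\<bar> \<le> B"
  shows "L2 (triangle_measure a b c) g"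
    "(\<integral>x. (norm (g x))\<^sup>2 \<partial>triangle_measure a b c) \<le> B\<^sup>2 * measure (triangle_measure a b c) (convex hull {a, b, c})"
proof -
  let ?M = "triangle_measure a b c"
  have "emeasure ?M (space ?M) = (\<integral>\<^sup>+x. 1 \<partial>?M)" by simp
  also have "\<dots> = ennreal (norm (cross3 (b - a) (c - a))) * emeasure lborel unit_triangle"
    \<comment> \<open>The choice of \<open>d\<close> is a placeholder, as \<open>Phi\<close> at
      height 0 is independent of it.\<close>
    by (subst nn_integral_triangle_measure[where d=0]) auto
  also have "\<dots> < \<infinity>" using emeasure_unit_triangle_finite by (simp add: ennreal_mult_less_top)
  finally interpret finite_measure ?M by (intro finite_measureI) auto
  have m: "g \<in> borel_measurable ?M" by (rule measurable_triangle_measure[OF g])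
  have le: "(norm (g x))\<^sup>2 \<le> B\<^sup>2" if "x \<in> convex hull {a, b, c}" for x
    using assms(2)[OF that] by (intro power_mono) auto
  have i: "integrable ?M (\<lambda>x. (norm (g x))\<^sup>2)"
    by (rule integrable_const_bound[of _ "B\<^sup>2"])
      (use m le in \<open>auto simp: space_triangle_measure intro!: AE_I2\<close>)
  then show "L2 ?M g" using m by (simp add: L2_def)
  have "(\<integral>x. (norm (g x))\<^sup>2 \<partial>?M) \<le> (\<integral>x. B\<^sup>2 \<partial>?M)"
    by (rule integral_mono[OF i]) (use le in \<open>auto simp: space_triangle_measure\<close>)
  then show "(\<integral>x. (norm (g x))\<^sup>2 \<partial>?M) \<le> B\<^sup>2 * measure ?M (convex hull {a, b, c})"
    by (simp add: space_triangle_measure mult.commute)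
qed

section \<open>Estimates on the fibres over one face\<close>

lemma nn_integral_lebesgue_on_borel:
  fixes K :: "R3 set"
  assumes "K \<in> sets borel" "f \<in> borel_measurable borel"
  shows "(\<integral>\<^sup>+x. f x \<partial>lebesgue_on K) = (\<integral>\<^sup>+x\<in>K. f x \<partial>lborel)"
proof -
  have "(\<integral>\<^sup>+x. f x \<partial>lebesgue_on K) = (\<integral>\<^sup>+x\<in>K. f x \<partial>lebesgue)"
    using assms(1) by (intro nn_integral_restrict_space) auto
  then show ?thesis by (simp add: nn_integral_completion)
qed

text \<open>The tetrahedron seen from the face \<open>abc\<close>. The form given by
  \<open>p\<close> and \<open>q\<close> is the barycentric coordinate of the opposite vertex
  \<open>d\<close>: it is 0 on the face and 1 at \<open>d\<close>.\<close>

locale corner =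
  fixes a b c d p :: R3 and q :: real and K :: "R3 set"
  assumes nd: "nondegenerate a b c d" and oK: "open K"
    and K: "\<And>s t r. Phi a b c d ((s, t), r) \<in> K \<longleftrightarrow> 0 < s \<and> 0 < t \<and> 0 < r \<and> s + t + r < 1"
    and form: "\<And>s t r. p \<bullet> Phi a b c d ((s, t), r) + q = r"
begin

text \<open>The length of the part of the fibre over \<open>z\<close> that lies in the layer of
  height \<delta>. For \<open>z\<close> outside the open triangle the value is at most 0, so that
  the interval from 0 to it is empty and no case distinction is needed in integrals.\<close>

definition fiber_end :: "real \<Rightarrow> real \<times> real \<Rightarrow> real" where
  "fiber_end \<delta> = (\<lambda>(s, t). if 0 < s \<and> 0 < t then min \<delta> (1 - s - t) else 0)"

lemma fiber_iff:
  "Phi a b c d (z, r) \<in> {x \<in> K. p \<bullet> x + q < \<delta>} \<longleftrightarrow> r \<in> {0<..<fiber_end \<delta> z}"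
proof (cases z)
  case (Pair s t)
  show ?thesis unfolding Pair using K[of s t r] form[of s t r]
    by (auto simp: fiber_end_def)
qed

lemma fiber_end_le: "0 < \<delta> \<Longrightarrow> fiber_end \<delta> z \<le> \<delta>" and
  fiber_end_triangle: "0 < r \<Longrightarrow> r < fiber_end \<delta> z \<Longrightarrow> z \<in> unit_triangle"
  by (auto simp: fiber_end_def unit_triangle_def split: prod.splits if_splits)

lemma layer_borel: "{x \<in> K. p \<bullet> x + q < \<delta>} \<in> sets borel"
proof -
  have "open {x \<in> K. p \<bullet> x + q < \<delta>}"
    using oK by (intro open_Collect_conj open_Collect_less continuous_intros) (simp add: Collect_mem_eq)
  then show ?thesis by simp
qed

lemma fiber_change:
  obtains \<kappa> :: real where "0 < \<kappa>"
    "\<And>f \<delta>. f \<in> borel_measurable borel \<Longrightarrow> (\<integral>\<^sup>+x\<in>{x \<in> K. p \<bullet> x + q < \<delta>}. f x \<partial>lborel)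
      = ennreal \<kappa> * (\<integral>\<^sup>+z. (\<integral>\<^sup>+r\<in>{0<..<fiber_end \<delta> z}. f (Phi a b c d (z, r)) \<partial>lborel) \<partial>lborel)"
proof -
  obtain \<kappa> where k: "0 < \<kappa>" "\<And>f. f \<in> borel_measurable borel \<Longrightarrow>
      (\<integral>\<^sup>+x. f x \<partial>lborel) = ennreal \<kappa> * (\<integral>\<^sup>+z. \<integral>\<^sup>+r. f (Phi a b c d (z, r)) \<partial>lborel \<partial>lborel)"
    by (rule nn_integral_Phi[OF nd]) blast
  show ?thesis
  proof (rule that[OF k(1)])
    fix f :: "R3 \<Rightarrow> ennreal" and \<delta> assume [measurable]: "f \<in> borel_measurable borel"
    note layer_borel[measurable]
    have "(\<integral>\<^sup>+x\<in>{x \<in> K. p \<bullet> x + q < \<delta>}. f x \<partial>lborel) = ennreal \<kappa> * (\<integral>\<^sup>+z. \<integral>\<^sup>+r.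
        f (Phi a b c d (z, r)) * indicator {x \<in> K. p \<bullet> x + q < \<delta>} (Phi a b c d (z, r)) \<partial>lborel \<partial>lborel)"
      by (rule k(2)) measurable
    also have "\<dots> = ennreal \<kappa> * (\<integral>\<^sup>+z. (\<integral>\<^sup>+r\<in>{0<..<fiber_end \<delta> z}. f (Phi a b c d (z, r)) \<partial>lborel) \<partial>lborel)"
      using fiber_iff by (intro arg_cong[where f="\<lambda>x. ennreal \<kappa> * x"] nn_integral_cong) (simp add: indicator_def)
    finally show "(\<integral>\<^sup>+x\<in>{x \<in> K. p \<bullet> x + q < \<delta>}. f x \<partial>lborel)
      = ennreal \<kappa> * (\<integral>\<^sup>+z. (\<integral>\<^sup>+r\<in>{0<..<fiber_end \<delta> z}. f (Phi a b c d (z, r)) \<partial>lborel) \<partial>lborel)" .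
  qed
qed

text \<open>Both bounds come from \<open>A\<^sup>2 \<le> 2 * B\<^sup>2 + 2 * (A - B)\<^sup>2\<close>
  and the fibre estimate. The first carries information from the face into the solid and leads to
  the layer estimate, the second carries it back and leads to the trace estimate.\<close>

lemma fiber_pointwise:
  fixes u :: "R3 \<Rightarrow> real" and z :: "real \<times> real" and r l :: real
  assumes u: "smooth u" and r: "0 < r" "r < l"
  defines "N \<equiv> (\<integral>\<^sup>+\<rho>\<in>{0<..<l}. ennreal ((norm (grad u (Phi a b c d (z, \<rho>))))\<^sup>2) \<partial>lborel)"
  shows "ennreal ((u (Phi a b c d (z, r)))\<^sup>2)
      \<le> 2 * ennreal ((u (Phi a b c d (z, 0)))\<^sup>2) + ennreal (2 * r * (norm (d - a))\<^sup>2) * N"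
    "ennreal ((u (Phi a b c d (z, 0)))\<^sup>2) \<le> 2 * ennreal ((u (Phi a b c d (z, r)))\<^sup>2) + ennreal (2 * r * (norm (d - a))\<^sup>2) * N"
proof -
  let ?y = "Phi a b c d (z, 0)" and ?e = "d - a" and ?u = "\<lambda>r. ennreal ((u (Phi a b c d (z, r)))\<^sup>2)"
  let ?D = "ennreal ((u (?y + r *\<^sub>R ?e) - u ?y)\<^sup>2)"
  have D0: "?D \<le> ennreal (r * (norm ?e)\<^sup>2) * (\<integral>\<^sup>+\<rho>\<in>{0..r}. ennreal ((norm (grad u (?y + \<rho> *\<^sub>R ?e)))\<^sup>2) \<partial>lborel)"
    by (rule fiber_estimate[OF u]) (use r in simp)
  have D1: "(\<integral>\<^sup>+\<rho>\<in>{0..r}. ennreal ((norm (grad u (?y + \<rho> *\<^sub>R ?e)))\<^sup>2) \<partial>lborel) \<le> N"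
    unfolding N_def
  proof (rule nn_integral_mono_AE)
    \<comment> \<open>The fibre estimate integrates over a closed interval and \<open>N\<close> over
      an open one; only the endpoint 0 is missing.\<close>
    have "AE \<rho> in lborel. \<rho> \<noteq> (0::real)" by (rule AE_lborel_singleton)
    then show "AE \<rho> in lborel. ennreal ((norm (grad u (?y + \<rho> *\<^sub>R ?e)))\<^sup>2) * indicator {0..r} \<rho>
        \<le> ennreal ((norm (grad u (Phi a b c d (z, \<rho>))))\<^sup>2) * indicator {0<..<l} \<rho>"
    proof eventually_elim
      case (elim \<rho>)
      show ?case unfolding Phi_step[of a b c d z \<rho>] using r elim by (simp add: indicator_def)
    qed
  qed
  have D: "?D \<le> ennreal (r * (norm ?e)\<^sup>2) * N"
    by (rule order_trans[OF D0 mult_left_mono[OF D1]]) simp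
  have two: "2 * (ennreal (r * (norm ?e)\<^sup>2) * N) = ennreal (2 * r * (norm ?e)\<^sup>2) * N"
    using r by (simp add: mult.assoc ennreal_mult)
  have gen: "ennreal (A\<^sup>2) \<le> 2 * ennreal (B\<^sup>2) + 2 * ennreal ((A - B)\<^sup>2)" for A B :: real
  proof -
    have "A\<^sup>2 \<le> 2 * B\<^sup>2 + 2 * (A - B)\<^sup>2"
      using norm_add_sq_le[of B "A - B"] by simp
    then have "ennreal (A\<^sup>2) \<le> ennreal (2 * B\<^sup>2 + 2 * (A - B)\<^sup>2)" by (rule ennreal_leI)
    then show ?thesis by (simp add: ennreal_mult)
  qed
  have st: "Phi a b c d (z, r) = ?y + r *\<^sub>R ?e" by (rule Phi_step)
  show "?u r \<le> 2 * ?u 0 + ennreal (2 * r * (norm (d - a))\<^sup>2) * N"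
    using order_trans[OF gen[of "u (?y + r *\<^sub>R ?e)" "u ?y"] add_left_mono[OF mult_left_mono[OF D, of 2]]]
    unfolding st two by simp
  have sym: "(u ?y - u (?y + r *\<^sub>R ?e))\<^sup>2 = (u (?y + r *\<^sub>R ?e) - u ?y)\<^sup>2" by (rule power2_commute)
  show "?u 0 \<le> 2 * ?u r + ennreal (2 * r * (norm (d - a))\<^sup>2) * N"
    using order_trans[OF gen[of "u ?y" "u (?y + r *\<^sub>R ?e)", unfolded sym] add_left_mono[OF mult_left_mono[OF D, of 2]]]
    unfolding st two by simp
qed

lemma Phi_section_measurable:
  "f \<in> borel_measurable borel \<Longrightarrow> (\<lambda>r. f (Phi a b c d (z, r))) \<in> borel_measurable borel"
  "f \<in> borel_measurable borel \<Longrightarrow> (\<lambda>z. f (Phi a b c d (z, r))) \<in> borel_measurable borel"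
proof -
  have "(\<lambda>r. Phi a b c d (z, r)) \<in> borel_measurable borel"
    by (intro borel_measurable_continuous_onI continuous_on_compose2[OF continuous_Phi[of UNIV]] continuous_intros) auto
  then show "f \<in> borel_measurable borel \<Longrightarrow> (\<lambda>r. f (Phi a b c d (z, r))) \<in> borel_measurable borel"
    by (rule measurable_compose)
  have "(\<lambda>z. Phi a b c d (z, r)) \<in> borel_measurable borel"
    by (intro borel_measurable_continuous_onI continuous_on_compose2[OF continuous_Phi[of UNIV]] continuous_intros) auto
  then show "f \<in> borel_measurable borel \<Longrightarrow> (\<lambda>z. f (Phi a b c d (z, r))) \<in> borel_measurable borel"
    by (rule measurable_compose)
qed

text \<open>The endpoint of the fibre depends on \<open>z\<close>, but by \<open>fiber_iff\<close>
  the integrand is \<open>f\<close> times the indicator of a Borel layer composed with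
  \<open>Phi\<close>. This is jointly measurable, and the integral over its sections is measurable
  by Tonelli.\<close>

lemma fiber_measurable:
  assumes f: "f \<in> borel_measurable borel"
  shows "(\<lambda>z. (\<integral>\<^sup>+r\<in>{0<..<fiber_end \<delta> z}. f (Phi a b c d (z, r)) \<partial>lborel)) \<in> borel_measurable borel"
proof -
  have "(\<lambda>x. f x * indicator {x \<in> K. p \<bullet> x + q < \<delta>} x) \<in> borel_measurable borel"
    by (intro borel_measurable_times_ennreal f borel_measurable_indicator layer_borel)
  moreover have fib: "indicator {x \<in> K. p \<bullet> x + q < \<delta>} (Phi a b c d w) = (indicator {0<..<fiber_end \<delta> (fst w)} (snd w) :: ennreal)" for w
    using fiber_iff[of "fst w" "snd w" \<delta>] by (simp add: indicator_def)
  moreover note measurable_compose[OF Phi_measurable[of a b c d], of "\<lambda>x. f x * indicator {x \<in> K. p \<bullet> x + q < \<delta>} x" borel]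
  ultimately
  have "(\<lambda>(z, r). f (Phi a b c d (z, r)) * indicator {0<..<fiber_end \<delta> z} r) \<in> borel_measurable (lborel \<Otimes>\<^sub>M lborel)"
    unfolding lborel_prod using fib by (simp add: case_prod_unfold)
  from lborel.borel_measurable_nn_integral[OF this] show ?thesis by simp
qed

text \<open>Fibres in the layer are shorter than \<delta>. Integrating the fibre bound over the
  height gives a factor \<delta> in front of the face term; the energy term receives a second
  \<delta> from the factor \<open>r\<close> in that bound.\<close>

lemma layer_estimate_nn:
  obtains C :: real where "0 < C"
    "\<And>u \<delta>. smooth u \<Longrightarrow> 0 < \<delta> \<Longrightarrow> \<delta> \<le> 1 \<Longrightarrow>
      (\<integral>\<^sup>+x\<in>{x \<in> K. p \<bullet> x + q < \<delta>}. ennreal ((u x)\<^sup>2) \<partial>lborel)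
      \<le> ennreal (C * \<delta>) * (\<integral>\<^sup>+z\<in>unit_triangle. ennreal ((u (Phi a b c d (z, 0)))\<^sup>2) \<partial>lborel)
        + ennreal (C * \<delta>\<^sup>2) * (\<integral>\<^sup>+x\<in>{x \<in> K. p \<bullet> x + q < \<delta>}. ennreal ((norm (grad u x))\<^sup>2) \<partial>lborel)"
proof -
  obtain \<kappa> where k: "0 < \<kappa>" and ch: "\<And>f \<delta>. f \<in> borel_measurable borel \<Longrightarrow>
      (\<integral>\<^sup>+x\<in>{x \<in> K. p \<bullet> x + q < \<delta>}. f x \<partial>lborel)
      = ennreal \<kappa> * (\<integral>\<^sup>+z. (\<integral>\<^sup>+r\<in>{0<..<fiber_end \<delta> z}. f (Phi a b c d (z, r)) \<partial>lborel) \<partial>lborel)"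
    by (rule fiber_change) blast
  define E where "E = (norm (d - a))\<^sup>2"
  \<comment> \<open>The face term carries \<open>2 * \<kappa>\<close>. The energy term carries only
    \<open>2 * E\<close>, because its \<kappa> is absorbed when the fibre integrals are turned back
    into an integral over the layer.\<close>
  define C where "C = 2 * \<kappa> + 2 * E"
  have E: "E \<ge> 0" by (simp add: E_def)
  have C: "C > 0" using k E by (simp add: C_def)
  show ?thesis
  proof (rule that[OF C])
    fix u :: "R3 \<Rightarrow> real" and \<delta> :: real assume u: "smooth u" and d: "0 < \<delta>" "\<delta> \<le> 1"
    have mu: "(\<lambda>x. ennreal ((u x)\<^sup>2)) \<in> borel_measurable borel"
      using smooth_measurable[OF u] by measurable
    have mg: "(\<lambda>x. ennreal ((norm (grad u x))\<^sup>2)) \<in> borel_measurable borel"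
      using borel_measurable_continuous_onI[OF smooth_grad_continuous[OF u]] by measurable
    define N where "N z = (\<integral>\<^sup>+\<rho>\<in>{0<..<fiber_end \<delta> z}. ennreal ((norm (grad u (Phi a b c d (z, \<rho>))))\<^sup>2) \<partial>lborel)" for z
    define U where "U z = ennreal ((u (Phi a b c d (z, 0)))\<^sup>2)" for z
    have mU: "U \<in> borel_measurable borel" unfolding U_def[abs_def] by (rule Phi_section_measurable(2)[OF mu])
    have mN: "N \<in> borel_measurable borel" unfolding N_def[abs_def] by (rule fiber_measurable[OF mg])
    have fib: "(\<integral>\<^sup>+r\<in>{0<..<fiber_end \<delta> z}. ennreal ((u (Phi a b c d (z, r)))\<^sup>2) \<partial>lborel)
        \<le> ennreal (2 * \<delta>) * (U z * indicator unit_triangle z) + ennreal (2 * E * \<delta>\<^sup>2) * N z" for z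
    proof -
      have "(\<integral>\<^sup>+r\<in>{0<..<fiber_end \<delta> z}. ennreal ((u (Phi a b c d (z, r)))\<^sup>2) \<partial>lborel)
         \<le> (\<integral>\<^sup>+r. (2 * (U z * indicator unit_triangle z) + ennreal (2 * \<delta> * E) * N z) * indicator {0<..<\<delta>} r \<partial>lborel)"
      proof (rule nn_integral_mono)
        fix r
        show "ennreal ((u (Phi a b c d (z, r)))\<^sup>2) * indicator {0<..<fiber_end \<delta> z} r
           \<le> (2 * (U z * indicator unit_triangle z) + ennreal (2 * \<delta> * E) * N z) * indicator {0<..<\<delta>} r"
        proof (cases "r \<in> {0<..<fiber_end \<delta> z}")
          case True
          then have r: "0 < r" "r < fiber_end \<delta> z" "r < \<delta>" "z \<in> unit_triangle"
            using fiber_end_le[OF d(1), of z] fiber_end_triangle[of r \<delta> z] by auto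
          have "ennreal (2 * r * (norm (d - a))\<^sup>2) \<le> ennreal (2 * \<delta> * E)"
            unfolding E_def using r by (intro ennreal_leI mult_right_mono) auto
          then have "ennreal ((u (Phi a b c d (z, r)))\<^sup>2) \<le> 2 * U z + ennreal (2 * \<delta> * E) * N z"
            using fiber_pointwise(1)[OF u r(1,2), of z] unfolding U_def N_def
            by (elim order_trans) (intro add_left_mono mult_right_mono, auto)
          then show ?thesis using True r by simp
        qed simp
      qed
      also have "\<dots> = (2 * (U z * indicator unit_triangle z) + ennreal (2 * \<delta> * E) * N z) * ennreal \<delta>"
        using d by (subst nn_integral_cmult) auto
      also have "\<dots> = ennreal (2 * \<delta>) * (U z * indicator unit_triangle z) + ennreal (2 * E * \<delta>\<^sup>2) * N z"
        using d E by (simp add: distrib_right distrib_left ennreal_mult power2_eq_square ac_simps)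
      finally show ?thesis .
    qed
    have "(\<integral>\<^sup>+x\<in>{x \<in> K. p \<bullet> x + q < \<delta>}. ennreal ((u x)\<^sup>2) \<partial>lborel)
       \<le> ennreal \<kappa> * (\<integral>\<^sup>+z. ennreal (2 * \<delta>) * (U z * indicator unit_triangle z) + ennreal (2 * E * \<delta>\<^sup>2) * N z \<partial>lborel)"
      unfolding ch[OF mu] by (intro mult_left_mono nn_integral_mono fib) simp
    also have "\<dots> = ennreal \<kappa> * (ennreal (2 * \<delta>) * (\<integral>\<^sup>+z\<in>unit_triangle. U z \<partial>lborel) + ennreal (2 * E * \<delta>\<^sup>2) * (\<integral>\<^sup>+z. N z \<partial>lborel))"
      using mU mN by (simp add: nn_integral_add nn_integral_cmult)
    also have "\<dots> = ennreal (2 * \<kappa> * \<delta>) * (\<integral>\<^sup>+z\<in>unit_triangle. U z \<partial>lborel)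
        + ennreal (2 * E * \<delta>\<^sup>2) * (ennreal \<kappa> * (\<integral>\<^sup>+z. N z \<partial>lborel))"
      using d E k by (simp add: distrib_left ennreal_mult ac_simps)
    also have "ennreal \<kappa> * (\<integral>\<^sup>+z. N z \<partial>lborel) = (\<integral>\<^sup>+x\<in>{x \<in> K. p \<bullet> x + q < \<delta>}. ennreal ((norm (grad u x))\<^sup>2) \<partial>lborel)"
      unfolding N_def ch[OF mg] ..
    also have "ennreal (2 * \<kappa> * \<delta>) * (\<integral>\<^sup>+z\<in>unit_triangle. U z \<partial>lborel)
        + ennreal (2 * E * \<delta>\<^sup>2) * (\<integral>\<^sup>+x\<in>{x \<in> K. p \<bullet> x + q < \<delta>}. ennreal ((norm (grad u x))\<^sup>2) \<partial>lborel)
      \<le> ennreal (C * \<delta>) * (\<integral>\<^sup>+z\<in>unit_triangle. U z \<partial>lborel)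
        + ennreal (C * \<delta>\<^sup>2) * (\<integral>\<^sup>+x\<in>{x \<in> K. p \<bullet> x + q < \<delta>}. ennreal ((norm (grad u x))\<^sup>2) \<partial>lborel)"
      using d k E by (intro add_mono mult_right_mono ennreal_leI) (auto simp: C_def)
    finally show "(\<integral>\<^sup>+x\<in>{x \<in> K. p \<bullet> x + q < \<delta>}. ennreal ((u x)\<^sup>2) \<partial>lborel)
      \<le> ennreal (C * \<delta>) * (\<integral>\<^sup>+z\<in>unit_triangle. ennreal ((u (Phi a b c d (z, 0)))\<^sup>2) \<partial>lborel)
        + ennreal (C * \<delta>\<^sup>2) * (\<integral>\<^sup>+x\<in>{x \<in> K. p \<bullet> x + q < \<delta>}. ennreal ((norm (grad u x))\<^sup>2) \<partial>lborel)"
      unfolding U_def .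
  qed
qed

text \<open>The reverse fibre bound is integrated over a whole fibre. Its left-hand side does not
  depend on the height and so picks up the length of the fibre, which is the origin of the weight
  \<open>fiber_end 1 z\<close>.\<close>

lemma trace_estimate_nn:
  obtains C :: real where "0 < C"
    "\<And>u. smooth u \<Longrightarrow> (\<integral>\<^sup>+z. ennreal (fiber_end 1 z * (u (Phi a b c d (z, 0)))\<^sup>2) \<partial>lborel)
      \<le> ennreal C * (\<integral>\<^sup>+x\<in>K. ennreal ((u x)\<^sup>2) \<partial>lborel) + ennreal C * (\<integral>\<^sup>+x\<in>K. ennreal ((norm (grad u x))\<^sup>2) \<partial>lborel)"
proof -
  obtain \<kappa> where k: "0 < \<kappa>" and ch: "\<And>f \<delta>. f \<in> borel_measurable borel \<Longrightarrow>
      (\<integral>\<^sup>+x\<in>{x \<in> K. p \<bullet> x + q < \<delta>}. f x \<partial>lborel)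
      = ennreal \<kappa> * (\<integral>\<^sup>+z. (\<integral>\<^sup>+r\<in>{0<..<fiber_end \<delta> z}. f (Phi a b c d (z, r)) \<partial>lborel) \<partial>lborel)"
    by (rule fiber_change) blast
  define E where "E = (norm (d - a))\<^sup>2"
  define C where "C = 2 / \<kappa> + 2 * E / \<kappa>"
  have E: "E \<ge> 0" by (simp add: E_def)
  have C: "C > 0" using k E by (simp add: C_def add_pos_nonneg)
  have inK: "(\<integral>\<^sup>+z. (\<integral>\<^sup>+r\<in>{0<..<fiber_end 1 z}. f (Phi a b c d (z, r)) \<partial>lborel) \<partial>lborel)
      \<le> ennreal (1 / \<kappa>) * (\<integral>\<^sup>+x\<in>K. f x \<partial>lborel)" (is "?X \<le> _") if f: "f \<in> borel_measurable borel" for f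
  proof -
    have "?X = ennreal (1 / \<kappa>) * (ennreal \<kappa> * ?X)"
      using k by (simp add: mult.assoc[symmetric] ennreal_mult[symmetric])
    also have "\<dots> \<le> ennreal (1 / \<kappa>) * (\<integral>\<^sup>+x\<in>K. f x \<partial>lborel)"
      unfolding ch[OF f, symmetric]
      by (intro mult_left_mono nn_integral_mono) (auto simp: indicator_def)
    finally show ?thesis .
  qed
  show ?thesis
  proof (rule that[OF C])
    fix u :: "R3 \<Rightarrow> real" assume u: "smooth u"
    have mu: "(\<lambda>x. ennreal ((u x)\<^sup>2)) \<in> borel_measurable borel"
      using smooth_measurable[OF u] by measurable
    have mg: "(\<lambda>x. ennreal ((norm (grad u x))\<^sup>2)) \<in> borel_measurable borel"
      using borel_measurable_continuous_onI[OF smooth_grad_continuous[OF u]] by measurable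
    define N where "N z = (\<integral>\<^sup>+\<rho>\<in>{0<..<fiber_end 1 z}. ennreal ((norm (grad u (Phi a b c d (z, \<rho>))))\<^sup>2) \<partial>lborel)" for z
    define V where "V z = (\<integral>\<^sup>+r\<in>{0<..<fiber_end 1 z}. ennreal ((u (Phi a b c d (z, r)))\<^sup>2) \<partial>lborel)" for z
    have mN: "N \<in> borel_measurable borel" unfolding N_def[abs_def] by (rule fiber_measurable[OF mg])
    have mV: "V \<in> borel_measurable borel" unfolding V_def[abs_def] by (rule fiber_measurable[OF mu])
    have fib: "ennreal (fiber_end 1 z * (u (Phi a b c d (z, 0)))\<^sup>2) \<le> 2 * V z + ennreal (2 * E) * N z" for z
    proof (cases "0 < fiber_end 1 z")
      case False
      then have "fiber_end 1 z * (u (Phi a b c d (z, 0)))\<^sup>2 \<le> 0" by (simp add: mult_nonpos_nonneg)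
      then show ?thesis by (simp add: ennreal_neg)
    next
      case True
      let ?l = "fiber_end 1 z"
      have l: "0 < ?l" "?l \<le> 1" using True fiber_end_le[of 1 z] by auto
      have ms: "(\<lambda>r. ennreal ((u (Phi a b c d (z, r)))\<^sup>2)) \<in> borel_measurable borel"
        by (rule Phi_section_measurable(1)[OF mu])
      have "ennreal (?l * (u (Phi a b c d (z, 0)))\<^sup>2) = (\<integral>\<^sup>+r\<in>{0<..<?l}. ennreal ((u (Phi a b c d (z, 0)))\<^sup>2) \<partial>lborel)"
        using l by (subst nn_integral_cmult_indicator) (simp_all add: ennreal_mult mult.commute)
      also have "\<dots> \<le> (\<integral>\<^sup>+r. 2 * (ennreal ((u (Phi a b c d (z, r)))\<^sup>2) * indicator {0<..<?l} r)
          + ennreal (2 * E) * N z * indicator {0<..<?l} r \<partial>lborel)"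
      proof (rule nn_integral_mono)
        fix r
        show "ennreal ((u (Phi a b c d (z, 0)))\<^sup>2) * indicator {0<..<?l} r
          \<le> 2 * (ennreal ((u (Phi a b c d (z, r)))\<^sup>2) * indicator {0<..<?l} r) + ennreal (2 * E) * N z * indicator {0<..<?l} r"
        proof (cases "r \<in> {0<..<?l}")
          case True
          then have r: "0 < r" "r < ?l" by auto
          have "r * E \<le> 1 * E" using r l E by (intro mult_right_mono) auto
          then have "ennreal (2 * r * (norm (d - a))\<^sup>2) \<le> ennreal (2 * E)"
            unfolding E_def by (intro ennreal_leI) simp
          then have "ennreal ((u (Phi a b c d (z, 0)))\<^sup>2) \<le> 2 * ennreal ((u (Phi a b c d (z, r)))\<^sup>2) + ennreal (2 * E) * N z"
            using fiber_pointwise(2)[OF u r, of z] unfolding N_def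
            by (elim order_trans) (intro add_left_mono mult_right_mono, auto)
          then show ?thesis using True by simp
        qed simp
      qed
      also have "\<dots> = 2 * V z + ennreal (2 * E) * N z * ennreal ?l"
        using l ms unfolding V_def by (subst nn_integral_add) (auto simp: nn_integral_cmult nn_integral_cmult_indicator)
      also have "\<dots> \<le> 2 * V z + ennreal (2 * E) * N z * 1"
        using l by (intro add_left_mono mult_left_mono) auto
      finally show ?thesis by simp
    qed
    have "(\<integral>\<^sup>+z. ennreal (fiber_end 1 z * (u (Phi a b c d (z, 0)))\<^sup>2) \<partial>lborel)
        \<le> (\<integral>\<^sup>+z. 2 * V z + ennreal (2 * E) * N z \<partial>lborel)"
      by (intro nn_integral_mono fib)
    also have "\<dots> = 2 * (\<integral>\<^sup>+z. V z \<partial>lborel) + ennreal (2 * E) * (\<integral>\<^sup>+z. N z \<partial>lborel)"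
      using mV mN by (simp add: nn_integral_add nn_integral_cmult)
    also have "\<dots> \<le> 2 * (ennreal (1 / \<kappa>) * (\<integral>\<^sup>+x\<in>K. ennreal ((u x)\<^sup>2) \<partial>lborel))
        + ennreal (2 * E) * (ennreal (1 / \<kappa>) * (\<integral>\<^sup>+x\<in>K. ennreal ((norm (grad u x))\<^sup>2) \<partial>lborel))"
      unfolding V_def N_def by (intro add_mono mult_left_mono inK mu mg) auto
    also have "\<dots> = ennreal (2 / \<kappa>) * (\<integral>\<^sup>+x\<in>K. ennreal ((u x)\<^sup>2) \<partial>lborel)
        + ennreal (2 * E / \<kappa>) * (\<integral>\<^sup>+x\<in>K. ennreal ((norm (grad u x))\<^sup>2) \<partial>lborel)"
    proof -
      have "ennreal (2 / \<kappa>) = 2 * ennreal (1 / \<kappa>)" "ennreal (2 * E / \<kappa>) = ennreal (2 * E) * ennreal (1 / \<kappa>)"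
        using k E by (simp_all flip: ennreal_mult ennreal_numeral)
      then show ?thesis by (simp add: mult.assoc)
    qed
    also have "\<dots> \<le> ennreal C * (\<integral>\<^sup>+x\<in>K. ennreal ((u x)\<^sup>2) \<partial>lborel)
        + ennreal C * (\<integral>\<^sup>+x\<in>K. ennreal ((norm (grad u x))\<^sup>2) \<partial>lborel)"
      using k E by (intro add_mono mult_right_mono ennreal_leI) (auto simp: C_def)
    finally show "(\<integral>\<^sup>+z. ennreal (fiber_end 1 z * (u (Phi a b c d (z, 0)))\<^sup>2) \<partial>lborel)
      \<le> ennreal C * (\<integral>\<^sup>+x\<in>K. ennreal ((u x)\<^sup>2) \<partial>lborel) + ennreal C * (\<integral>\<^sup>+x\<in>K. ennreal ((norm (grad u x))\<^sup>2) \<partial>lborel)" .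
  qed
qed

end

text \<open>Positivity of the surface Jacobian allows dividing by it, so face integrals in the chart
  can be expressed through \<open>triangle_measure\<close>.\<close>

lemma nondegenerate_cross3:
  assumes "nondegenerate a b c d" shows "0 < norm (cross3 (b - a) (c - a))"
proof -
  have "cross3 (b - a) (c - a) \<noteq> 0"
  proof
    assume "cross3 (b - a) (c - a) = 0"
    then have "b - a = 0 \<or> c - a = 0 \<or> (\<exists>k. c - a = k *\<^sub>R (b - a))"
      by (simp add: cross_eq_0 collinear_lemma)
    then show False
    proof (elim disjE exE)
      assume "b - a = 0"
      then have "1 *\<^sub>R (b - a) + 0 *\<^sub>R (c - a) + 0 *\<^sub>R (d - a) = 0" by simp
      then show False using assms unfolding nondegenerate_def by fastforce
    next
      assume "c - a = 0"
      then have "0 *\<^sub>R (b - a) + 1 *\<^sub>R (c - a) + 0 *\<^sub>R (d - a) = 0" by simp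
      then show False using assms unfolding nondegenerate_def by fastforce
    next
      fix k assume "c - a = k *\<^sub>R (b - a)"
      then have "(- k) *\<^sub>R (b - a) + 1 *\<^sub>R (c - a) + 0 *\<^sub>R (d - a) = 0" by simp
      then show False using assms unfolding nondegenerate_def by fastforce
    qed
  qed
  then show ?thesis by simp
qed

lemma ennreal_lincomb:
  "0 \<le> a \<Longrightarrow> 0 \<le> x \<Longrightarrow> 0 \<le> b \<Longrightarrow> 0 \<le> y \<Longrightarrow> ennreal a * ennreal x + ennreal b * ennreal y = ennreal (a * x + b * y)"
  by (simp add: ennreal_mult)

text \<open>Translates the extended nonnegative integrals of the fibre estimates into the real
  integrals over \<open>lebesgue_on K\<close> in which limits are taken.\<close>

lemma set_nn_integral_continuous:
  fixes h :: "R3 \<Rightarrow> 'b::euclidean_space"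
  assumes K: "open K" "bounded K" and S: "S \<in> sets borel" "S \<subseteq> K" and h: "continuous_on UNIV h"
  shows "(\<integral>\<^sup>+x\<in>S. ennreal ((norm (h x))\<^sup>2) \<partial>lborel) = ennreal (\<integral>x. indicator S x * (norm (h x))\<^sup>2 \<partial>lebesgue_on K)"
proof -
  note L = L2_continuous[OF K h]
  have hm[measurable]: "h \<in> borel_measurable borel" by (rule borel_measurable_continuous_onI[OF h])
  note S(1)[measurable]
  have "integrable (lebesgue_on K) (\<lambda>x. indicator S x * (norm (h x))\<^sup>2)"
  proof (rule Bochner_Integration.integrable_bound[OF L2_integrable[OF L]])
    have "(\<lambda>x. indicator S x * (norm (h x))\<^sup>2) \<in> borel_measurable borel" by measurable
    then show "(\<lambda>x. indicator S x * (norm (h x))\<^sup>2) \<in> borel_measurable (lebesgue_on K)"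
      by (intro measurable_restrict_space1 measurable_completion) simp
  qed (auto simp: indicator_def)
  then have "(\<integral>\<^sup>+x. ennreal (indicator S x * (norm (h x))\<^sup>2) \<partial>lebesgue_on K)
      = ennreal (\<integral>x. indicator S x * (norm (h x))\<^sup>2 \<partial>lebesgue_on K)"
    by (intro nn_integral_eq_integral) auto
  moreover have "(\<integral>\<^sup>+x. ennreal (indicator S x * (norm (h x))\<^sup>2) \<partial>lebesgue_on K)
      = (\<integral>\<^sup>+x\<in>K. ennreal (indicator S x * (norm (h x))\<^sup>2) \<partial>lborel)"
    using K by (intro nn_integral_lebesgue_on_borel) auto
  moreover have "\<dots> = (\<integral>\<^sup>+x\<in>S. ennreal ((norm (h x))\<^sup>2) \<partial>lborel)"
    using S(2) by (intro nn_integral_cong) (auto simp: indicator_def)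
  ultimately show ?thesis by simp
qed

context corner
begin

lemma layer_estimate_smooth:
  assumes bK: "bounded K"
  obtains C :: real where "0 < C"
    "\<And>u \<delta>. smooth u \<Longrightarrow> L2 (triangle_measure a b c) u \<Longrightarrow> 0 < \<delta> \<Longrightarrow> \<delta> \<le> 1 \<Longrightarrow>
      (\<integral>x. indicator {x \<in> K. p \<bullet> x + q < \<delta>} x * (norm (u x))\<^sup>2 \<partial>lebesgue_on K)
      \<le> C * \<delta> * (\<integral>x. (norm (u x))\<^sup>2 \<partial>triangle_measure a b c)
        + C * \<delta>\<^sup>2 * (\<integral>x. indicator {x \<in> K. p \<bullet> x + q < \<delta>} x * (norm (grad u x))\<^sup>2 \<partial>lebesgue_on K)"
proof -
  define J where "J = norm (cross3 (b - a) (c - a))"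
  have J: "J > 0" unfolding J_def by (rule nondegenerate_cross3[OF nd])
  obtain C where C: "0 < C" "\<And>u \<delta>. smooth u \<Longrightarrow> 0 < \<delta> \<Longrightarrow> \<delta> \<le> 1 \<Longrightarrow>
      (\<integral>\<^sup>+x\<in>{x \<in> K. p \<bullet> x + q < \<delta>}. ennreal ((u x)\<^sup>2) \<partial>lborel)
      \<le> ennreal (C * \<delta>) * (\<integral>\<^sup>+z\<in>unit_triangle. ennreal ((u (Phi a b c d (z, 0)))\<^sup>2) \<partial>lborel)
        + ennreal (C * \<delta>\<^sup>2) * (\<integral>\<^sup>+x\<in>{x \<in> K. p \<bullet> x + q < \<delta>}. ennreal ((norm (grad u x))\<^sup>2) \<partial>lborel)"
    by (rule layer_estimate_nn) blast
  \<comment> \<open>The face integral in the chart equals the integral over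
    \<open>triangle_measure\<close> divided by \<open>J\<close>; the second summand serves the
    energy term.\<close>
  define C' where "C' = C / J + C"
  have C': "C' > 0" using C(1) J by (simp add: C'_def add_pos_pos)
  show ?thesis
  proof (rule that[OF C'])
    fix u and \<delta> :: real assume u: "smooth u" and Lu: "L2 (triangle_measure a b c) u" and d: "0 < \<delta>" "\<delta> \<le> 1"
    let ?S = "{x \<in> K. p \<bullet> x + q < \<delta>}"
    let ?A = "\<integral>x. indicator ?S x * (norm (u x))\<^sup>2 \<partial>lebesgue_on K"
    let ?B = "\<integral>x. indicator ?S x * (norm (grad u x))\<^sup>2 \<partial>lebesgue_on K"
    let ?T = "\<integral>x. (norm (u x))\<^sup>2 \<partial>triangle_measure a b c"
    have S: "?S \<subseteq> K" by auto
    have A: "(\<integral>\<^sup>+x\<in>?S. ennreal ((u x)\<^sup>2) \<partial>lborel) = ennreal ?A"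
      using set_nn_integral_continuous[OF oK bK layer_borel S smooth_continuous[OF u]] by simp
    have B: "(\<integral>\<^sup>+x\<in>?S. ennreal ((norm (grad u x))\<^sup>2) \<partial>lborel) = ennreal ?B"
      by (rule set_nn_integral_continuous[OF oK bK layer_borel S smooth_grad_continuous[OF u]])
    define X where "X = (\<integral>\<^sup>+z\<in>unit_triangle. ennreal ((u (Phi a b c d (z, 0)))\<^sup>2) \<partial>lborel)"
    have "(\<lambda>x. ennreal ((norm (u x))\<^sup>2)) \<in> borel_measurable (triangle_measure a b c)"
      using L2_measurable[OF Lu] by measurable
    from nn_integral_triangle_measure[OF this, where d=d] have T: "ennreal ?T = ennreal J * X"
      unfolding L2_nn_integral[OF Lu] by (simp add: J_def X_def)
    have "X = ennreal (1 / J) * (ennreal J * X)"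
      using J by (simp add: mult.assoc[symmetric] ennreal_mult[symmetric])
    then have X: "X = ennreal (?T / J)" unfolding T[symmetric] using J by (simp add: ennreal_mult[symmetric])
    have nn: "?T \<ge> 0" "?B \<ge> 0" by (auto intro!: Bochner_Integration.integral_nonneg)
    have "ennreal ?A \<le> ennreal (C * \<delta>) * ennreal (?T / J) + ennreal (C * \<delta>\<^sup>2) * ennreal ?B"
      using C(2)[OF u d] unfolding A B X_def[symmetric] X .
    also have "\<dots> = ennreal (C * \<delta> * (?T / J) + C * \<delta>\<^sup>2 * ?B)"
      by (rule ennreal_lincomb) (use C(1) d J nn in auto)
    finally have "?A \<le> C * \<delta> * (?T / J) + C * \<delta>\<^sup>2 * ?B"
      using C(1) d J nn by (subst (asm) ennreal_le_iff) auto
    also have "\<dots> = (C / J) * (\<delta> * ?T) + C * (\<delta>\<^sup>2 * ?B)" by simp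
    also have "\<dots> \<le> C' * (\<delta> * ?T) + C' * (\<delta>\<^sup>2 * ?B)"
      using C(1) d J nn by (intro add_mono mult_right_mono) (auto simp: C'_def)
    finally show "?A \<le> C' * \<delta> * ?T + C' * \<delta>\<^sup>2 * ?B" by (simp add: mult.assoc)
  qed
qed

text \<open>For fixed \<delta> all three terms are quadratic with bounded weights, hence continuous
  along the approximation, and the estimate for smooth functions passes to the limit.\<close>

lemma layer_estimate:
  assumes bK: "bounded K"
  obtains C :: real where "0 < C"
    "\<And>u v G g \<delta>. (\<And>n. smooth (u n)) \<Longrightarrow> L2_tendsto (lebesgue_on K) u v \<Longrightarrow>
      L2_tendsto (lebesgue_on K) (\<lambda>n. grad (u n)) G \<Longrightarrow> L2_tendsto (triangle_measure a b c) u g \<Longrightarrow>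
      0 < \<delta> \<Longrightarrow> \<delta> \<le> 1 \<Longrightarrow>
      (\<integral>x. indicator {x \<in> K. p \<bullet> x + q < \<delta>} x * (norm (v x))\<^sup>2 \<partial>lebesgue_on K)
      \<le> C * \<delta> * (\<integral>x. (norm (g x))\<^sup>2 \<partial>triangle_measure a b c)
        + C * \<delta>\<^sup>2 * (\<integral>x. indicator {x \<in> K. p \<bullet> x + q < \<delta>} x * (norm (G x))\<^sup>2 \<partial>lebesgue_on K)"
proof -
  obtain C where C: "0 < C" and est: "\<And>u \<delta>. smooth u \<Longrightarrow> L2 (triangle_measure a b c) u \<Longrightarrow> 0 < \<delta> \<Longrightarrow> \<delta> \<le> 1 \<Longrightarrow>
      (\<integral>x. indicator {x \<in> K. p \<bullet> x + q < \<delta>} x * (norm (u x))\<^sup>2 \<partial>lebesgue_on K)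
      \<le> C * \<delta> * (\<integral>x. (norm (u x))\<^sup>2 \<partial>triangle_measure a b c)
        + C * \<delta>\<^sup>2 * (\<integral>x. indicator {x \<in> K. p \<bullet> x + q < \<delta>} x * (norm (grad u x))\<^sup>2 \<partial>lebesgue_on K)"
    by (rule layer_estimate_smooth[OF bK]) blast
  show ?thesis
  proof (rule that[OF C])
    fix u v G g and \<delta> :: real assume u: "\<And>n. smooth (u n)" and v: "L2_tendsto (lebesgue_on K) u v"
      and G: "L2_tendsto (lebesgue_on K) (\<lambda>n. grad (u n)) G" and g: "L2_tendsto (triangle_measure a b c) u g"
      and d: "0 < \<delta>" "\<delta> \<le> (1::real)"
    let ?c = "\<lambda>x. indicator {x \<in> K. p \<bullet> x + q < \<delta>} x :: real"
    have c: "?c \<in> borel_measurable (lebesgue_on K)"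
      using layer_borel by (intro measurable_restrict_space1 measurable_completion) simp
    have cb: "AE x in lebesgue_on K. \<bar>?c x\<bar> \<le> 1" by (auto simp: indicator_def)
    note 1 = L2_tendsto_weighted_inner[OF v v c cb] L2_tendsto_weighted_inner[OF G G c cb]
      L2_tendsto_weighted_inner[OF g g, of "\<lambda>x. 1" 1]
    have lim: "(\<lambda>n. \<integral>x. ?c x * (norm (u n x))\<^sup>2 \<partial>lebesgue_on K) \<longlonglongrightarrow> (\<integral>x. ?c x * (norm (v x))\<^sup>2 \<partial>lebesgue_on K)"
      "(\<lambda>n. \<integral>x. ?c x * (norm (grad (u n) x))\<^sup>2 \<partial>lebesgue_on K) \<longlonglongrightarrow> (\<integral>x. ?c x * (norm (G x))\<^sup>2 \<partial>lebesgue_on K)"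
      "(\<lambda>n. \<integral>x. (norm (u n x))\<^sup>2 \<partial>triangle_measure a b c) \<longlonglongrightarrow> (\<integral>x. (norm (g x))\<^sup>2 \<partial>triangle_measure a b c)"
      using 1 unfolding dot_square_norm by (simp_all add: power2_eq_square)
    show "(\<integral>x. ?c x * (norm (v x))\<^sup>2 \<partial>lebesgue_on K)
      \<le> C * \<delta> * (\<integral>x. (norm (g x))\<^sup>2 \<partial>triangle_measure a b c)
        + C * \<delta>\<^sup>2 * (\<integral>x. ?c x * (norm (G x))\<^sup>2 \<partial>lebesgue_on K)"
      by (rule LIMSEQ_le[OF lim(1) tendsto_add[OF tendsto_mult_left[OF lim(3)] tendsto_mult_left[OF lim(2)]]])
        (use est[OF u L2_tendstoD(1)[OF g] d] in blast)
  qed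
qed

text \<open>The weight in the trace estimate vanishes on the edges of the face; continuity of \<open>g\<close> covers them.\<close>

lemma trace_zero:
  assumes bK: "bounded K" and u: "\<And>n. smooth (u n)"
    and u0: "(\<lambda>n. \<integral>x. (norm (u n x))\<^sup>2 \<partial>lebesgue_on K) \<longlonglongrightarrow> 0"
    and g0: "(\<lambda>n. \<integral>x. (norm (grad (u n) x))\<^sup>2 \<partial>lebesgue_on K) \<longlonglongrightarrow> 0"
    and g: "L2_tendsto (triangle_measure a b c) u g"
    and cg: "continuous_on (convex hull {a, b, c}) g"
    and x: "x \<in> convex hull {a, b, c}"
  shows "g x = 0"
proof -
  define J where "J = norm (cross3 (b - a) (c - a))"
  have J: "J > 0" unfolding J_def by (rule nondegenerate_cross3[OF nd])
  obtain C where C: "0 < C" "\<And>u. smooth u \<Longrightarrow> (\<integral>\<^sup>+z. ennreal (fiber_end 1 z * (u (Phi a b c d (z, 0)))\<^sup>2) \<partial>lborel)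
      \<le> ennreal C * (\<integral>\<^sup>+x\<in>K. ennreal ((u x)\<^sup>2) \<partial>lborel) + ennreal C * (\<integral>\<^sup>+x\<in>K. ennreal ((norm (grad u x))\<^sup>2) \<partial>lborel)"
    by (rule trace_estimate_nn) blast
  have Km: "K \<in> sets borel" using oK by simp
  define h where "h z = g (Phi a b c d (z, 0))" for z
  have ch: "continuous_on unit_triangle h" unfolding h_def
    by (rule continuous_on_compose2[OF cg continuous_on_compose2[OF continuous_Phi[of UNIV]]])
      (auto intro!: continuous_intros Phi_face_in_hull)
  \<comment> \<open>\<open>g\<close> is continuous only on the face; extension by zero in the chart
    makes it Borel measurable on the whole plane.\<close>
  define gz where "gz z = indicator unit_triangle z *\<^sub>R h z" for z
  have mgz[measurable]: "gz \<in> borel_measurable borel"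
    unfolding gz_def[abs_def] by (rule borel_measurable_continuous_on_indicator[OF unit_triangle_borel ch])
  have w[measurable]: "fiber_end 1 \<in> borel_measurable borel"
  proof -
    have "open {z :: real \<times> real. 0 < fst z \<and> 0 < snd z}"
      by (intro open_Collect_conj open_Collect_less continuous_intros)
    then have "(\<lambda>z. if z \<in> {z. 0 < fst z \<and> 0 < snd z} then min 1 (1 - fst z - snd z) else 0 :: real) \<in> borel_measurable borel"
      by (intro measurable_If_set borel_measurable_continuous_onI continuous_intros) auto
    then show ?thesis by (simp add: fiber_end_def case_prod_unfold)
  qed
  define X where "X = (\<integral>\<^sup>+z. ennreal (fiber_end 1 z * (gz z)\<^sup>2) \<partial>lborel)"
  \<comment> \<open>Comparing \<open>g\<close> with \<open>u n\<close>, the weighted square of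
    \<open>u n\<close> is controlled by the trace estimate and the square of \<open>u n - g\<close>
    by the convergence on the face. All three integrals tend to zero.\<close>
  define r where "r n = 2 * (C * (\<integral>x. (norm (u n x))\<^sup>2 \<partial>lebesgue_on K) + C * (\<integral>x. (norm (grad (u n) x))\<^sup>2 \<partial>lebesgue_on K))
      + 2 * ((\<integral>x. (norm (u n x - g x))\<^sup>2 \<partial>triangle_measure a b c) / J)" for n
  have "r \<longlonglongrightarrow> 2 * (C * 0 + C * 0) + 2 * (0 / J)"
    unfolding r_def[abs_def] by (intro tendsto_intros u0 g0 L2_tendstoD(3)[OF g]) (use J in simp)
  then have r0: "r \<longlonglongrightarrow> 0" by simp
  have le: "X \<le> ennreal (r n)" for n
  proof -
    have Ld: "L2 (triangle_measure a b c) (\<lambda>x. u n x - g x)"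
      by (intro L2_diff L2_tendstoD[OF g])
    have mPhi: "(\<lambda>z. u n (Phi a b c d (z, 0))) \<in> borel_measurable borel"
      by (rule Phi_section_measurable(2)[OF smooth_measurable[OF u]])
    note [measurable] = mPhi
    let ?P = "\<integral>\<^sup>+z. ennreal (fiber_end 1 z * (u n (Phi a b c d (z, 0)))\<^sup>2) \<partial>lborel"
    let ?Y = "\<integral>\<^sup>+z\<in>unit_triangle. ennreal ((norm (u n (Phi a b c d (z, 0)) - g (Phi a b c d (z, 0))))\<^sup>2) \<partial>lborel"
    let ?a = "\<integral>x. (norm (u n x))\<^sup>2 \<partial>lebesgue_on K" and ?b = "\<integral>x. (norm (grad (u n) x))\<^sup>2 \<partial>lebesgue_on K"
    let ?t = "\<integral>x. (norm (u n x - g x))\<^sup>2 \<partial>triangle_measure a b c"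
    have "X \<le> (\<integral>\<^sup>+z. 2 * ennreal (fiber_end 1 z * (u n (Phi a b c d (z, 0)))\<^sup>2)
        + 2 * ennreal (indicator unit_triangle z * (u n (Phi a b c d (z, 0)) - gz z)\<^sup>2) \<partial>lborel)"
      unfolding X_def
    proof (rule nn_integral_mono)
      fix z
      let ?w = "fiber_end 1 z" and ?u = "u n (Phi a b c d (z, 0))"
      show "ennreal (?w * (gz z)\<^sup>2) \<le> 2 * ennreal (?w * ?u\<^sup>2) + 2 * ennreal (indicator unit_triangle z * (?u - gz z)\<^sup>2)"
      proof (cases "0 < ?w")
        case True
        have T: "z \<in> unit_triangle" using fiber_end_triangle[of "?w / 2" 1 z] True by simp
        have w1: "?w \<le> 1" by (rule fiber_end_le) simp
        have "(gz z)\<^sup>2 \<le> 2 * ?u\<^sup>2 + 2 * (?u - gz z)\<^sup>2"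
          using norm_add_sq_le[of ?u "gz z - ?u"] by (simp add: power2_commute)
        then have "?w * (gz z)\<^sup>2 \<le> ?w * (2 * ?u\<^sup>2 + 2 * (?u - gz z)\<^sup>2)"
          using True by (intro mult_left_mono) auto
        also have "\<dots> \<le> 2 * (?w * ?u\<^sup>2) + 2 * (?u - gz z)\<^sup>2"
          using mult_right_mono[OF w1, of "2 * (?u - gz z)\<^sup>2"] by (simp add: algebra_simps)
        finally have "ennreal (?w * (gz z)\<^sup>2) \<le> ennreal (2 * (?w * ?u\<^sup>2) + 2 * (?u - gz z)\<^sup>2)" by (rule ennreal_leI)
        then show ?thesis using True T by (simp add: ennreal_mult ennreal_plus)
      next
        case False
        then have "?w * (gz z)\<^sup>2 \<le> 0" by (simp add: mult_nonpos_nonneg)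
        then show ?thesis by (simp add: ennreal_neg)
      qed
    qed
    also have "\<dots> = 2 * (\<integral>\<^sup>+z. ennreal (fiber_end 1 z * (u n (Phi a b c d (z, 0)))\<^sup>2) \<partial>lborel)
        + 2 * (\<integral>\<^sup>+z. ennreal (indicator unit_triangle z * (u n (Phi a b c d (z, 0)) - gz z)\<^sup>2) \<partial>lborel)"
      by (subst nn_integral_add) (auto simp: nn_integral_cmult)
    also have "(\<integral>\<^sup>+z. ennreal (indicator unit_triangle z * (u n (Phi a b c d (z, 0)) - gz z)\<^sup>2) \<partial>lborel)
       = (\<integral>\<^sup>+z\<in>unit_triangle. ennreal ((norm (u n (Phi a b c d (z, 0)) - g (Phi a b c d (z, 0))))\<^sup>2) \<partial>lborel)"
      by (intro nn_integral_cong) (auto simp: gz_def h_def indicator_def)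
    finally have 1: "X \<le> 2 * ?P + 2 * ?Y" .
    have 2: "?Y = ennreal (?t / J)"
    proof -
      have "(\<lambda>x. ennreal ((norm (u n x - g x))\<^sup>2)) \<in> borel_measurable (triangle_measure a b c)"
        using L2_measurable[OF Ld] by measurable
      from nn_integral_triangle_measure[OF this, where d=d]
      have T: "ennreal (\<integral>x. (norm (u n x - g x))\<^sup>2 \<partial>triangle_measure a b c) = ennreal J * ?Y"
        unfolding L2_nn_integral[OF Ld] by (simp add: J_def)
      have "?Y = ennreal (1 / J) * (ennreal J * ?Y)"
        using J by (simp add: mult.assoc[symmetric] ennreal_mult[symmetric])
      then show ?thesis unfolding T[symmetric] using J by (simp add: ennreal_mult[symmetric])
    qed
    have 3: "?P \<le> ennreal C * (\<integral>\<^sup>+x\<in>K. ennreal ((u n x)\<^sup>2) \<partial>lborel) + ennreal C * (\<integral>\<^sup>+x\<in>K. ennreal ((norm (grad (u n) x))\<^sup>2) \<partial>lborel)"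
      by (rule C(2)[OF u])
    have 4: "(\<integral>\<^sup>+x\<in>K. ennreal ((u n x)\<^sup>2) \<partial>lborel) = ennreal ?a"
      using nn_integral_lebesgue_on_borel[OF Km, of "\<lambda>x. ennreal ((u n x)\<^sup>2)"] smooth_measurable[OF u]
        L2_nn_integral[OF L2_smooth[OF oK bK u]] by simp
    have 5: "(\<integral>\<^sup>+x\<in>K. ennreal ((norm (grad (u n) x))\<^sup>2) \<partial>lborel) = ennreal ?b"
      using nn_integral_lebesgue_on_borel[OF Km, of "\<lambda>x. ennreal ((norm (grad (u n) x))\<^sup>2)"]
        borel_measurable_continuous_onI[OF smooth_grad_continuous[OF u]]
        L2_nn_integral[OF L2_smooth_grad[OF oK bK u]] by simp
    have nn: "?a \<ge> 0" "?b \<ge> 0" "?t \<ge> 0" by (auto intro!: Bochner_Integration.integral_nonneg)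
    have "X \<le> 2 * (ennreal C * ennreal ?a + ennreal C * ennreal ?b) + 2 * ennreal (?t / J)"
      using 1 3 unfolding 2 4 5 by (elim order_trans) (intro add_right_mono mult_left_mono, auto)
    also have "\<dots> = ennreal (r n)"
    proof -
      have "ennreal C * ennreal ?a + ennreal C * ennreal ?b = ennreal (C * ?a + C * ?b)"
        by (rule ennreal_lincomb) (use C(1) nn in auto)
      moreover have "ennreal 2 * ennreal (C * ?a + C * ?b) + ennreal 2 * ennreal (?t / J) = ennreal (r n)"
        unfolding r_def by (rule ennreal_lincomb) (use C(1) J nn in auto)
      ultimately show ?thesis by simp
    qed
    finally show ?thesis .
  qed
  have "X \<le> ennreal 0"
    by (rule LIMSEQ_le_const[OF tendsto_ennrealI[OF r0]]) (use le in blast)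
  then have "X = 0" by simp
  then have AE0: "AE z in lborel. ennreal (fiber_end 1 z * (gz z)\<^sup>2) = 0"
    unfolding X_def by (subst (asm) nn_integral_0_iff_AE) auto
  define U where "U = {(s, t). 0 < s \<and> 0 < t \<and> s + t < (1::real)}"
  have oU: "open U" unfolding U_def case_prod_beta
    by (intro open_Collect_conj open_Collect_less continuous_intros)
  have UT: "U \<subseteq> unit_triangle" by (auto simp: U_def unit_triangle_def)
  have h0: "h z = 0" if "z \<in> U" for z
  proof (rule ccontr)
    assume nz: "h z \<noteq> 0"
    \<comment> \<open>By continuity the points of the open triangle where \<open>h\<close> is
      nonzero form an open set. The weight is positive there, so this set is null, and a null open
      set is empty.\<close>
    let ?Z = "U \<inter> h -` (- {0})"
    have "open ?Z" by (rule continuous_open_preimage[OF continuous_on_subset[OF ch UT] oU])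
        (intro open_Compl closed_singleton)
    moreover have "?Z \<noteq> {}" using that nz by auto
    ultimately have "\<not> negligible ?Z" by (rule open_not_negligible)
    moreover have "AE z in lborel. z \<notin> ?Z"
      using AE0
    proof eventually_elim
      case (elim z)
      show ?case
      proof
        assume z: "z \<in> ?Z"
        then have "fiber_end 1 z > 0" by (auto simp: U_def fiber_end_def)
        moreover have "(gz z)\<^sup>2 > 0" using z UT by (auto simp: gz_def)
        ultimately have "fiber_end 1 z * (gz z)\<^sup>2 > 0" by (rule mult_pos_pos)
        then show False using elim unfolding ennreal_eq_0_iff by linarith
      qed
    qed
    then have "negligible ?Z"
      unfolding negligible_iff_null_sets using AE_iff_null_sets[of ?Z lebesgue] AE_completion[of "\<lambda>z. z \<notin> ?Z" lborel] \<open>open ?Z\<close>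
      by auto
    ultimately show False by contradiction
  qed
  obtain z where z: "z \<in> unit_triangle" "x = Phi a b c d (z, 0)" using hull_in_Phi_face[OF x] by metis
  \<comment> \<open>Boundary points of the triangle are approached along the segment towards its
    centroid, which runs through the interior.\<close>
  define y where "y n = z + inverse (real (Suc n)) *\<^sub>R ((1/3, 1/3) - z)" for n
  have yU: "y n \<in> U" for n
  proof -
    obtain s t where st: "z = (s, t)" "0 \<le> s" "0 \<le> t" "s + t \<le> 1" using z(1) by (auto simp: unit_triangle_def)
    define e where "e = inverse (real (Suc n))"
    have e: "0 < e" "e \<le> 1" by (auto simp: e_def field_simps)
    have "(1 - e) * (s + t) \<le> (1 - e) * 1" by (rule mult_left_mono) (use e st in auto)
    moreover have "0 \<le> (1 - e) * s" "0 \<le> (1 - e) * t" using e st by auto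
    ultimately show ?thesis using e unfolding y_def e_def[symmetric] st by (simp add: U_def algebra_simps)
  qed
  have "y \<longlonglongrightarrow> z + 0 *\<^sub>R ((1/3, 1/3) - z)"
    unfolding y_def[abs_def] by (intro tendsto_intros LIMSEQ_inverse_real_of_nat)
  then have "(\<lambda>n. h (y n)) \<longlonglongrightarrow> h z"
    by (intro continuous_on_tendsto_compose[OF ch]) (use z yU UT in \<open>auto intro!: always_eventually\<close>)
  then show ?thesis using h0[OF yU] z by (simp add: h_def LIMSEQ_const_iff)
qed

end

section \<open>Geometry of tetrahedra and uniqueness of traces\<close>

definition tetrahedron :: "R3 set \<Rightarrow> R3 set \<Rightarrow> bool" where
  "tetrahedron K S \<longleftrightarrow> \<not> affine_dependent S \<and> card S = 4 \<and> closure K = convex hull S \<and> K = interior (convex hull S)"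

lemma Phi_barycentric:
  "Phi a b c d ((s, t), r) = (1 - s - t - r) *\<^sub>R a + s *\<^sub>R b + t *\<^sub>R c + r *\<^sub>R d"
  by (simp add: Phi_def algebra_simps)

lemma tetrahedron_nondegenerate:
  assumes "\<not> affine_dependent {a, b, c, d}" "distinct [a, b, c, d]"
  shows "nondegenerate a b c d"
  unfolding nondegenerate_def
proof (intro allI impI)
  fix s t r :: real assume z: "s *\<^sub>R (b - a) + t *\<^sub>R (c - a) + r *\<^sub>R (d - a) = 0"
  \<comment> \<open>A linear relation between the edges at \<open>a\<close> is an affine relation
    between the vertices; the coefficient at \<open>a\<close> balances the sum to zero.\<close>
  define U where "U x = (if x = a then - (s + t + r) else if x = b then s else if x = c then t else r)" for x
  have "sum U {a, b, c, d} = 0" "(\<Sum>v\<in>{a, b, c, d}. U v *\<^sub>R v) = 0"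
    using assms(2) z by (auto simp: U_def algebra_simps)
  then have "\<forall>v\<in>{a, b, c, d}. U v = 0"
    using assms(1) unfolding affine_dependent_explicit_finite[of "{a, b, c, d}", simplified] by auto
  then show "s = 0 \<and> t = 0 \<and> r = 0" using assms(2) by (auto simp: U_def)
qed

lemma Phi_inj:
  assumes "nondegenerate a b c d" "Phi a b c d ((s, t), r) = Phi a b c d ((s', t'), r')"
  shows "s = s' \<and> t = t' \<and> r = r'"
proof -
  have "(s - s') *\<^sub>R (b - a) + (t - t') *\<^sub>R (c - a) + (r - r') *\<^sub>R (d - a) = 0"
    using assms(2) by (simp add: Phi_def algebra_simps)
  then show ?thesis using assms(1) unfolding nondegenerate_def by fastforce
qed

text \<open>\<open>s\<close>, \<open>t\<close>, \<open>r\<close> are the barycentric coordinates of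
  \<open>b\<close>, \<open>c\<close>, \<open>d\<close>, and \<open>a\<close> receives the remainder.
  Interior points are those with four positive coordinates.\<close>

lemma interior_tetrahedron_iff:
  assumes i: "\<not> affine_dependent {a, b, c, d}" and dist: "distinct [a, b, c, d]"
  shows "Phi a b c d ((s, t), r) \<in> interior (convex hull {a, b, c, d}) \<longleftrightarrow> 0 < s \<and> 0 < t \<and> 0 < r \<and> s + t + r < 1"
proof -
  have "card {a, b, c, d} = 4" using dist by simp
  then have int: "interior (convex hull {a, b, c, d}) =
     {y. \<exists>u. (\<forall>x\<in>{a, b, c, d}. 0 < u x) \<and> sum u {a, b, c, d} = 1 \<and> (\<Sum>x\<in>{a, b, c, d}. u x *\<^sub>R x) = y}"
    using interior_convex_hull_explicit_minimal[OF i] by simp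
  note nd = tetrahedron_nondegenerate[OF i dist]
  show ?thesis
  proof
    assume "Phi a b c d ((s, t), r) \<in> interior (convex hull {a, b, c, d})"
    then obtain u where u: "0 < u a" "0 < u b" "0 < u c" "0 < u d" "u a + u b + u c + u d = 1"
      "u a *\<^sub>R a + u b *\<^sub>R b + u c *\<^sub>R c + u d *\<^sub>R d = Phi a b c d ((s, t), r)"
      unfolding int using dist by (auto simp: add.assoc)
    have "1 - u b - u c - u d = u a" using u(5) by simp
    then have "Phi a b c d ((u b, u c), u d) = u a *\<^sub>R a + u b *\<^sub>R b + u c *\<^sub>R c + u d *\<^sub>R d"
      by (simp add: Phi_barycentric)
    then have "Phi a b c d ((u b, u c), u d) = Phi a b c d ((s, t), r)" unfolding u(6) .
    from Phi_inj[OF nd this] show "0 < s \<and> 0 < t \<and> 0 < r \<and> s + t + r < 1" using u by auto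
  next
    assume pos: "0 < s \<and> 0 < t \<and> 0 < r \<and> s + t + r < 1"
    define u where "u x = (if x = a then 1 - s - t - r else if x = b then s else if x = c then t else r)" for x
    have "\<forall>x\<in>{a, b, c, d}. 0 < u x" "sum u {a, b, c, d} = 1"
      "(\<Sum>x\<in>{a, b, c, d}. u x *\<^sub>R x) = Phi a b c d ((s, t), r)"
      using pos dist by (auto simp: u_def Phi_barycentric)
    then show "Phi a b c d ((s, t), r) \<in> interior (convex hull {a, b, c, d})" unfolding int by blast
  qed
qed

lemma tetrahedron_corner:
  assumes "tetrahedron K {a, b, c, d}" "distinct [a, b, c, d]"
  obtains p q where "corner a b c d p q K"
proof -
  have i: "\<not> affine_dependent {a, b, c, d}" and K: "K = interior (convex hull {a, b, c, d})"
    using assms(1) unfolding tetrahedron_def by blast+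
  note nd = tetrahedron_nondegenerate[OF i assms(2)]
  obtain p q where "\<And>s t r. p \<bullet> Phi a b c d ((s, t), r) + q = r" by (rule Phi_form[OF nd]) blast
  then have "corner a b c d p q K"
    by unfold_locales (use nd K interior_tetrahedron_iff[OF i assms(2)] in auto)
  then show ?thesis by (rule that)
qed

lemma card_4_obtain:
  assumes "card S = 4" obtains a b c d where "S = {a, b, c, d}" "distinct [a, b, c, d]"
proof -
  have "card S = Suc (Suc (Suc (Suc 0)))" using assms by simp
  then obtain a b c d where "S = {a, b, c, d}" "a \<notin> {b, c, d}" "b \<notin> {c, d}" "c \<noteq> d"
    unfolding card_Suc_eq by blast
  then show ?thesis by (intro that[of a b c d]) auto
qed

lemma tetrahedron_facts:
  assumes "tetrahedron K S"
  shows "open K" "bounded K" "convex K" "finite S" "K \<noteq> {}"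
    "frontier K = \<Union> {convex hull (S - {a}) | a. a \<in> S}" "closure K = K \<union> frontier K"
proof -
  show fin: "finite S" using assms by (auto simp: tetrahedron_def intro: card_ge_0_finite)
  show "open K" using assms by (metis tetrahedron_def open_interior)
  have cl: "closure K = convex hull S" using assms unfolding tetrahedron_def by blast
  have "bounded (closure K)" unfolding cl using fin by (intro bounded_convex_hull finite_imp_bounded)
  then show "bounded K" by (rule bounded_subset[OF _ closure_subset])
  show "convex K" using assms convex_interior[OF convex_convex_hull[of S]] by (simp add: tetrahedron_def)
  obtain a b c d where S: "S = {a, b, c, d}" "distinct [a, b, c, d]"
    using card_4_obtain assms unfolding tetrahedron_def by blast
  have "Phi a b c d ((1/4, 1/4), 1/4) \<in> interior (convex hull {a, b, c, d})"
    by (subst interior_tetrahedron_iff) (use assms S in \<open>simp_all add: tetrahedron_def\<close>)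
  moreover have "K = interior (convex hull {a, b, c, d})" using assms unfolding S(1) tetrahedron_def by blast
  ultimately show "K \<noteq> {}" by blast
  have "frontier K = closure K - K" by (simp add: frontier_def interior_open[OF \<open>open K\<close>])
  also have "\<dots> = frontier (convex hull S)"
  proof -
    have "closure (convex hull S) = closure K" using assms by (metis closure_closure tetrahedron_def)
    then show ?thesis using assms unfolding frontier_def tetrahedron_def by argo
  qed
  also have "\<dots> = \<Union> {convex hull (S - {a}) | a. a \<in> S}"
    using assms by (intro frontier_of_convex_hull) (simp add: tetrahedron_def)
  finally show "frontier K = \<Union> {convex hull (S - {a}) | a. a \<in> S}" .
  show "closure K = K \<union> frontier K" by (simp add: closure_Un_frontier)
qed

text \<open>\<open>has_trace\<close> quantifies over all triples whose hull is a facet, so such a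
  triple must be recognized as three vertices: the extreme points of the hull belong to the triple,
  and counting gives equality.\<close>

lemma tetrahedron_facet:
  assumes K: "tetrahedron K S" and f: "(convex hull {a, b, c}) facet_of closure K"
  obtains d p q where "S = {a, b, c, d}" "corner a b c d p q K"
proof -
  have i: "\<not> affine_dependent S" and c4: "card S = 4" and cl: "closure K = convex hull S"
    using K unfolding tetrahedron_def by blast+
  obtain d where d: "d \<in> S" "convex hull {a, b, c} = convex hull (S - {d})"
    using f unfolding cl facet_of_convex_hull_affine_independent[OF i] by auto
  have c3: "card (S - {d}) = 3" using c4 d(1) by (simp add: card_Diff_singleton)
  have "\<not> affine_dependent (S - {d})" using i by (rule affine_independent_Diff)
  then have sub: "S - {d} \<subseteq> {a, b, c}"
    using extreme_point_of_convex_hull_affine_independent d(2) extreme_point_of_convex_hull by (metis subsetI)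
  have "card {a, b, c} \<le> 3" by (simp add: card_insert_if)
  then have eq: "S - {d} = {a, b, c}"
    using sub c3 by (metis card_seteq finite.emptyI finite.insertI)
  have S: "S = {a, b, c, d}" using eq d(1) by blast
  have "distinct [a, b, c, d]"
    using c4 unfolding S by (auto simp: card_insert_if split: if_splits)
  with K obtain p q where "corner a b c d p q K" unfolding S using tetrahedron_corner by metis
  then show ?thesis using that S by blast
qed

lemma face_of_vertices:
  assumes K: "tetrahedron K S" and S: "S = {a, b, c, d}" "distinct [a, b, c, d]"
  shows "(convex hull {a, b, c}) facet_of closure K"
proof -
  have i: "\<not> affine_dependent S" and cl: "closure K = convex hull S"
    using K unfolding tetrahedron_def by blast+
  have eq: "S - {d} = {a, b, c}" using S by auto
  have "d \<in> S" using S by simp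
  then show ?thesis unfolding cl facet_of_convex_hull_affine_independent[OF i]
    by (intro conjI exI[of _ d]) (simp_all only: eq, simp)
qed

lemma frontier_point_facet:
  assumes K: "tetrahedron K S" and x: "x \<in> frontier K"
  obtains a b c where "(convex hull {a, b, c}) facet_of closure K" "x \<in> convex hull {a, b, c}"
proof -
  obtain v where v: "v \<in> S" "x \<in> convex hull (S - {v})" using x tetrahedron_facts(6)[OF K] by auto
  have "card (S - {v}) = 3" using K v(1) by (simp add: tetrahedron_def card_Diff_singleton)
  then have "card (S - {v}) = Suc (Suc (Suc 0))" by simp
  then obtain a b c where "S - {v} = {a, b, c}" "a \<notin> {b, c}" "b \<noteq> c"
    unfolding card_Suc_eq by blast
  then have abc: "S - {v} = {a, b, c}" "distinct [a, b, c]" by auto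
  have "S = {a, b, c, v}" "distinct [a, b, c, v]" using abc v(1) by auto
  from face_of_vertices[OF K this] v(2) abc(1) show ?thesis by (intro that[of a b c]) auto
qed

lemma facet_subset_frontier:
  assumes K: "tetrahedron K S" and F: "F facet_of closure K"
  shows "F \<subseteq> frontier K"
proof -
  have i: "\<not> affine_dependent S" and cl: "closure K = convex hull S"
    using K unfolding tetrahedron_def by blast+
  obtain v where "v \<in> S" "F = convex hull (S - {v})"
    using F unfolding cl facet_of_convex_hull_affine_independent[OF i] by auto
  then show ?thesis using tetrahedron_facts(6)[OF K] by blast
qed

text \<open>The four forms are the barycentric coordinates. Each is obtained from the
  \<open>corner\<close> of its own face, so that every layer of the cutoff for \<open>P\<close>
  comes with a layer estimate.\<close>

lemma tetrahedron_halfspaces: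
  assumes K: "tetrahedron K S"
  obtains P where "finite P" "K = halfspaces P"
    "\<And>p q. (p, q) \<in> P \<Longrightarrow> \<exists>a b c d. corner a b c d p q K \<and> (convex hull {a, b, c}) facet_of closure K"
proof -
  obtain a b c d where S: "S = {a, b, c, d}" "distinct [a, b, c, d]"
    using card_4_obtain K unfolding tetrahedron_def by blast
  have dist: "distinct [a, b, c, d]" "distinct [a, c, d, b]" "distinct [a, b, d, c]" "distinct [b, c, d, a]"
    using S(2) by auto
  have sets: "S = {a, b, c, d}" "S = {a, c, d, b}" "S = {a, b, d, c}" "S = {b, c, d, a}"
    using S(1) by auto
  obtain p1 q1 where 1: "corner a b c d p1 q1 K"
    using tetrahedron_corner[OF K[unfolded sets(1)] dist(1)] by metis
  obtain p2 q2 where 2: "corner a c d b p2 q2 K"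
    using tetrahedron_corner[OF K[unfolded sets(2)] dist(2)] by metis
  obtain p3 q3 where 3: "corner a b d c p3 q3 K"
    using tetrahedron_corner[OF K[unfolded sets(3)] dist(3)] by metis
  obtain p4 q4 where 4: "corner b c d a p4 q4 K"
    using tetrahedron_corner[OF K[unfolded sets(4)] dist(4)] by metis
  interpret c1: corner a b c d p1 q1 K by (rule 1)
  interpret c2: corner a c d b p2 q2 K by (rule 2)
  interpret c3: corner a b d c p3 q3 K by (rule 3)
  interpret c4: corner b c d a p4 q4 K by (rule 4)
  define P where "P = {(p1, q1), (p2, q2), (p3, q3), (p4, q4)}"
  have "x \<in> K \<longleftrightarrow> x \<in> halfspaces P" for x
  proof -
    obtain s t r where x: "x = Phi a b c d ((s, t), r)" by (rule Phi_surj[OF c1.nd])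
    have "x = Phi a c d b ((t, r), s)" "x = Phi a b d c ((s, r), t)" "x = Phi b c d a ((t, r), 1 - s - t - r)"
      unfolding x Phi_barycentric by (simp_all add: algebra_simps)
    then have "p1 \<bullet> x + q1 = r" "p2 \<bullet> x + q2 = s" "p3 \<bullet> x + q3 = t" "p4 \<bullet> x + q4 = 1 - s - t - r"
      using x c1.form c2.form c3.form c4.form by metis+
    moreover have "x \<in> K \<longleftrightarrow> 0 < s \<and> 0 < t \<and> 0 < r \<and> s + t + r < 1" unfolding x by (rule c1.K)
    ultimately show ?thesis by (auto simp: P_def halfspaces_def)
  qed
  then have "K = halfspaces P" by blast
  moreover have "\<exists>a b c d. corner a b c d p q K \<and> (convex hull {a, b, c}) facet_of closure K" if "(p, q) \<in> P" for p q
    using that 1 2 3 4 face_of_vertices[OF K sets(1) dist(1)] face_of_vertices[OF K sets(2) dist(2)]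
      face_of_vertices[OF K sets(3) dist(3)] face_of_vertices[OF K sets(4) dist(4)]
    unfolding P_def by blast
  ultimately show ?thesis using that[of P] by (simp add: P_def)
qed

lemma tetrahedron_weak_grad_unique:
  assumes "tetrahedron K S" "weak_grad K v G" "weak_grad K v G'"
  shows "AE x in lebesgue_on K. G x = G' x"
proof -
  obtain P where P: "finite P" "K = halfspaces P" using tetrahedron_halfspaces[OF assms(1)] by metis
  show ?thesis unfolding P(2)
    by (rule weak_grad_unique[OF P(1)]) (use assms tetrahedron_facts(2)[OF assms(1)] P(2) in auto)
qed

text \<open>The difference of the two approximating sequences consists of smooth functions tending
  to zero. For its gradients this uses that the two limit gradients agree almost everywhere. On a
  face through \<open>x\<close> the difference converges to \<open>g - g'\<close>, which
  \<open>trace_zero\<close> then annihilates.\<close>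

lemma trace_unique:
  assumes T: "tetrahedron K S" and t: "has_trace K v g" "has_trace K v g'"
    and c: "continuous_on (frontier K) g" "continuous_on (frontier K) g'" and x: "x \<in> frontier K"
  shows "g x = g' x"
proof -
  obtain u G where u: "weak_grad K v G" "\<And>n. smooth (u n)" "L2_tendsto (lebesgue_on K) u v"
     "L2_tendsto (lebesgue_on K) (\<lambda>n. grad (u n)) G"
     "\<And>a b c. (convex hull {a, b, c}) facet_of closure K \<Longrightarrow> L2_tendsto (triangle_measure a b c) u g"
    using t(1) unfolding has_trace_def by blast
  obtain u' G' where u': "weak_grad K v G'" "\<And>n. smooth (u' n)" "L2_tendsto (lebesgue_on K) u' v"
     "L2_tendsto (lebesgue_on K) (\<lambda>n. grad (u' n)) G'"
     "\<And>a b c. (convex hull {a, b, c}) facet_of closure K \<Longrightarrow> L2_tendsto (triangle_measure a b c) u' g'"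
    using t(2) unfolding has_trace_def by blast
  note kf = tetrahedron_facts[OF T]
  let ?d = "\<lambda>n x. u n x - u' n x"
  have sd: "smooth (?d n)" for n by (intro smooth_diff u(2) u'(2))
  have gd: "grad (?d n) = (\<lambda>x. grad (u n) x - grad (u' n) x)" for n
    by (rule ext, rule grad_diff[OF u(2) u'(2)])
  have AEG: "AE x in lebesgue_on K. G x = G' x"
    by (rule tetrahedron_weak_grad_unique[OF T u(1) u'(1)])
  have d0: "(\<lambda>n. \<integral>x. (norm (?d n x))\<^sup>2 \<partial>lebesgue_on K) \<longlonglongrightarrow> 0"
    using L2_tendstoD(3)[OF L2_tendsto_diff[OF u(3) u'(3)]] by simp
  have "(\<integral>x. (norm (grad (u n) x - grad (u' n) x - (G x - G' x)))\<^sup>2 \<partial>lebesgue_on K)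
      = (\<integral>x. (norm (grad (?d n) x))\<^sup>2 \<partial>lebesgue_on K)" for n
  proof (rule integral_cong_AE)
    show "AE x in lebesgue_on K. (norm (grad (u n) x - grad (u' n) x - (G x - G' x)))\<^sup>2 = (norm (grad (?d n) x))\<^sup>2"
      using AEG by eventually_elim (simp add: gd)
    note L = L2_measurable[OF L2_tendstoD(1)[OF u(4)]] L2_measurable[OF L2_tendstoD(1)[OF u'(4)]]
      L2_measurable[OF L2_tendstoD(2)[OF u(4)]] L2_measurable[OF L2_tendstoD(2)[OF u'(4)]]
    show "(\<lambda>x. (norm (grad (u n) x - grad (u' n) x - (G x - G' x)))\<^sup>2) \<in> borel_measurable (lebesgue_on K)"
      "(\<lambda>x. (norm (grad (?d n) x))\<^sup>2) \<in> borel_measurable (lebesgue_on K)"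
      unfolding gd using L by measurable
  qed
  then have g0: "(\<lambda>n. \<integral>x. (norm (grad (?d n) x))\<^sup>2 \<partial>lebesgue_on K) \<longlonglongrightarrow> 0"
    using L2_tendstoD(3)[OF L2_tendsto_diff[OF u(4) u'(4)]] by simp
  obtain a b c where F: "(convex hull {a, b, c}) facet_of closure K" "x \<in> convex hull {a, b, c}"
    by (rule frontier_point_facet[OF T x])
  obtain d p q where "corner a b c d p q K" by (rule tetrahedron_facet[OF T F(1)])
  then interpret corner a b c d p q K .
  have "continuous_on (convex hull {a, b, c}) (\<lambda>x. g x - g' x)"
    by (intro continuous_on_diff continuous_on_subset[OF c(1)] continuous_on_subset[OF c(2)]
        facet_subset_frontier[OF T F(1)])
  from trace_zero[OF kf(2) sd d0 g0 L2_tendsto_diff[OF u(5)[OF F(1)] u'(5)[OF F(1)]] this F(2)]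
  show ?thesis by simp
qed

text \<open>Uniqueness of the continuous trace resolves the definite description in
  \<open>boundary_value\<close>.\<close>

lemma boundary_value_eq:
  assumes "tetrahedron K S" "has_trace K v g" "continuous_on (frontier K) g" "x \<in> frontier K"
  shows "boundary_value K v x = g x"
  unfolding boundary_value_def
  by (rule the_equality) (use assms trace_unique in blast)+

section \<open>Nodal interpolation on the boundary\<close>

text \<open>Leave the piece containing \<open>x\<close> at the last parameter where the segment
  meets it. The rest of the segment is covered by the remaining pieces, so induction on their number
  applies; the two bounds add up since the lengths do.\<close>

lemma lipschitz_along_segment:
  fixes f :: "R3 \<Rightarrow> real"
  assumes "finite \<C>" and cl: "\<And>C. C \<in> \<C> \<Longrightarrow> closed C"
    and lip: "\<And>C u v. C \<in> \<C> \<Longrightarrow> u \<in> C \<Longrightarrow> v \<in> C \<Longrightarrow> \<bar>f u - f v\<bar> \<le> L * norm (u - v)"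
    and sub: "closed_segment x y \<subseteq> \<Union>\<C>"
  shows "\<bar>f x - f y\<bar> \<le> L * norm (x - y)"
  using assms
proof (induction "card \<C>" arbitrary: \<C> x)
  case 0
  then show ?case by auto
next
  case (Suc n)
  have "x \<in> closed_segment x y" by simp
  then obtain C where C: "C \<in> \<C>" "x \<in> C" using Suc.prems(4) by blast
  define \<gamma> where "\<gamma> t = x + t *\<^sub>R (y - x)" for t :: real
  have seg: "\<gamma> t \<in> closed_segment x y" if "t \<in> {0..1}" for t
    using that by (auto simp: \<gamma>_def in_segment algebra_simps intro!: exI[of _ t])
  have c\<gamma>: "continuous_on S \<gamma>" for S unfolding \<gamma>_def by (intro continuous_intros)
  have "closed ({0..1} \<inter> \<gamma> -` C)"
    by (rule continuous_closed_preimage[OF c\<gamma> closed_atLeastAtMost Suc.prems(2)[OF C(1)]])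
  then have "compact ({0..1} \<inter> \<gamma> -` C)"
    using compact_Int_closed[OF compact_Icc] by (metis inf.left_idem)
  moreover have "0 \<in> {0..1} \<inter> \<gamma> -` C" using C by (simp add: \<gamma>_def)
  ultimately obtain s where s: "s \<in> {0..1} \<inter> \<gamma> -` C" "\<And>t. t \<in> {0..1} \<inter> \<gamma> -` C \<Longrightarrow> t \<le> s"
    using compact_attains_sup by (metis empty_iff)
  let ?z = "\<gamma> s"
  have 1: "\<bar>f x - f ?z\<bar> \<le> L * norm (x - ?z)" by (rule Suc.prems(3)[OF C(1,2)]) (use s in auto)
  have n1: "norm (x - ?z) = s * norm (x - y)"
  proof -
    have "x - ?z = s *\<^sub>R (x - y)" by (simp add: \<gamma>_def algebra_simps)
    then show ?thesis using s(1) by simp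
  qed
  have n2: "norm (?z - y) = (1 - s) * norm (x - y)"
  proof -
    have "?z - y = (1 - s) *\<^sub>R (x - y)" by (simp add: \<gamma>_def algebra_simps)
    then show ?thesis using s(1) by simp
  qed
  show ?case
  proof (cases "s = 1")
    case True
    then show ?thesis using 1 by (simp add: \<gamma>_def)
  next
    case False
    then have s1: "0 \<le> s" "s < 1" using s(1) by auto
    let ?D = "\<C> - {C}"
    have later: "\<gamma> t \<in> \<Union>?D" if "s < t" "t \<le> 1" for t
    proof -
      have "\<gamma> t \<in> \<Union>\<C>" using seg[of t] that s1 Suc.prems(4) by auto
      moreover have "\<gamma> t \<notin> C" using s(2)[of t] that s1 by auto
      ultimately show ?thesis by blast
    qed
    have clD: "closed (\<Union>?D)" using Suc.prems(1,2) by (intro closed_Union) auto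
    \<comment> \<open>The exit point itself is still in \<open>C\<close>. It also lies in one of the
      other pieces, being the limit of later points of the segment in a closed union.\<close>
    have zD: "?z \<in> \<Union>?D"
    proof (rule closed_sequentially[OF clD])
      show "\<gamma> (s + (1 - s) * inverse (real (Suc n))) \<in> \<Union>?D" for n
      proof (rule later)
        have "inverse (real (Suc n)) \<le> 1" by (auto simp: field_simps)
        then have "(1 - s) * inverse (real (Suc n)) \<le> (1 - s) * 1"
          using s1 by (intro mult_left_mono) auto
        then show "s + (1 - s) * inverse (real (Suc n)) \<le> 1" by simp
      qed (use s1 in simp)
      have "(\<lambda>n. s + (1 - s) * inverse (real (Suc n))) \<longlonglongrightarrow> s + (1 - s) * 0"
        by (intro tendsto_intros LIMSEQ_inverse_real_of_nat)
      then have "(\<lambda>n. s + (1 - s) * inverse (real (Suc n))) \<longlonglongrightarrow> s" by simp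
      then show "(\<lambda>n. \<gamma> (s + (1 - s) * inverse (real (Suc n)))) \<longlonglongrightarrow> ?z"
        by (intro continuous_on_tendsto_compose[OF c\<gamma>[of UNIV]]) auto
    qed
    have "closed_segment ?z y \<subseteq> \<Union>?D"
    proof
      fix w assume "w \<in> closed_segment ?z y"
      then obtain t where t: "0 \<le> t" "t \<le> 1" "w = (1 - t) *\<^sub>R ?z + t *\<^sub>R y" by (auto simp: in_segment)
      have w: "w = \<gamma> (s + t * (1 - s))" unfolding t(3) \<gamma>_def by (simp add: algebra_simps)
      show "w \<in> \<Union>?D"
      proof (cases "t = 0")
        case True then show ?thesis using zD t(3) by simp
      next
        case False
        have le: "t * (1 - s) \<le> 1 * (1 - s)" using t s1 by (intro mult_right_mono) auto
        have "0 < t * (1 - s)" using False t s1 by (intro mult_pos_pos) auto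
        then show ?thesis unfolding w using le by (intro later) auto
      qed
    qed
    note segD = this
    have "n = card ?D" using Suc.hyps(2) C(1) Suc.prems(1) by simp
    then have "\<bar>f ?z - f y\<bar> \<le> L * norm (?z - y)"
    proof (rule Suc.hyps(1))
      show "finite ?D" using Suc.prems(1) by simp
      show "closed C'" if "C' \<in> ?D" for C' using that Suc.prems(2) by blast
      show "\<bar>f u - f v\<bar> \<le> L * norm (u - v)" if "C' \<in> ?D" "u \<in> C'" "v \<in> C'" for C' u v
        using that by (intro Suc.prems(3)[of C']) auto
    qed (rule segD)
    then have "\<bar>f x - f y\<bar> \<le> L * norm (x - ?z) + L * norm (?z - y)" using 1 by linarith
    also have "\<dots> = L * norm (x - y)" unfolding n1 n2 by (simp add: algebra_simps)
    finally show ?thesis .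
  qed
qed

lemma nondegenerate_dual:
  assumes nd: "nondegenerate a b c d"
  obtains p where "p \<bullet> (b - a) = 0" "p \<bullet> (c - a) = 0" "p \<bullet> (d - a) = 1"
proof -
  obtain p q where f: "\<And>s t r. p \<bullet> Phi a b c d ((s, t), r) + q = r" by (rule Phi_form[OF nd]) blast
  have "p \<bullet> (b - a) = 0" "p \<bullet> (c - a) = 0" "p \<bullet> (d - a) = 1"
    using f[of 0 0 0] f[of 1 0 0] f[of 0 1 0] f[of 0 0 1] by (simp_all add: Phi_def inner_diff_right)
  then show ?thesis by (rule that)
qed

lemma nondegenerate_permute:
  assumes "nondegenerate a b c d" shows "nondegenerate a c d b" "nondegenerate a d b c"
proof -
  have *: "s = 0 \<and> t = 0 \<and> r = 0" if "s *\<^sub>R (b - a) + t *\<^sub>R (c - a) + r *\<^sub>R (d - a) = 0" for s t r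
    using assms that unfolding nondegenerate_def by blast
  show "nondegenerate a c d b" unfolding nondegenerate_def
  proof (intro allI impI)
    fix s t r assume "s *\<^sub>R (c - a) + t *\<^sub>R (d - a) + r *\<^sub>R (b - a) = 0"
    then show "s = 0 \<and> t = 0 \<and> r = 0" using *[of r s t] by (simp add: add.commute add.left_commute)
  qed
  show "nondegenerate a d b c" unfolding nondegenerate_def
  proof (intro allI impI)
    fix s t r assume "s *\<^sub>R (d - a) + t *\<^sub>R (b - a) + r *\<^sub>R (c - a) = 0"
    then show "s = 0 \<and> t = 0 \<and> r = 0" using *[of t r s] by (simp add: add.commute add.left_commute)
  qed
qed

text \<open>The cone over the triangle is closed because it is cut out by the linear forms dual to the
  edges at the apex.\<close>

lemma cone_data:
  assumes nd: "nondegenerate x0 z1 z2 z3"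
  obtains p C where "closed C" "\<And>x. x \<in> C \<longleftrightarrow> (\<exists>y\<in>convex hull {z1, z2, z3}. \<exists>r\<ge>0. x = x0 + r *\<^sub>R (y - x0))"
    "p \<bullet> (z1 - x0) = a z1" "p \<bullet> (z2 - x0) = a z2" "p \<bullet> (z3 - x0) = a z3"
proof -
  obtain p3 where p3: "p3 \<bullet> (z1 - x0) = 0" "p3 \<bullet> (z2 - x0) = 0" "p3 \<bullet> (z3 - x0) = 1"
    by (rule nondegenerate_dual[OF nd])
  obtain p1 where p1: "p1 \<bullet> (z2 - x0) = 0" "p1 \<bullet> (z3 - x0) = 0" "p1 \<bullet> (z1 - x0) = 1"
    by (rule nondegenerate_dual[OF nondegenerate_permute(1)[OF nd]])
  obtain p2 where p2: "p2 \<bullet> (z3 - x0) = 0" "p2 \<bullet> (z1 - x0) = 0" "p2 \<bullet> (z2 - x0) = 1"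
    by (rule nondegenerate_dual[OF nondegenerate_permute(2)[OF nd]])
  \<comment> \<open>\<open>p1\<close>, \<open>p2\<close>, \<open>p3\<close> are dual to the three
    edges, so this combination takes the prescribed values on them.\<close>
  define p where "p = a z1 *\<^sub>R p1 + a z2 *\<^sub>R p2 + a z3 *\<^sub>R p3"
  define C where "C = {x. 0 \<le> p1 \<bullet> (x - x0)} \<inter> {x. 0 \<le> p2 \<bullet> (x - x0)} \<inter> {x. 0 \<le> p3 \<bullet> (x - x0)}"
  have "closed C" unfolding C_def by (intro closed_Int closed_Collect_le continuous_intros)
  moreover have "x \<in> C \<longleftrightarrow> (\<exists>y\<in>convex hull {z1, z2, z3}. \<exists>r\<ge>0. x = x0 + r *\<^sub>R (y - x0))" for x
  proof
    assume x: "x \<in> C"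
    obtain s t r where xs: "x = Phi x0 z1 z2 z3 ((s, t), r)" by (rule Phi_surj[OF nd])
    have d: "x - x0 = s *\<^sub>R (z1 - x0) + t *\<^sub>R (z2 - x0) + r *\<^sub>R (z3 - x0)" by (simp add: xs Phi_def)
    have "p1 \<bullet> (x - x0) = s" "p2 \<bullet> (x - x0) = t" "p3 \<bullet> (x - x0) = r"
      unfolding d by (simp_all add: inner_add_right p1 p2 p3)
    then have pos: "0 \<le> s" "0 \<le> t" "0 \<le> r" using x unfolding C_def by auto
    show "\<exists>y\<in>convex hull {z1, z2, z3}. \<exists>r\<ge>0. x = x0 + r *\<^sub>R (y - x0)"
    proof (cases "s + t + r = 0")
      case True
      then have "s = 0" "t = 0" "r = 0" using pos by linarith+
      then have "x = x0 + 0 *\<^sub>R (z1 - x0)" using d by simp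
      then show ?thesis by (intro bexI[of _ z1] exI[of _ 0]) (auto simp: hull_inc)
    next
      case False
      define w where "w = s + t + r"
      have w: "w > 0" using False pos by (simp add: w_def)
      define y where "y = (s / w) *\<^sub>R z1 + (t / w) *\<^sub>R z2 + (r / w) *\<^sub>R z3"
      have "y \<in> convex hull {z1, z2, z3}" unfolding convex_hull_3
        by (intro CollectI exI[of _ "s / w"] exI[of _ "t / w"] exI[of _ "r / w"])
          (use pos w in \<open>auto simp: y_def w_def simp flip: add_divide_distrib\<close>)
      moreover have "x0 + w *\<^sub>R (y - x0) = x"
      proof -
        have "w *\<^sub>R y = s *\<^sub>R z1 + t *\<^sub>R z2 + r *\<^sub>R z3"
          using w by (simp add: y_def scaleR_add_right)
        moreover have "x = x0 + s *\<^sub>R z1 + t *\<^sub>R z2 + r *\<^sub>R z3 - w *\<^sub>R x0"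
          by (simp add: xs Phi_def w_def algebra_simps)
        ultimately show ?thesis by (simp add: algebra_simps)
      qed
      ultimately show ?thesis using w by (intro bexI[of _ y] exI[of _ w]) auto
    qed
  next
    assume "\<exists>y\<in>convex hull {z1, z2, z3}. \<exists>r\<ge>0. x = x0 + r *\<^sub>R (y - x0)"
    then obtain y r where y: "y \<in> convex hull {z1, z2, z3}" "0 \<le> r" "x = x0 + r *\<^sub>R (y - x0)" by blast
    obtain u v w where uvw: "0 \<le> u" "0 \<le> v" "0 \<le> w" "u + v + w = 1" "y = u *\<^sub>R z1 + v *\<^sub>R z2 + w *\<^sub>R z3"
      using y(1) unfolding convex_hull_3 by auto
    have u: "u = 1 - v - w" using uvw(4) by simp
    have "y - x0 = u *\<^sub>R (z1 - x0) + v *\<^sub>R (z2 - x0) + w *\<^sub>R (z3 - x0)"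
      unfolding uvw(5) u by (simp add: algebra_simps)
    then have "x - x0 = r *\<^sub>R (u *\<^sub>R (z1 - x0) + v *\<^sub>R (z2 - x0) + w *\<^sub>R (z3 - x0))" using y(3) by simp
    then show "x \<in> C" unfolding C_def using y(2) uvw(1-3) by (simp add: inner_add_right p1 p2 p3)
  qed
  moreover have "p \<bullet> (z1 - x0) = a z1" "p \<bullet> (z2 - x0) = a z2" "p \<bullet> (z3 - x0) = a z3"
    by (simp_all add: p_def inner_add_left p1 p2 p3)
  ultimately show ?thesis by (rule that)
qed

lemma facet_form:
  assumes T: "tetrahedron K S" and F: "F facet_of closure K"
  obtains p q where "\<And>x. x \<in> F \<Longrightarrow> p \<bullet> x + q = 0" "\<And>x. x \<in> K \<Longrightarrow> 0 < p \<bullet> x + q"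
proof -
  have i: "\<not> affine_dependent S" and cl: "closure K = convex hull S" and c4: "card S = 4"
    using T unfolding tetrahedron_def by blast+
  obtain v where v: "v \<in> S" "F = convex hull (S - {v})"
    using F unfolding cl facet_of_convex_hull_affine_independent[OF i] by auto
  have "card (S - {v}) = 3" using c4 v(1) by (simp add: card_Diff_singleton)
  then have "card (S - {v}) = Suc (Suc (Suc 0))" by simp
  then obtain a b c where abc: "S - {v} = {a, b, c}" unfolding card_Suc_eq by blast
  have F': "F = convex hull {a, b, c}" unfolding v(2) abc ..
  obtain d p q where "corner a b c d p q K" by (rule tetrahedron_facet[OF T F[unfolded F']])
  then interpret corner a b c d p q K .
  show ?thesis
  proof (rule that[of p q])
    fix x assume "x \<in> F"
    then obtain z where "x = Phi a b c d (z, 0)" unfolding F' by (rule hull_in_Phi_face)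
    then show "p \<bullet> x + q = 0" using form[of "fst z" "snd z" 0] by simp
  next
    fix x assume x: "x \<in> K"
    obtain s t r where xs: "x = Phi a b c d ((s, t), r)" by (rule Phi_surj[OF nd])
    then show "0 < p \<bullet> x + q" using x K[of s t r] form[of s t r] by simp
  qed
qed

lemma simplex_2_obtain:
  assumes "2 simplex T"
  obtains z1 z2 z3 where "T = convex hull {z1, z2, z3}" "\<not> affine_dependent {z1, z2, z3}"
    "z1 \<noteq> z2" "z1 \<noteq> z3" "z2 \<noteq> z3"
proof -
  obtain C where C: "\<not> affine_dependent C" "int (card C) = 2 + 1" "T = convex hull C"
    using assms unfolding simplex_def by blast
  have "card C = Suc (Suc (Suc 0))" using C(2) by simp
  then obtain z1 z2 z3 where z: "C = {z1, z2, z3}" "z1 \<notin> {z2, z3}" "z2 \<noteq> z3" unfolding card_Suc_eq by blast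
  then show ?thesis using C by (intro that[of z1 z2 z3]) auto
qed

text \<open>The form vanishes at the three vertices and is positive at the apex, so applying it to a
  linear relation shows that the coefficients sum to zero. What remains is an affine relation
  between the vertices.\<close>

lemma apex_nondegenerate:
  assumes i: "\<not> affine_dependent {z1, z2, z3}" "z1 \<noteq> z2" "z1 \<noteq> z3" "z2 \<noteq> z3"
    and f: "p \<bullet> z1 + q = 0" "p \<bullet> z2 + q = 0" "p \<bullet> z3 + q = 0" "0 < p \<bullet> x0 + q"
  shows "nondegenerate x0 z1 z2 z3"
  unfolding nondegenerate_def
proof (intro allI impI)
  fix s t r assume z: "s *\<^sub>R (z1 - x0) + t *\<^sub>R (z2 - x0) + r *\<^sub>R (z3 - x0) = 0"
  define l where "l = p \<bullet> x0 + q"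
  have "p \<bullet> (s *\<^sub>R (z1 - x0) + t *\<^sub>R (z2 - x0) + r *\<^sub>R (z3 - x0))
      = s * (p \<bullet> z1 - p \<bullet> x0) + t * (p \<bullet> z2 - p \<bullet> x0) + r * (p \<bullet> z3 - p \<bullet> x0)"
    by (simp add: inner_add_right inner_diff_right)
  moreover have "p \<bullet> z1 - p \<bullet> x0 = - l" "p \<bullet> z2 - p \<bullet> x0 = - l" "p \<bullet> z3 - p \<bullet> x0 = - l"
    using f by (simp_all add: l_def)
  ultimately have "s * (- l) + t * (- l) + r * (- l) = 0" using z by simp
  then have "(s + t + r) * l = 0" by (simp add: algebra_simps)
  then have sum0: "s + t + r = 0" using f(4) by (simp add: l_def)
  define U where "U x = (if x = z1 then s else if x = z2 then t else r)" for x
  have "s *\<^sub>R z1 + t *\<^sub>R z2 + r *\<^sub>R z3 = (s + t + r) *\<^sub>R x0" using z by (simp add: algebra_simps)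
  then have "sum U {z1, z2, z3} = 0" "(\<Sum>v\<in>{z1, z2, z3}. U v *\<^sub>R v) = 0"
    using i sum0 by (auto simp: U_def add.assoc)
  then have "\<forall>v\<in>{z1, z2, z3}. U v = 0"
    using i(1) affine_dependent_explicit_finite[of "{z1, z2, z3}"] by auto
  then show "s = 0 \<and> t = 0 \<and> r = 0" using i by (auto simp: U_def)
qed

lemma affine_eq_on_hull:
  fixes p p' :: R3
  assumes "\<And>v. v \<in> X \<Longrightarrow> p \<bullet> v + q = p' \<bullet> v + q'" "x \<in> convex hull X"
  shows "p \<bullet> x + q = p' \<bullet> x + q'"
proof -
  have "{y. p \<bullet> y + q = p' \<bullet> y + q'} = {y. (p - p') \<bullet> y = q' - q}"
    by (auto simp: inner_diff_left)
  then have "convex {y. p \<bullet> y + q = p' \<bullet> y + q'}" by (simp add: convex_hyperplane)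
  then have "convex hull X \<subseteq> {y. p \<bullet> y + q = p' \<bullet> y + q'}" using assms(1) by (intro hull_minimal) auto
  then show ?thesis using assms(2) by blast
qed

text \<open>A ray from an interior point of a convex set meets the frontier only once: the nearer of
  two frontier points would lie in an open segment from the interior point to the closure, hence in
  the interior.\<close>

lemma radial_point_unique:
  fixes K :: "R3 set"
  assumes K: "convex K" "open K" "x0 \<in> K" and y: "y \<in> frontier K" "y' \<in> frontier K"
    and r: "0 < r" "0 < r'" and eq: "r *\<^sub>R (y - x0) = r' *\<^sub>R (y' - x0)"
  shows "y = y' \<and> r = r'"
proof -
  have int: "interior K = K" using K(2) by (rule interior_open)
  have no: "\<not> r' < r" if y: "y \<in> frontier K" "y' \<in> frontier K"
    and r: "0 < r" "0 < r'" and eq: "r *\<^sub>R (y - x0) = r' *\<^sub>R (y' - x0)" for r r' :: real and y y'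
  proof
    assume less: "r' < r"
    have y'c: "y' \<in> closure K" using y(2) by (simp add: frontier_def)
    have "y' \<noteq> x0" using y(2) K(3) int by (auto simp: frontier_def)
    have "r *\<^sub>R y = r *\<^sub>R ((1 - r' / r) *\<^sub>R x0 + (r' / r) *\<^sub>R y')"
      using eq r(1) by (simp add: algebra_simps)
    then have "y = (1 - r' / r) *\<^sub>R x0 + (r' / r) *\<^sub>R y'" using r(1) by simp
    then have "y \<in> open_segment x0 y'"
      unfolding in_segment using r less \<open>y' \<noteq> x0\<close> by (intro conjI exI[of _ "r' / r"]) auto
    then have "y \<in> interior K"
      using in_interior_closure_convex_segment[OF K(1) _ y'c] K(3) int by blast
    then show False using y(1) by (simp add: frontier_def)
  qed
  have "r = r'" using no[OF y r eq] no[OF y(2,1) r(2,1) eq[symmetric]] by linarith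
  then show ?thesis using eq r by simp
qed

text \<open>The combinatorial part of \<open>boundary_triangulation\<close>: triangles that
  subdivide the faces and meet in common faces, which is what makes piecewise linear interpolation
  well defined.\<close>

definition triangulated_boundary :: "R3 set \<Rightarrow> R3 set set \<Rightarrow> bool" where
  "triangulated_boundary K \<F> \<longleftrightarrow> triangulation \<F> \<and> (\<forall>T\<in>\<F>. 2 simplex T) \<and>
     (\<forall>T\<in>\<F>. \<exists>F. F facet_of closure K \<and> T \<subseteq> F) \<and>
     (\<forall>F. F facet_of closure K \<longrightarrow> F = \<Union>{T\<in>\<F>. T \<subseteq> F})"

lemma boundary_triangulation_boundary:
  "boundary_triangulation \<Gamma> \<theta> C K \<F> \<Longrightarrow> triangulated_boundary K \<F>"
  unfolding boundary_triangulation_def triangulated_boundary_def by blast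

lemma triangulated_boundary_frontier:
  assumes T: "tetrahedron K S" and F: "triangulated_boundary K \<F>"
  shows "T \<in> \<F> \<Longrightarrow> T \<subseteq> frontier K" "x \<in> frontier K \<Longrightarrow> \<exists>T\<in>\<F>. x \<in> T"
proof -
  show "T \<subseteq> frontier K" if T1: "T \<in> \<F>"
  proof -
    obtain F where "F facet_of closure K" "T \<subseteq> F" using F T1 unfolding triangulated_boundary_def by blast
    then show ?thesis using facet_subset_frontier[OF T] by blast
  qed
  show "\<exists>T\<in>\<F>. x \<in> T" if xf: "x \<in> frontier K"
  proof -
    obtain a b c where abc: "(convex hull {a, b, c}) facet_of closure K" "x \<in> convex hull {a, b, c}"
      by (rule frontier_point_facet[OF T xf])
    then have "convex hull {a, b, c} = \<Union>{T\<in>\<F>. T \<subseteq> convex hull {a, b, c}}"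
      using F unfolding triangulated_boundary_def by blast
    then show ?thesis using abc(2) by blast
  qed
qed

text \<open>On each triangle an affine function is determined by its values at the three vertices,
  and these are nodes.\<close>

lemma B_space_unique:
  assumes T: "tetrahedron K S" and F: "triangulated_boundary K \<F>"
    and g: "g \<in> B_space K \<F>" "g' \<in> B_space K \<F>" and eq: "\<And>z. z \<in> nodes \<F> \<Longrightarrow> g z = g' z"
    and x: "x \<in> frontier K"
  shows "g x = g' x"
proof -
  obtain T where T1: "T \<in> \<F>" "x \<in> T" using triangulated_boundary_frontier(2)[OF T F x] by blast
  have "2 simplex T" using F T1(1) unfolding triangulated_boundary_def by blast
  then obtain z1 z2 z3 where z: "T = convex hull {z1, z2, z3}" "\<not> affine_dependent {z1, z2, z3}"
    by (rule simplex_2_obtain)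
  obtain p q where pq: "\<And>x. x \<in> T \<Longrightarrow> g x = p \<bullet> x + q" using g(1) T1(1) unfolding B_space_def by blast
  obtain p' q' where pq': "\<And>x. x \<in> T \<Longrightarrow> g' x = p' \<bullet> x + q'" using g(2) T1(1) unfolding B_space_def by blast
  have v: "p \<bullet> v + q = p' \<bullet> v + q'" if "v \<in> {z1, z2, z3}" for v
  proof -
    have "v extreme_point_of T" unfolding z(1) extreme_point_of_convex_hull_affine_independent[OF z(2)] by (rule that)
    then have "v \<in> nodes \<F>" using T1(1) unfolding nodes_def by blast
    moreover have "v \<in> T" unfolding z(1) using that by (rule hull_inc)
    ultimately show ?thesis using eq[of v] pq[of v] pq'[of v] by simp
  qed
  have "p \<bullet> x + q = p' \<bullet> x + q'"
    by (rule affine_eq_on_hull[OF v]) (use T1(2) z(1) in auto)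
  then show ?thesis using T1(2) pq pq' by simp
qed

text \<open>The interpolant is extended radially from a point of \<open>K\<close>: on the cone over each triangle it is
  linear, so Lipschitz continuity follows along segments.\<close>

lemma nodal_interpolant:
  fixes a :: "R3 \<Rightarrow> real"
  assumes T: "tetrahedron K S" and F: "triangulated_boundary K \<F>"
  obtains f L where "0 \<le> L" "\<And>x y. \<bar>f x - f y\<bar> \<le> L * norm (x - y)"
    "\<And>z. z \<in> nodes \<F> \<Longrightarrow> f z = a z" "f \<in> B_space K \<F>"
proof -
  note kf = tetrahedron_facts[OF T]
  obtain x0 where x0: "x0 \<in> K" using kf(5) by blast
  have fin: "finite \<F>" using F unfolding triangulated_boundary_def triangulation_def by blast
  have "\<exists>p C. closed C \<and> (\<forall>x. x \<in> C \<longleftrightarrow> (\<exists>y\<in>T. \<exists>r\<ge>0. x = x0 + r *\<^sub>R (y - x0))) \<and>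
      (\<forall>v. v extreme_point_of T \<longrightarrow> p \<bullet> (v - x0) = a v)" if T1: "T \<in> \<F>" for T
  proof -
    have "2 simplex T" using F T1 unfolding triangulated_boundary_def by blast
    then obtain z1 z2 z3 where z: "T = convex hull {z1, z2, z3}" "\<not> affine_dependent {z1, z2, z3}"
      "z1 \<noteq> z2" "z1 \<noteq> z3" "z2 \<noteq> z3" by (rule simplex_2_obtain)
    obtain F' where F': "F' facet_of closure K" "T \<subseteq> F'" using F T1 unfolding triangulated_boundary_def by blast
    obtain p q where pq: "\<And>x. x \<in> F' \<Longrightarrow> p \<bullet> x + q = 0" "\<And>x. x \<in> K \<Longrightarrow> 0 < p \<bullet> x + q"
      by (rule facet_form[OF T F'(1)]) blast
    have zT: "z1 \<in> T" "z2 \<in> T" "z3 \<in> T" unfolding z(1) by (auto intro: hull_inc)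
    have nd: "nondegenerate x0 z1 z2 z3"
      by (rule apex_nondegenerate[OF z(2-5)]) (use pq zT F'(2) x0 in blast)+
    obtain p C where C: "closed C" "\<And>x. x \<in> C \<longleftrightarrow> (\<exists>y\<in>convex hull {z1, z2, z3}. \<exists>r\<ge>0. x = x0 + r *\<^sub>R (y - x0))"
      "p \<bullet> (z1 - x0) = a z1" "p \<bullet> (z2 - x0) = a z2" "p \<bullet> (z3 - x0) = a z3"
      by (rule cone_data[OF nd, of a]) blast
    have "\<forall>v. v extreme_point_of T \<longrightarrow> p \<bullet> (v - x0) = a v"
      unfolding z(1) extreme_point_of_convex_hull_affine_independent[OF z(2)] using C(3-5) by blast
    then show ?thesis using C(1,2) unfolding z(1)[symmetric] by blast
  qed
  then obtain pf Cf where cone: "\<And>T. T \<in> \<F> \<Longrightarrow> closed (Cf T)"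
    "\<And>T x. T \<in> \<F> \<Longrightarrow> x \<in> Cf T \<longleftrightarrow> (\<exists>y\<in>T. \<exists>r\<ge>0. x = x0 + r *\<^sub>R (y - x0))"
    "\<And>T v. T \<in> \<F> \<Longrightarrow> v extreme_point_of T \<Longrightarrow> pf T \<bullet> (v - x0) = a v"
    by metis
  \<comment> \<open>Two triangles meet in a common face, which is the hull of its extreme points.
    These are vertices of both triangles, so both forms take the nodal values there and agree on the
    hull.\<close>
  have agree: "pf T \<bullet> (x - x0) = pf T' \<bullet> (x - x0)" if TT: "T \<in> \<F>" "T' \<in> \<F>" and x: "x \<in> T" "x \<in> T'" for T T' x
  proof -
    let ?E = "T \<inter> T'"
    have face: "?E face_of T" "?E face_of T'"
      using F TT unfolding triangulated_boundary_def triangulation_def by (metis, metis Int_commute)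
    have "2 simplex T" using F TT(1) unfolding triangulated_boundary_def by blast
    then obtain z1 z2 z3 where z: "T = convex hull {z1, z2, z3}" by (rule simplex_2_obtain)
    have cT: "compact T" "convex T" unfolding z by (simp_all add: finite_imp_compact_convex_hull)
    have "compact ?E" by (rule face_of_imp_compact[OF cT(2,1) face(1)])
    moreover have "convex ?E" by (rule face_of_imp_convex[OF face(1)])
    ultimately have "?E = convex hull {v. v extreme_point_of ?E}" by (rule Krein_Milman_Minkowski)
    then have xE: "x \<in> convex hull {v. v extreme_point_of ?E}" using x by blast
    have "pf T \<bullet> x + - (pf T \<bullet> x0) = pf T' \<bullet> x + - (pf T' \<bullet> x0)"
    proof (rule affine_eq_on_hull[OF _ xE])
      fix v assume "v \<in> {v. v extreme_point_of ?E}"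
      then have "v extreme_point_of T" "v extreme_point_of T'"
        using extreme_point_of_face[OF face(1)] extreme_point_of_face[OF face(2)] by auto
      then have "pf T \<bullet> (v - x0) = pf T' \<bullet> (v - x0)" using cone(3) TT by simp
      then show "pf T \<bullet> v + - (pf T \<bullet> x0) = pf T' \<bullet> v + - (pf T' \<bullet> x0)" by (simp add: inner_diff_right)
    qed
    then show ?thesis by (simp add: inner_diff_right)
  qed
  \<comment> \<open>A common point of two cones other than the apex lies on a single ray, which
    meets the frontier in a single point. This point belongs to both triangles, so agreement on
    triangles extends to the cones by homogeneity.\<close>
  have agree': "pf T \<bullet> (x - x0) = pf T' \<bullet> (x - x0)"
    if TT: "T \<in> \<F>" "T' \<in> \<F>" and x: "x \<in> Cf T" "x \<in> Cf T'" for T T' x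
  proof -
    obtain y r where y: "y \<in> T" "0 \<le> r" "x = x0 + r *\<^sub>R (y - x0)" using x(1) cone(2)[OF TT(1)] by blast
    obtain y' r' where y': "y' \<in> T'" "0 \<le> r'" "x = x0 + r' *\<^sub>R (y' - x0)" using x(2) cone(2)[OF TT(2)] by blast
    show ?thesis
    proof (cases "x = x0")
      case False
      have eq: "r *\<^sub>R (y - x0) = r' *\<^sub>R (y' - x0)" using y(3) y'(3) by simp
      have "0 < r" "0 < r'" using False y y' by (auto simp: less_le)
      moreover have "y \<in> frontier K" "y' \<in> frontier K"
        using triangulated_boundary_frontier(1)[OF T F] TT y(1) y'(1) by blast+
      ultimately have "y = y'" using radial_point_unique[OF kf(3) kf(1) x0 _ _ _ _ eq] by blast
      then have "pf T \<bullet> (y - x0) = pf T' \<bullet> (y - x0)" using agree[OF TT] y(1) y'(1) by blast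
      then show ?thesis by (simp add: y(3))
    qed simp
  qed
  have cover: "\<exists>T\<in>\<F>. x \<in> Cf T" for x
  proof (cases "x = x0")
    case True
    obtain l :: R3 where "l \<noteq> 0" using axis_basis[of 1] nonzero_Basis by blast
    then obtain d where "0 < d" "x0 + d *\<^sub>R l \<in> frontier K"
      using ray_to_frontier[OF kf(2), of x0 l] x0 interior_open[OF kf(1)] by metis
    then obtain T where T1: "T \<in> \<F>" "x0 + d *\<^sub>R l \<in> T" using triangulated_boundary_frontier(2)[OF T F] by blast
    have "x = x0 + 0 *\<^sub>R (x0 + d *\<^sub>R l - x0)" by (simp add: True)
    then have "x \<in> Cf T" using cone(2)[OF T1(1)] T1(2) by (metis order_refl)
    then show ?thesis using T1(1) by blast
  next
    case False
    then have "x - x0 \<noteq> 0" by simp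
    then obtain d where d: "0 < d" "x0 + d *\<^sub>R (x - x0) \<in> frontier K"
      using ray_to_frontier[OF kf(2), of x0 "x - x0"] x0 interior_open[OF kf(1)] by metis
    then obtain T where T1: "T \<in> \<F>" "x0 + d *\<^sub>R (x - x0) \<in> T" using triangulated_boundary_frontier(2)[OF T F] by blast
    have "x = x0 + (1 / d) *\<^sub>R (x0 + d *\<^sub>R (x - x0) - x0)" "0 \<le> 1 / d" using d(1) by simp_all
    then have "x \<in> Cf T" using cone(2)[OF T1(1)] T1(2) by metis
    then show ?thesis using T1(1) by blast
  qed
  \<comment> \<open>By \<open>agree'\<close> the value does not depend on which cone is
    chosen.\<close>
  define f where "f x = pf (SOME T. T \<in> \<F> \<and> x \<in> Cf T) \<bullet> (x - x0)" for x
  have f: "f x = pf T \<bullet> (x - x0)" if "T \<in> \<F>" "x \<in> Cf T" for T x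
  proof -
    have "(SOME T. T \<in> \<F> \<and> x \<in> Cf T) \<in> \<F> \<and> x \<in> Cf (SOME T. T \<in> \<F> \<and> x \<in> Cf T)"
      by (rule someI[of "\<lambda>T. T \<in> \<F> \<and> x \<in> Cf T" T]) (use that in blast)
    then show ?thesis unfolding f_def using agree' that by blast
  qed
  have TC: "x \<in> Cf T" if "T \<in> \<F>" "x \<in> T" for T x
  proof -
    have "x = x0 + 1 *\<^sub>R (x - x0)" by simp
    then show ?thesis using cone(2)[OF that(1)] that(2) by (metis zero_le_one)
  qed
  \<comment> \<open>The sum of the norms is a convenient common upper bound for the Lipschitz
    constants of the pieces.\<close>
  define L where "L = (\<Sum>T\<in>\<F>. norm (pf T))"
  have L: "0 \<le> L" unfolding L_def by (intro sum_nonneg) simp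
  have lip: "\<bar>f x - f y\<bar> \<le> L * norm (x - y)" for x y
  proof (rule lipschitz_along_segment)
    show "finite (Cf ` \<F>)" using fin by simp
    show "closed C" if "C \<in> Cf ` \<F>" for C using that cone(1) by blast
    show "closed_segment x y \<subseteq> \<Union>(Cf ` \<F>)" using cover by blast
    fix C u v assume "C \<in> Cf ` \<F>" and uv: "u \<in> C" "v \<in> C"
    then obtain T where T1: "T \<in> \<F>" "C = Cf T" by blast
    have "f u - f v = pf T \<bullet> (u - v)"
      using f[OF T1(1)] uv T1(2) by (simp add: inner_diff_right)
    then have "\<bar>f u - f v\<bar> \<le> norm (pf T) * norm (u - v)" by (simp add: Cauchy_Schwarz_ineq2)
    also have "\<dots> \<le> L * norm (u - v)"
      unfolding L_def by (intro mult_right_mono member_le_sum[OF T1(1)] fin) auto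
    finally show "\<bar>f u - f v\<bar> \<le> L * norm (u - v)" .
  qed
  have "L-lipschitz_on UNIV f" by (rule lipschitz_onI) (use lip L in \<open>auto simp: dist_norm\<close>)
  then have cf: "continuous_on (frontier K) f"
    using lipschitz_on_continuous_on continuous_on_subset by blast
  have "\<exists>p q. \<forall>x\<in>T. f x = p \<bullet> x + q" if "T \<in> \<F>" for T
    by (intro exI[of _ "pf T"] exI[of _ "- (pf T \<bullet> x0)"])
      (use f[OF that TC[OF that]] in \<open>auto simp: inner_diff_right\<close>)
  then have fB: "f \<in> B_space K \<F>" using cf unfolding B_space_def by blast
  have "f z = a z" if "z \<in> nodes \<F>" for z
  proof -
    obtain T where T1: "T \<in> \<F>" "z extreme_point_of T" using \<open>z \<in> nodes \<F>\<close> unfolding nodes_def by blast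
    have "z \<in> T" using T1(2) unfolding extreme_point_of_def by blast
    then show ?thesis using f[OF T1(1) TC[OF T1(1)]] cone(3)[OF T1] by simp
  qed
  then show ?thesis using that L lip fB by blast
qed

section \<open>Smooth approximation of Lipschitz functions\<close>

text \<open>The derivative in the direction of the gradient itself is the square of its norm, while
  the Lipschitz condition bounds it by \<open>L\<close> times the norm.\<close>

lemma grad_norm_le:
  assumes f: "smooth f" and lip: "\<And>x y. \<bar>f x - f y\<bar> \<le> L * norm (x - y)"
  shows "norm (grad f x) \<le> L"
proof -
  let ?e = "grad f x"
  have "?e \<bullet> ?e \<le> L * norm ?e"
  proof (rule LIMSEQ_le_const2[OF smooth_directional_limit[OF f, of x ?e]], intro exI allI impI)
    fix n :: nat
    let ?h = "inverse (real (Suc n))"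
    have h: "0 < ?h" by simp
    have "f (x + ?h *\<^sub>R ?e) - f x \<le> L * norm (x + ?h *\<^sub>R ?e - x)" using lip[of "x + ?h *\<^sub>R ?e" x] by linarith
    also have "\<dots> = L * norm ?e * ?h" using h by simp
    finally show "(f (x + ?h *\<^sub>R ?e) - f x) / ?h \<le> L * norm ?e" unfolding pos_divide_le_eq[OF h] .
  qed
  then have "norm ?e * norm ?e \<le> L * norm ?e" by (simp add: power2_norm_eq_inner[symmetric] power2_eq_square)
  then show ?thesis
  proof (cases "norm ?e = 0")
    \<comment> \<open>When the gradient vanishes, \<open>L\<close> still has to be nonnegative; the
      Lipschitz condition at two points of distance 1 shows it.\<close>
    case True
    have "0 \<le> \<bar>f (axis 1 1) - f 0\<bar>" by simp
    also have "\<dots> \<le> L * norm (axis 1 (1::real) - (0::R3))" by (rule lip)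
    finally show ?thesis using True by (simp add: norm_axis_1)
  next
    case False
    then show ?thesis using \<open>norm ?e * norm ?e \<le> L * norm ?e\<close> mult_le_cancel_right[of "norm ?e" "norm ?e" L] by auto
  qed
qed

lemma smooth_regularized_norm:
  assumes "0 < \<delta>" shows "smooth (\<lambda>x. sqrt ((norm (x - y))\<^sup>2 + \<delta>\<^sup>2))"
proof -
  have "smooth (\<lambda>x. (\<Sum>i\<in>UNIV. (x $ i - y $ i) * (x $ i - y $ i)) + \<delta>\<^sup>2)"
    by (intro smooth_add smooth_sum smooth_mult smooth_diff smooth_component smooth_const)
  moreover have "(\<Sum>i\<in>UNIV. (x $ i - y $ i) * (x $ i - y $ i)) = (norm (x - y))\<^sup>2" for x
    by (simp add: power2_norm_eq_inner inner_vec_def)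
  ultimately have "smooth (\<lambda>x. (norm (x - y))\<^sup>2 + \<delta>\<^sup>2)" by simp
  then show ?thesis
  proof (rule smooth_sqrt)
    fix x show "0 < (norm (x - y))\<^sup>2 + \<delta>\<^sup>2" using assms by (simp add: add_nonneg_pos)
  qed
qed

text \<open>The square root is the Euclidean norm of the pair \<open>(x - z, \<delta>)\<close>, so
  this is the triangle inequality one dimension higher.\<close>

lemma regularized_norm_lipschitz:
  "sqrt ((norm (x - z))\<^sup>2 + \<delta>\<^sup>2) \<le> sqrt ((norm (y - z))\<^sup>2 + \<delta>\<^sup>2) + norm (x - y)" for x y z :: R3
proof -
  have "norm (x - z, \<delta>) \<le> norm (y - z, \<delta>) + norm (x - y, 0::real)"
    using norm_triangle_ineq[of "(y - z, \<delta>)" "(x - y, 0)"] by simp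
  then show ?thesis by (simp add: norm_Pair)
qed

text \<open>The soft minimum \<open>-\<delta> ln \<Sum> exp (-a i / \<delta>)\<close> of finitely many \<open>L\<close>-Lipschitz functions is
  \<open>L\<close>-Lipschitz and within \<open>\<delta> ln N\<close> of the minimum; here the \<open>a i\<close> are the smoothed cones of
  McShane's extension formula.\<close>

lemma smooth_lipschitz_approximation:
  fixes f :: "R3 \<Rightarrow> real"
  assumes L: "0 \<le> L" and lip: "\<And>x y. \<bar>f x - f y\<bar> \<le> L * norm (x - y)"
    and D: "compact D" and eta: "0 < \<eta>"
  obtains u where "smooth u" "\<And>x. norm (grad u x) \<le> L" "\<And>y. y \<in> D \<Longrightarrow> \<bar>u y - f y\<bar> \<le> \<eta>"
proof -
  \<comment> \<open>Mesh size of the finite net. The distance to the net, its use inside the cone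
    and the regularization together cost at most \<open>3 * L * e\<close>, which is below \<eta>;
    \<open>L + 1\<close> avoids division by zero.\<close>
  define e where "e = \<eta> / (4 * (L + 1))"
  have e: "0 < e" using eta L by (simp add: e_def)
  obtain Y0 where Y0: "finite Y0" "D \<subseteq> (\<Union>y\<in>Y0. ball y e)"
    using D e unfolding compact_eq_totally_bounded by metis
  \<comment> \<open>The additional point keeps the net nonempty, so the logarithm below is taken of
    a positive sum even for empty \<open>D\<close>.\<close>
  define Y where "Y = insert 0 Y0"
  have Y: "finite Y" "Y \<noteq> {}" "D \<subseteq> (\<Union>y\<in>Y. ball y e)" using Y0 by (auto simp: Y_def)
  define N where "N = real (card Y)"
  have N: "1 \<le> N" using Y by (simp add: N_def card_gt_0_iff Suc_leI)
  \<comment> \<open>The same \<open>d\<close> regularizes the cones, hence \<open>d \<le> e\<close>,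
    and is the temperature of the soft minimum, whose error is \<open>d * ln N \<le> \<eta>\<close>.
    Adding 1 to \<open>ln N\<close> covers \<open>N = 1\<close>.\<close>
  define d where "d = min e (\<eta> / (ln N + 1))"
  have lnN: "0 \<le> ln N" using N by simp
  have d: "0 < d" "d \<le> e" "d * ln N \<le> \<eta>"
  proof -
    show "0 < d" using e eta lnN by (simp add: d_def add_nonneg_pos)
    show "d \<le> e" by (simp add: d_def)
    have "d * ln N \<le> \<eta> / (ln N + 1) * ln N" using lnN by (intro mult_right_mono) (auto simp: d_def)
    also have "\<dots> \<le> \<eta>" using eta lnN by (simp add: field_simps)
    finally show "d * ln N \<le> \<eta>" .
  qed
  define a where "a y x = f y + L * sqrt ((norm (x - y))\<^sup>2 + d\<^sup>2)" for y x
  define s where "s x = (\<Sum>y\<in>Y. exp (- a y x / d))" for x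
  define u where "u x = - d * ln (s x)" for x
  have spos: "0 < s x" for x unfolding s_def using Y(1,2) by (intro sum_pos) auto
  have sa: "smooth (a y)" for y
    unfolding a_def[abs_def] by (intro smooth_add smooth_const smooth_mult smooth_regularized_norm d)
  have "smooth (\<lambda>x. (- 1 / d) * a y x)" for y by (intro smooth_mult smooth_const sa)
  then have "smooth (\<lambda>x. - a y x / d)" for y by simp
  then have "smooth s" unfolding s_def[abs_def] by (intro smooth_sum smooth_exp)
  then have su: "smooth u" unfolding u_def[abs_def] by (intro smooth_mult smooth_const smooth_ln spos)
  have alip: "a y x \<le> a y x' + L * norm (x - x')" for y x x'
    using mult_left_mono[OF regularized_norm_lipschitz[of x y d x'] L] by (simp add: a_def algebra_simps)
  have ulip1: "u x \<le> u x' + L * norm (x - x')" for x x'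
  proof -
    let ?t = "L * norm (x - x') / d"
    have "exp (- ?t) * s x' = (\<Sum>y\<in>Y. exp (- ?t + - a y x' / d))"
      by (simp add: s_def sum_distrib_left exp_add[symmetric])
    also have "\<dots> \<le> s x" unfolding s_def
    proof (intro sum_mono, subst exp_le_cancel_iff)
      fix y
      have "- (L * norm (x - x')) + - a y x' \<le> - a y x" using alip[of y x x'] by linarith
      then have "(- (L * norm (x - x')) + - a y x') / d \<le> - a y x / d" using d(1) by (intro divide_right_mono) auto
      then show "- ?t + - a y x' / d \<le> - a y x / d" by (simp add: diff_divide_distrib)
    qed
    finally have "ln (exp (- ?t) * s x') \<le> ln (s x)" using spos by (subst ln_le_cancel_iff) auto
    then have "- ?t + ln (s x') \<le> ln (s x)" using spos[of x'] by (simp add: ln_mult)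
    then have "d * (- ?t + ln (s x')) \<le> d * ln (s x)" using d(1) by (intro mult_left_mono) auto
    moreover have "d * ?t = L * norm (x - x')" using d(1) by simp
    ultimately show ?thesis unfolding u_def by (simp add: algebra_simps)
  qed
  have ulip: "\<bar>u x - u x'\<bar> \<le> L * norm (x - x')" for x x'
    using ulip1[of x x'] ulip1[of x' x] by (simp add: norm_minus_commute)
  have near: "\<bar>u x - f x\<bar> \<le> \<eta>" if xD: "x \<in> D" for x
  proof -
    have low: "f x \<le> a y x" for y
    proof -
      have "f x \<le> f y + L * norm (x - y)" using lip[of x y] by linarith
      also have "\<dots> \<le> a y x" unfolding a_def by (intro add_left_mono mult_left_mono L real_le_rsqrt) simp
      finally show ?thesis .
    qed
    have "s x \<le> (\<Sum>y\<in>Y. exp (- f x / d))"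
      unfolding s_def using low d(1) by (intro sum_mono) (auto intro!: divide_right_mono)
    also have "\<dots> = N * exp (- f x / d)" by (simp add: N_def)
    finally have "ln (s x) \<le> ln (N * exp (- f x / d))" using spos N by (subst ln_le_cancel_iff) auto
    then have "ln (s x) \<le> ln N - f x / d" using N by (simp add: ln_mult)
    then have "d * ln (s x) \<le> d * (ln N - f x / d)" using d(1) by (intro mult_left_mono) auto
    then have l: "u x \<ge> f x - \<eta>" using d(1,3) by (simp add: u_def algebra_simps)
    obtain y where y: "y \<in> Y" "dist y x < e" using Y(3) xD by auto
    have "sqrt ((norm (x - y))\<^sup>2 + d\<^sup>2) \<le> norm (x - y) + d"
      using sqrt_sum_squares_le_sum[of "norm (x - y)" d] d(1) by simp
    also have "\<dots> \<le> 2 * e" using y(2) d(2) by (simp add: dist_norm norm_minus_commute)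
    finally have sq: "L * sqrt ((norm (x - y))\<^sup>2 + d\<^sup>2) \<le> L * (2 * e)" using L by (rule mult_left_mono)
    have "f y \<le> f x + L * norm (y - x)" using lip[of y x] by linarith
    also have "L * norm (y - x) \<le> L * e" using y(2) L by (intro mult_left_mono) (auto simp: dist_norm)
    finally have "a y x \<le> f x + 3 * (L * e)" using sq by (simp add: a_def)
    also have "3 * (L * e) \<le> \<eta>"
    proof -
      have "L * e \<le> (L + 1) * e" using e by simp
      also have "(L + 1) * e = \<eta> / 4"
      proof -
        have "4 * (L + 1) \<noteq> 0" using L by simp
        then have "e * (4 * (L + 1)) = \<eta>" unfolding e_def by (metis nonzero_divide_eq_eq)
        then show ?thesis by (simp add: algebra_simps)
      qed
      finally show ?thesis using eta by simp
    qed
    finally have ay: "a y x \<le> f x + \<eta>" by simp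
    have "exp (- a y x / d) \<le> s x" unfolding s_def by (rule member_le_sum[OF y(1) _ Y(1)]) simp
    then have "ln (exp (- a y x / d)) \<le> ln (s x)" using spos by (subst ln_le_cancel_iff) auto
    then have "d * (- a y x / d) \<le> d * ln (s x)" using d(1) by (intro mult_left_mono) auto
    then have "u x \<le> a y x" using d(1) by (simp add: u_def)
    then show ?thesis using l ay by linarith
  qed
  show ?thesis by (rule that[OF su grad_norm_le[OF su ulip] near])
qed

section \<open>The interface is negligible\<close>

text \<open>Infinitely many translates of \<open>S\<close> in direction \<open>e\<close> are disjoint and fit in a bounded set.\<close>

lemma negligible_line_injective:
  fixes S :: "R3 set"
  assumes S: "compact S" and inj: "\<And>x t. x \<in> S \<Longrightarrow> x + t *\<^sub>R e \<in> S \<Longrightarrow> t = 0"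
  shows "negligible S"
proof -
  have Sm: "S \<in> lmeasurable" using S by (rule lmeasurable_compact)
  obtain R where R: "\<And>x. x \<in> S \<Longrightarrow> norm x \<le> R" using compact_imp_bounded[OF S] bounded_iff by blast
  define h where "h n = inverse (real (Suc n))" for n
  have h: "0 < h n" "h n \<le> 1" for n by (auto simp: h_def field_simps)
  define T where "T n = (+) (h n *\<^sub>R e) ` S" for n
  have Tm: "T n \<in> lmeasurable" for n unfolding T_def by (rule measurable_translation[OF Sm])
  have mT: "measure lebesgue (T n) = measure lebesgue S" for n unfolding T_def by (rule measure_translation)
  have disj: "T i \<inter> T j = {}" if "i \<noteq> j" for i j
  proof (rule ccontr)
    assume "T i \<inter> T j \<noteq> {}"
    then obtain x y where xy: "x \<in> S" "y \<in> S" "h i *\<^sub>R e + x = h j *\<^sub>R e + y" unfolding T_def by auto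
    then have "x + (h i - h j) *\<^sub>R e = y" by (simp add: algebra_simps)
    then have "h i - h j = 0" using inj[OF xy(1), of "h i - h j"] xy(2) by simp
    then show False using that by (simp add: h_def)
  qed
  have sub: "T n \<subseteq> cball 0 (R + norm e)" for n
  proof
    fix y assume "y \<in> T n"
    then obtain x where x: "x \<in> S" "y = h n *\<^sub>R e + x" unfolding T_def by auto
    have "norm y \<le> norm (h n *\<^sub>R e) + norm x" unfolding x(2) by (rule norm_triangle_ineq)
    also have "norm (h n *\<^sub>R e) \<le> norm e" using h[of n] by (simp add: mult_left_le_one_le)
    finally show "y \<in> cball 0 (R + norm e)" using R[OF x(1)] by simp
  qed
  define m where "m = measure lebesgue S"
  have le: "real N * m \<le> measure lebesgue (cball (0::R3) (R + norm e))" for N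
  proof -
    have "real N * m = (\<Sum>n<N. measure lebesgue (T n))" by (simp add: mT m_def)
    also have "\<dots> = measure lebesgue (\<Union>n<N. T n)"
      by (rule measure_UNION'[symmetric]) (use Tm disj in \<open>auto simp: pairwise_def disjnt_def\<close>)
    also have "\<dots> \<le> measure lebesgue (cball (0::R3) (R + norm e))"
      by (rule measure_mono_fmeasurable) (use sub Tm in \<open>auto intro!: fmeasurable.finite_UN fmeasurableD\<close>)
    finally show ?thesis .
  qed
  have "m \<le> 0"
  proof (rule ccontr)
    assume "\<not> m \<le> 0"
    then obtain N where "measure lebesgue (cball (0::R3) (R + norm e)) < real N * m"
      using reals_Archimedean3[of m] by auto
    then show False using le[of N] by simp
  qed
  moreover have "m \<ge> 0" by (simp add: m_def)
  ultimately have "m = 0" by simp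
  then show ?thesis using negligible_iff_measure0[OF Sm] by (simp add: m_def)
qed

text \<open>In a small ball the derivative of \<phi> in the direction of its gradient at the centre
  stays positive. So \<phi> is strictly increasing along that direction, and a level set meets each
  such line at most once.\<close>

lemma surface_locally_line_injective:
  assumes phi: "Ck_on (Suc 0) U \<phi>" "open U" "x0 \<in> U" "grad \<phi> x0 \<noteq> 0"
  obtains r e where "0 < r" "cball x0 r \<subseteq> U"
    "\<And>x t. x \<in> cball x0 r \<Longrightarrow> x + t *\<^sub>R e \<in> cball x0 r \<Longrightarrow> \<phi> x = \<phi> (x + t *\<^sub>R e) \<Longrightarrow> t = 0"
proof -
  define e where "e = grad \<phi> x0"
  have diff: "\<And>x. x \<in> U \<Longrightarrow> \<phi> differentiable (at x)" and c: "\<And>i. continuous_on U (\<lambda>x. grad \<phi> x $ i)"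
    using phi(1) by auto
  have "continuous_on U (\<lambda>x. \<chi> i. grad \<phi> x $ i)" by (intro continuous_on_vec_lambda c)
  then have cg: "continuous_on U (grad \<phi>)" by simp
  have "open (U \<inter> (\<lambda>x. grad \<phi> x \<bullet> e) -` {0<..})"
    by (intro continuous_open_preimage continuous_intros cg phi(2))
  moreover have "x0 \<in> U \<inter> (\<lambda>x. grad \<phi> x \<bullet> e) -` {0<..}" using phi by (simp add: e_def)
  ultimately obtain r where r: "0 < r" "cball x0 r \<subseteq> U \<inter> (\<lambda>x. grad \<phi> x \<bullet> e) -` {0<..}"
    using open_contains_cball by blast
  have incr: "\<phi> x < \<phi> (x + t *\<^sub>R e)" if x: "x \<in> cball x0 r" "x + t *\<^sub>R e \<in> cball x0 r" and t: "0 < t" for x t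
  proof -
    have "\<phi> (x + 0 *\<^sub>R e) < \<phi> (x + t *\<^sub>R e)"
    proof (rule DERIV_pos_imp_increasing[OF t])
      fix s :: real assume s: "0 \<le> s" "s \<le> t"
      have "(1 - s / t) *\<^sub>R x + (s / t) *\<^sub>R (x + t *\<^sub>R e) \<in> cball x0 r"
        by (rule convexD_alt[OF convex_cball x]) (use s t in auto)
      moreover have "(1 - s / t) *\<^sub>R x + (s / t) *\<^sub>R (x + t *\<^sub>R e) = x + s *\<^sub>R e"
        using t by (simp add: algebra_simps)
      ultimately have y: "x + s *\<^sub>R e \<in> U" "0 < grad \<phi> (x + s *\<^sub>R e) \<bullet> e" using r(2) by auto
      have "((\<lambda>s. x + s *\<^sub>R e) has_derivative (\<lambda>t. t *\<^sub>R e)) (at s)"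
        by (auto intro!: derivative_eq_intros)
      from has_derivative_compose[OF this has_derivative_grad[OF diff[OF y(1)]]]
      have "((\<lambda>s. \<phi> (x + s *\<^sub>R e)) has_real_derivative grad \<phi> (x + s *\<^sub>R e) \<bullet> e) (at s)"
        by (simp add: has_field_derivative_def mult_commute_abs)
      then show "\<exists>y. ((\<lambda>s. \<phi> (x + s *\<^sub>R e)) has_real_derivative y) (at s) \<and> 0 < y" using y(2) by blast
    qed
    then show ?thesis by simp
  qed
  show ?thesis
  proof (rule that[OF r(1)])
    show "cball x0 r \<subseteq> U" using r(2) by auto
    fix x t assume x: "x \<in> cball x0 r" "x + t *\<^sub>R e \<in> cball x0 r" and eq: "\<phi> x = \<phi> (x + t *\<^sub>R e)"
    show "t = 0"
    proof (rule ccontr)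
      assume "t \<noteq> 0"
      then consider "0 < t" | "0 < - t" by linarith
      then show False
      proof cases
        case 1 then show False using incr[OF x] eq by simp
      next
        case 2 then show False using incr[OF x(2), of "- t"] x(1) eq by simp
      qed
    qed
  qed
qed

text \<open>Negligibility is a local property. Near each point the surface is a level set, which is
  injective along the lines of one direction, so \<open>negligible_line_injective\<close> applies to
  its intersection with a closed ball.\<close>

lemma Ck_surface_negligible:
  assumes S: "Ck_surface k S" "1 \<le> k" "closed S"
  shows "negligible S"
  unfolding locally_negligible_alt[of S]
proof
  fix x0 assume x0: "x0 \<in> S"
  obtain U \<phi> where U: "open U" "x0 \<in> U" "Ck_on k U \<phi>" "\<And>x. x \<in> U \<Longrightarrow> grad \<phi> x \<noteq> 0" "S \<inter> U = {x \<in> U. \<phi> x = 0}"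
  proof -
    from bspec[OF S(1)[unfolded Ck_surface_def] x0] obtain U \<phi> where
      "open U \<and> x0 \<in> U \<and> Ck_on k U \<phi> \<and> (\<forall>x\<in>U. grad \<phi> x \<noteq> 0) \<and> S \<inter> U = {x \<in> U. \<phi> x = 0}"
      by (elim exE)
    then show ?thesis by (intro that[of U \<phi>]) simp_all
  qed
  \<comment> \<open>Once differentiability of any order is known, the first derivatives are
    continuous on the open set \<open>U\<close>; first order is what the local argument
    uses.\<close>
  have "\<forall>j f. Ck_on (Suc j) U f \<longrightarrow> Ck_on (Suc 0) U f"
  proof
    fix j show "\<forall>f. Ck_on (Suc j) U f \<longrightarrow> Ck_on (Suc 0) U f"
    proof (induction j)
      case (Suc j)
      have "Ck_on 0 U g" if "Ck_on (Suc j) U g" for g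
        using that U(1) by (auto intro!: continuous_at_imp_continuous_on differentiable_imp_continuous_within)
      then show ?case unfolding Ck_on.simps(2)[of "Suc j"] Ck_on.simps(2)[of 0] by blast
    qed simp
  qed
  moreover have "k = Suc (k - 1)" using S(2) by simp
  ultimately have C1: "Ck_on (Suc 0) U \<phi>" using U(3) by metis
  obtain r e where r: "0 < r" "cball x0 r \<subseteq> U"
    "\<And>x t. x \<in> cball x0 r \<Longrightarrow> x + t *\<^sub>R e \<in> cball x0 r \<Longrightarrow> \<phi> x = \<phi> (x + t *\<^sub>R e) \<Longrightarrow> t = 0"
    using surface_locally_line_injective[OF C1 U(1,2) U(4)[OF U(2)]] by metis
  have "negligible (S \<inter> cball x0 r)"
  proof (rule negligible_line_injective)
    show "compact (S \<inter> cball x0 r)" using S(3) by (simp add: closed_Int_compact)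
    fix x t assume "x \<in> S \<inter> cball x0 r" "x + t *\<^sub>R e \<in> S \<inter> cball x0 r"
    moreover have "\<phi> y = 0" if "y \<in> S \<inter> cball x0 r" for y using that r(2) U(5) by blast
    ultimately show "t = 0" using r(3)[of x t] by auto
  qed
  then have "negligible (S \<inter> ball x0 r)" by (rule negligible_subset) auto
  moreover have "openin (top_of_set S) (S \<inter> ball x0 r)" by (simp add: openin_open_Int)
  moreover have "x0 \<in> S \<inter> ball x0 r" using x0 r(1) by simp
  ultimately show "\<exists>U. openin (top_of_set S) U \<and> x0 \<in> U \<and> negligible U" by blast
qed

text \<open>Completeness of Lebesgue measure: whatever \<open>g\<close> does on \<open>N\<close>,
  the preimages change only by a null set. This is applied to \<beta>, which is arbitrary on the
  interface.\<close>

lemma measurable_off_negligible: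
  fixes f g :: "R3 \<Rightarrow> real"
  assumes N: "negligible N" and K: "K \<in> sets lebesgue" and f: "f \<in> borel_measurable (lebesgue_on K)"
    and eq: "\<And>x. x \<in> K - N \<Longrightarrow> f x = g x"
  shows "g \<in> borel_measurable (lebesgue_on K)"
proof (rule measurableI)
  fix A :: "real set" assume A: "A \<in> sets borel"
  have "f -` A \<inter> space (lebesgue_on K) \<in> sets (lebesgue_on K)" using measurable_sets[OF f A] .
  then have 1: "f -` A \<inter> K \<in> sets lebesgue" using K by (simp add: sets_restrict_space_iff)
  have N': "negligible (g -` A \<inter> (K \<inter> N))" by (rule negligible_subset[OF N]) auto
  have "g -` A \<inter> K = (f -` A \<inter> K - N) \<union> (g -` A \<inter> (K \<inter> N))" using eq by auto
  then have "g -` A \<inter> K \<in> sets lebesgue"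
    using 1 negligible_imp_sets[OF N] negligible_imp_sets[OF N'] by auto
  then show "g -` A \<inter> space (lebesgue_on K) \<in> sets (lebesgue_on K)"
    using K by (simp add: sets_restrict_space_iff)
qed simp

section \<open>The weighted Dirichlet energy\<close>

lemma L2_triangle:
  fixes g :: "R3 \<Rightarrow> real"
  assumes "continuous_on (convex hull {a, b, c}) g"
  shows "L2 (triangle_measure a b c) g"
proof -
  have "compact (convex hull {a, b, c})" by (simp add: finite_imp_compact_convex_hull)
  then obtain B where "\<And>x. x \<in> convex hull {a, b, c} \<Longrightarrow> norm (g x) \<le> B"
    using assms by (rule bounded_on_compact) blast
  then show ?thesis by (intro L2_triangle_continuous(1)[OF assms, of B]) simp
qed

lemma corner_form_less_1:
  assumes "corner a b c d p q K" "x \<in> K" shows "p \<bullet> x + q < 1"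
proof -
  interpret corner a b c d p q K by (rule assms)
  obtain s t r where x: "x = Phi a b c d ((s, t), r)" by (rule Phi_surj[OF nd])
  then show ?thesis using K[of s t r] form[of s t r] assms(2) by simp
qed

text \<open>The height form stays below 1 on \<open>K\<close>, so the layer of width 1 is all of
  \<open>K\<close>. Layer estimates thereby include global ones.\<close>

lemma integral_indicator_whole:
  fixes f :: "R3 \<Rightarrow> real"
  assumes "corner a b c d p q K"
  shows "(\<integral>x. indicator {x \<in> K. p \<bullet> x + q < 1} x * f x \<partial>lebesgue_on K) = (\<integral>x. f x \<partial>lebesgue_on K)"
  using corner_form_less_1[OF assms]
  by (intro Bochner_Integration.integral_cong) (auto simp: indicator_def)

text \<open>The bounds on the weight hold almost everywhere because \<beta> may take any values on
  the interface.\<close>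

locale weighted_tetrahedron =
  fixes K S :: "R3 set" and b :: "R3 \<Rightarrow> real" and b0 b1 :: real
  assumes T: "tetrahedron K S" and bm: "b \<in> borel_measurable (lebesgue_on K)"
    and b0: "0 < b0" and bb: "AE x in lebesgue_on K. b0 \<le> b x \<and> b x \<le> b1"
begin

abbreviation "M \<equiv> lebesgue_on K"

lemmas oK = tetrahedron_facts(1)[OF T] and bK = tetrahedron_facts(2)[OF T]

lemma b_abs: "AE x in M. \<bar>b x\<bar> \<le> b1"
  using bb by eventually_elim (use b0 in auto)

lemma weight_L2: "L2 M F \<Longrightarrow> L2 M (\<lambda>x. b x *\<^sub>R F x)"
  by (rule L2_bounded_mult[OF _ bm b_abs])

text \<open>The form acts on vector fields instead of functions, so gradients of smooth functions
  and weak gradients that are mere \<open>L2\<close> limits are treated alike.\<close>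

definition energy :: "(R3 \<Rightarrow> R3) \<Rightarrow> (R3 \<Rightarrow> R3) \<Rightarrow> real" where
  "energy F H = (\<integral>x. b x * (F x \<bullet> H x) \<partial>M)"

lemma energy_integrable: "L2 M F \<Longrightarrow> L2 M H \<Longrightarrow> integrable M (\<lambda>x. b x * (F x \<bullet> H x))"
  using L2_inner_integrable[OF weight_L2] by fastforce

lemma energy_nonneg: "0 \<le> energy F F"
  unfolding energy_def by (rule integral_nonneg_AE) (use bb in eventually_elim, use b0 in auto)

lemma energy_lower: assumes F: "L2 M F" shows "b0 * (\<integral>x. (norm (F x))\<^sup>2 \<partial>M) \<le> energy F F"
proof -
  have "(\<integral>x. b0 * (norm (F x))\<^sup>2 \<partial>M) \<le> (\<integral>x. b x * (F x \<bullet> F x) \<partial>M)"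
  proof (rule integral_mono_AE)
    show "integrable M (\<lambda>x. b0 * (norm (F x))\<^sup>2)" using L2_integrable[OF F] by simp
    show "AE x in M. b0 * (norm (F x))\<^sup>2 \<le> b x * (F x \<bullet> F x)"
      using bb by eventually_elim (auto simp: power2_norm_eq_inner intro!: mult_right_mono)
  qed (rule energy_integrable[OF F F])
  then show ?thesis by (simp add: energy_def)
qed

text \<open>Stated with the midpoint, because the midpoint of two competitors is again a competitor
  and its energy is bounded below by the infimum.\<close>

lemma energy_parallelogram:
  assumes F: "L2 M F" and H: "L2 M H"
  shows "energy (\<lambda>x. F x - H x) (\<lambda>x. F x - H x) = 2 * energy F F + 2 * energy H H
    - 4 * energy (\<lambda>x. (1/2) *\<^sub>R (F x + H x)) (\<lambda>x. (1/2) *\<^sub>R (F x + H x))"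
proof -
  let ?A = "\<lambda>x. (1/2) *\<^sub>R (F x + H x)"
  have A: "L2 M ?A" by (intro L2_scaleR L2_add F H)
  have "energy (\<lambda>x. F x - H x) (\<lambda>x. F x - H x)
     = (\<integral>x. 2 * (b x * (F x \<bullet> F x)) + 2 * (b x * (H x \<bullet> H x)) - 4 * (b x * (?A x \<bullet> ?A x)) \<partial>M)"
    unfolding energy_def by (intro Bochner_Integration.integral_cong) (auto simp: inner_add_left inner_add_right inner_diff_left inner_diff_right inner_commute algebra_simps)
  also have "\<dots> = 2 * energy F F + 2 * energy H H - 4 * energy ?A ?A"
  proof -
    have "(\<integral>x. 2 * X x + 2 * Y x - 4 * Z x \<partial>M) = 2 * (\<integral>x. X x \<partial>M) + 2 * (\<integral>x. Y x \<partial>M) - 4 * (\<integral>x. Z x \<partial>M)"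
      if "integrable M X" "integrable M Y" "integrable M Z" for X Y Z :: "R3 \<Rightarrow> real"
      using that by simp
    from this[OF energy_integrable[OF F F] energy_integrable[OF H H] energy_integrable[OF A A]] show ?thesis
      unfolding energy_def .
  qed
  finally show ?thesis .
qed

lemma energy_add_scaled:
  assumes F: "L2 M F" and H: "L2 M H"
  shows "energy (\<lambda>x. F x + t *\<^sub>R H x) (\<lambda>x. F x + t *\<^sub>R H x) = energy F F + 2 * t * energy F H + t\<^sup>2 * energy H H"
proof -
  have "energy (\<lambda>x. F x + t *\<^sub>R H x) (\<lambda>x. F x + t *\<^sub>R H x)
     = (\<integral>x. b x * (F x \<bullet> F x) + (2 * t * (b x * (F x \<bullet> H x)) + t\<^sup>2 * (b x * (H x \<bullet> H x))) \<partial>M)"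
    unfolding energy_def by (intro Bochner_Integration.integral_cong)
      (auto simp: inner_add_left inner_add_right inner_commute power2_eq_square[of t] algebra_simps)
  also have "\<dots> = energy F F + 2 * t * energy F H + t\<^sup>2 * energy H H"
    unfolding energy_def using energy_integrable[OF F F] energy_integrable[OF F H] energy_integrable[OF H H] by simp
  finally show ?thesis .
qed

text \<open>The layer estimate of one face at width 1, where the layer is the whole
  tetrahedron.\<close>

lemma poincare:
  obtains a1 a2 a3 C where "(convex hull {a1, a2, a3}) facet_of closure K" "0 < C"
    "\<And>u. smooth u \<Longrightarrow> (\<integral>x. (norm (u x))\<^sup>2 \<partial>M) \<le> C * (\<integral>x. (norm (u x))\<^sup>2 \<partial>triangle_measure a1 a2 a3)
        + C * (\<integral>x. (norm (grad u x))\<^sup>2 \<partial>M)"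
proof -
  have "card S = 4" using T unfolding tetrahedron_def by blast
  then obtain a b c d where S: "S = {a, b, c, d}" "distinct [a, b, c, d]" by (rule card_4_obtain)
  obtain p q where crn: "corner a b c d p q K" by (rule tetrahedron_corner[OF T[unfolded S(1)] S(2)])
  have F: "(convex hull {a, b, c}) facet_of closure K" by (rule face_of_vertices[OF T S])
  obtain C where C: "0 < C" "\<And>u \<delta>. smooth u \<Longrightarrow> L2 (triangle_measure a b c) u \<Longrightarrow> 0 < \<delta> \<Longrightarrow> \<delta> \<le> 1 \<Longrightarrow>
      (\<integral>x. indicator {x \<in> K. p \<bullet> x + q < \<delta>} x * (norm (u x))\<^sup>2 \<partial>M)
      \<le> C * \<delta> * (\<integral>x. (norm (u x))\<^sup>2 \<partial>triangle_measure a b c)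
        + C * \<delta>\<^sup>2 * (\<integral>x. indicator {x \<in> K. p \<bullet> x + q < \<delta>} x * (norm (grad u x))\<^sup>2 \<partial>M)"
    by (rule corner.layer_estimate_smooth[OF crn bK]) blast
  show ?thesis
  proof (rule that[OF F C(1)])
    fix u assume u: "smooth u"
    from C(2)[OF u L2_triangle[OF smooth_continuous[OF u]], of 1]
    show "(\<integral>x. (norm (u x))\<^sup>2 \<partial>M) \<le> C * (\<integral>x. (norm (u x))\<^sup>2 \<partial>triangle_measure a b c)
        + C * (\<integral>x. (norm (grad u x))\<^sup>2 \<partial>M)"
      by (simp only: integral_indicator_whole[OF crn]) simp
  qed
qed

text \<open>Near-minimizers of the energy among smooth functions whose boundary values are
  uniformly close to \<open>f\<close> form a Cauchy sequence by the parallelogram identity.\<close>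

lemma minimizer:
  fixes f :: "R3 \<Rightarrow> real"
  assumes L: "0 \<le> L" and lip: "\<And>x y. \<bar>f x - f y\<bar> \<le> L * norm (x - y)"
  obtains u v G where "\<And>n. smooth (u n)" "L2_tendsto M u v" "L2_tendsto M (\<lambda>n. grad (u n)) G"
    "\<And>a1 a2 a3. (convex hull {a1, a2, a3}) facet_of closure K \<Longrightarrow> L2_tendsto (triangle_measure a1 a2 a3) u f"
    "\<And>\<phi>. test_function K \<phi> \<Longrightarrow> energy G (grad \<phi>) = 0"
proof -
  have gL: "L2 M (grad u)" if "smooth u" for u by (rule L2_smooth_grad[OF oK bK that])
  define J where "J u = energy (grad u) (grad u)" for u
  \<comment> \<open>Competitors match \<open>f\<close> on the boundary up to \<open>e\<close>. The
    class is closed under midpoints and under adding test functions, the two operations that the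
    argument performs.\<close>
  define Cs where "Cs e = {u. smooth u \<and> (\<forall>y\<in>frontier K. \<bar>u y - f y\<bar> \<le> e)}" for e
  define m where "m e = Inf (J ` Cs e)" for e
  have fK: "compact (frontier K)" using bK by (simp add: compact_frontier_bounded)
  \<comment> \<open>Smooth approximations of \<open>f\<close> have gradients bounded by
    \<open>L\<close> however closely they match \<open>f\<close>, so this bounds every infimum of
    the energy independently of the tolerance.\<close>
  define Mx where "Mx = (\<integral>x. b1 * L\<^sup>2 \<partial>M)"
  interpret fin: finite_measure M by (rule finite_measure_lebesgue_on_bounded[OF oK bK])
  have ex: "\<exists>u\<in>Cs e. J u \<le> Mx" if e: "0 < e" for e
  proof -
    obtain u where u: "smooth u" "\<And>x. norm (grad u x) \<le> L" "\<And>y. y \<in> frontier K \<Longrightarrow> \<bar>u y - f y\<bar> \<le> e"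
      by (rule smooth_lipschitz_approximation[OF L lip fK e]) blast
    have "J u \<le> Mx" unfolding J_def energy_def Mx_def
    proof (rule integral_mono_AE)
      show "AE x in M. b x * (grad u x \<bullet> grad u x) \<le> b1 * L\<^sup>2"
        using bb
      proof eventually_elim
        case (elim x)
        have "grad u x \<bullet> grad u x \<le> L\<^sup>2"
          unfolding power2_norm_eq_inner[symmetric] using u(2)[of x] by (intro power_mono) auto
        then show ?case using elim b0 by (intro mult_mono) auto
      qed
    qed (use energy_integrable[OF gL gL] u(1) in auto)
    then show ?thesis using u unfolding Cs_def by blast
  qed
  have bdd: "bdd_below (J ` X)" for X by (rule bdd_belowI2[of _ 0]) (simp add: J_def energy_nonneg)
  have m_le: "m e \<le> J u" if "u \<in> Cs e" for u e
    unfolding m_def by (rule cInf_lower[OF _ bdd]) (use that in blast)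
  define \<epsilon> where "\<epsilon> n = inverse (real (Suc n))" for n
  have eps: "0 < \<epsilon> n" for n by (simp add: \<epsilon>_def)
  have eps_mono: "\<epsilon> k \<le> \<epsilon> n" if "n \<le> k" for n k using that by (simp add: \<epsilon>_def)
  have eps0: "\<epsilon> \<longlonglongrightarrow> 0" unfolding \<epsilon>_def[abs_def] by (rule LIMSEQ_inverse_real_of_nat)
  have Cs_mono: "Cs (\<epsilon> k) \<subseteq> Cs (\<epsilon> n)" if "n \<le> k" for n k
    using eps_mono[OF that] unfolding Cs_def by (auto intro: order_trans)
  define c where "c n = m (\<epsilon> n)" for n
  have c_mono: "c n \<le> c k" if "n \<le> k" for n k
    unfolding c_def m_def using ex[OF eps] Cs_mono[OF that]
    by (intro cInf_superset_mono bdd image_mono) auto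
  have c_le: "c n \<le> Mx" for n
    unfolding c_def using ex[OF eps[of n]] m_le by (meson order_trans)
  have "\<exists>u. u \<in> Cs (\<epsilon> n) \<and> J u < c n + \<epsilon> n" for n
  proof -
    have ne: "J ` Cs (\<epsilon> n) \<noteq> {}" using ex[OF eps[of n]] by blast
    have lt: "Inf (J ` Cs (\<epsilon> n)) < c n + \<epsilon> n" using eps[of n] by (simp add: c_def m_def)
    from cInf_lessD[OF ne lt] show ?thesis by (elim bexE imageE) blast
  qed
  then have "\<exists>u. \<forall>n. u n \<in> Cs (\<epsilon> n) \<and> J (u n) < c n + \<epsilon> n" by (intro choice allI)
  then obtain u where uC: "\<And>n. u n \<in> Cs (\<epsilon> n)" and uJ: "\<And>n. J (u n) < c n + \<epsilon> n" by blast
  have su: "smooth (u n)" for n using uC[of n] by (simp add: Cs_def)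
  have ub: "\<bar>u n y - f y\<bar> \<le> \<epsilon> n" if "y \<in> frontier K" for n y using uC[of n] that by (simp add: Cs_def)
  have sd: "smooth (\<lambda>x. u n x - u k x)" for n k by (intro smooth_diff su)
  have gd: "grad (\<lambda>x. u n x - u k x) = (\<lambda>x. grad (u n) x - grad (u k) x)" for n k
    by (rule ext, rule grad_diff[OF su su])
  \<comment> \<open>The midpoint of \<open>u n\<close> and \<open>u k\<close> is a competitor for
    the larger tolerance, so its energy is at least \<open>c n\<close>. Together with
    \<open>J (u n) < c n + \<epsilon> n\<close> and the same for \<open>k\<close>, the parallelogram
    identity leaves this bound.\<close>
  have Jd: "b0 * (\<integral>x. (norm (grad (u n) x - grad (u k) x))\<^sup>2 \<partial>M) \<le> 2 * (c k - c n) + 2 * \<epsilon> n + 2 * \<epsilon> k" if nk: "n \<le> k" for n k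
  proof -
    have arith: "2 * X + 2 * Y - 4 * Z \<le> 2 * (t' - t) + 2 * r + 2 * r'"
      if "t \<le> Z" "X < t + r" "Y < t' + r'" for X Y Z t t' r r' :: real
      using that by argo
    let ?h = "\<lambda>x. (1/2) * (u n x + u k x)"
    have sh: "smooth ?h" by (intro smooth_mult smooth_const smooth_add su)
    have gh: "grad ?h = (\<lambda>x. (1/2) *\<^sub>R (grad (u n) x + grad (u k) x))"
      using grad_cmult[OF smooth_add[OF su su], of "1/2" n k] grad_add[OF su su, of n k] by (simp add: fun_eq_iff)
    have "?h \<in> Cs (\<epsilon> n)"
    proof -
      have "\<bar>?h y - f y\<bar> \<le> \<epsilon> n" if y: "y \<in> frontier K" for y
        using ub[OF y, of n] ub[OF y, of k] eps_mono[OF nk] by (simp add: abs_le_iff field_simps)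
      then show ?thesis using sh unfolding Cs_def by blast
    qed
    then have "c n \<le> energy (\<lambda>x. (1/2) *\<^sub>R (grad (u n) x + grad (u k) x)) (\<lambda>x. (1/2) *\<^sub>R (grad (u n) x + grad (u k) x))"
      using m_le[of ?h "\<epsilon> n"] unfolding c_def J_def gh by simp
    then have "energy (\<lambda>x. grad (u n) x - grad (u k) x) (\<lambda>x. grad (u n) x - grad (u k) x)
        \<le> 2 * (c k - c n) + 2 * \<epsilon> n + 2 * \<epsilon> k"
      unfolding energy_parallelogram[OF gL[OF su] gL[OF su]] using uJ[of n] uJ[of k] unfolding J_def
      by (rule arith)
    then show ?thesis using energy_lower[OF L2_diff[OF gL[OF su] gL[OF su]], of n k] by linarith
  qed
  \<comment> \<open>The classes shrink with the tolerance, so the infima increase; bounded by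
    \<open>Mx\<close>, they converge and their differences become small.\<close>
  have "incseq c" using c_mono by (simp add: incseq_def)
  then obtain l where "c \<longlonglongrightarrow> l" using incseq_convergent[of c Mx] c_le by blast
  then have Cc: "Cauchy c" by (rule LIMSEQ_imp_Cauchy)
  have small: "\<exists>N. \<forall>n\<ge>N. \<forall>k\<ge>n. 2 * (c k - c n) + 2 * \<epsilon> n + 2 * \<epsilon> k < d" if d: "0 < d" for d
  proof -
    obtain N1 where N1: "\<And>n k. n \<ge> N1 \<Longrightarrow> k \<ge> N1 \<Longrightarrow> \<bar>c n - c k\<bar> < d / 6"
      using Cc d unfolding Cauchy_def dist_real_def by (metis divide_pos_pos zero_less_numeral)
    have "\<forall>\<^sub>F n in sequentially. \<epsilon> n < d / 6" by (rule order_tendstoD(2)[OF eps0]) (use d in simp)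
    then obtain N2 where N2: "\<And>n. n \<ge> N2 \<Longrightarrow> \<epsilon> n < d / 6" unfolding eventually_sequentially by blast
    show ?thesis
    proof (intro exI[of _ "max N1 N2"] allI impI)
      fix n k assume nk: "max N1 N2 \<le> n" "n \<le> k"
      have "c k - c n < d / 6" by (rule le_less_trans[OF abs_ge_self N1]) (use nk in auto)
      moreover have "\<epsilon> n < d / 6" "\<epsilon> k < d / 6" using N2[of n] N2[of k] nk by auto
      ultimately show "2 * (c k - c n) + 2 * \<epsilon> n + 2 * \<epsilon> k < d" by argo
    qed
  qed
  have gC: "\<exists>N. \<forall>n\<ge>N. \<forall>k\<ge>N. (\<integral>x. (norm (grad (u n) x - grad (u k) x))\<^sup>2 \<partial>M) < d" if d: "0 < d" for d
  proof -
    obtain N where N: "\<And>n k. n \<ge> N \<Longrightarrow> k \<ge> n \<Longrightarrow> 2 * (c k - c n) + 2 * \<epsilon> n + 2 * \<epsilon> k < b0 * d"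
      using small[of "b0 * d"] d b0 by auto
    have le: "(\<integral>x. (norm (grad (u n) x - grad (u k) x))\<^sup>2 \<partial>M) < d" if "n \<ge> N" "k \<ge> n" for n k
      using le_less_trans[OF Jd[OF that(2)] N[OF that]] b0 by simp
    show ?thesis
    proof (intro exI[of _ N] allI impI)
      fix n k assume "N \<le> n" "N \<le> k"
      then show "(\<integral>x. (norm (grad (u n) x - grad (u k) x))\<^sup>2 \<partial>M) < d"
        using le[of n k] le[of k n] by (cases "n \<le> k") (auto simp: norm_minus_commute)
    qed
  qed
  obtain a1 a2 a3 C where P: "(convex hull {a1, a2, a3}) facet_of closure K" "0 < C"
    "\<And>u. smooth u \<Longrightarrow> (\<integral>x. (norm (u x))\<^sup>2 \<partial>M) \<le> C * (\<integral>x. (norm (u x))\<^sup>2 \<partial>triangle_measure a1 a2 a3)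
        + C * (\<integral>x. (norm (grad u x))\<^sup>2 \<partial>M)"
    by (rule poincare) blast
  define A where "A = measure (triangle_measure a1 a2 a3) (convex hull {a1, a2, a3})"
  have A: "0 \<le> A" by (simp add: A_def)
  \<comment> \<open>Poincare's inequality needs only the gradients, which are Cauchy, and the values
    on one face, where both functions are within their tolerance of \<open>f\<close>.\<close>
  have uCauchy: "\<exists>N. \<forall>n\<ge>N. \<forall>k\<ge>N. (\<integral>x. (norm (u n x - u k x))\<^sup>2 \<partial>M) < d" if d: "0 < d" for d
  proof -
    obtain N1 where N1: "\<And>n k. n \<ge> N1 \<Longrightarrow> k \<ge> N1 \<Longrightarrow> (\<integral>x. (norm (grad (u n) x - grad (u k) x))\<^sup>2 \<partial>M) < d / (2 * C)"
      using gC[of "d / (2 * C)"] d P(2) by auto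
    have "(\<lambda>n. C * ((2 * \<epsilon> n)\<^sup>2 * A)) \<longlonglongrightarrow> C * ((2 * 0)\<^sup>2 * A)" by (intro tendsto_intros eps0)
    then have "\<forall>\<^sub>F n in sequentially. C * ((2 * \<epsilon> n)\<^sup>2 * A) < d / 2" by (rule order_tendstoD) (use d in simp)
    then obtain N2 where N2: "\<And>n. n \<ge> N2 \<Longrightarrow> C * ((2 * \<epsilon> n)\<^sup>2 * A) < d / 2" unfolding eventually_sequentially by blast
    show ?thesis
    proof (intro exI[of _ "max N1 N2"] allI impI)
      fix n k assume nk: "max N1 N2 \<le> n" "max N1 N2 \<le> k"
      define N where "N = min n k"
      have N: "N2 \<le> N" "N \<le> n" "N \<le> k" using nk by (auto simp: N_def)
      have bnd: "\<bar>u n x - u k x\<bar> \<le> 2 * \<epsilon> N" if "x \<in> convex hull {a1, a2, a3}" for x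
      proof -
        have "x \<in> frontier K" using facet_subset_frontier[OF T P(1)] that by blast
        then show ?thesis using ub[of x n] ub[of x k] eps_mono[OF N(2)] eps_mono[OF N(3)] by linarith
      qed
      have "(\<integral>x. (norm (u n x - u k x))\<^sup>2 \<partial>triangle_measure a1 a2 a3) \<le> (2 * \<epsilon> N)\<^sup>2 * A"
        unfolding A_def by (rule L2_triangle_continuous(2)[OF smooth_continuous[OF sd] bnd])
      then have "C * (\<integral>x. (norm (u n x - u k x))\<^sup>2 \<partial>triangle_measure a1 a2 a3) \<le> C * ((2 * \<epsilon> N)\<^sup>2 * A)"
        using P(2) by (intro mult_left_mono) auto
      moreover have "C * (\<integral>x. (norm (grad (u n) x - grad (u k) x))\<^sup>2 \<partial>M) \<le> d / 2"
        using N1[of n k] nk P(2) by (simp add: field_simps)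
      ultimately show "(\<integral>x. (norm (u n x - u k x))\<^sup>2 \<partial>M) < d"
        using P(3)[OF sd, of n k] N2[OF N(1)] unfolding gd by linarith
    qed
  qed
  obtain v where v: "L2_tendsto M u v"
    by (rule L2_complete[of M u, OF L2_smooth[OF oK bK su] uCauchy]) blast
  obtain G where G: "L2_tendsto M (\<lambda>n. grad (u n)) G"
    by (rule L2_complete[of M "\<lambda>n. grad (u n)", OF gL[OF su] gC]) blast
  have tr: "L2_tendsto (triangle_measure x1 x2 x3) u f" if F: "(convex hull {x1, x2, x3}) facet_of closure K" for x1 x2 x3
  proof -
    have "L-lipschitz_on UNIV f" by (rule lipschitz_onI) (use lip L in \<open>auto simp: dist_norm\<close>)
    then have cf: "continuous_on X f" for X
      using lipschitz_on_continuous_on continuous_on_subset by blast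
    let ?t = "triangle_measure x1 x2 x3"
    have le: "(\<integral>x. (norm (u n x - f x))\<^sup>2 \<partial>?t) \<le> (\<epsilon> n)\<^sup>2 * measure ?t (convex hull {x1, x2, x3})" for n
      using facet_subset_frontier[OF T F] ub
      by (intro L2_triangle_continuous(2) continuous_on_diff smooth_continuous su cf) auto
    have "(\<lambda>n. (\<epsilon> n)\<^sup>2 * measure ?t (convex hull {x1, x2, x3})) \<longlonglongrightarrow> 0\<^sup>2 * measure ?t (convex hull {x1, x2, x3})"
      by (intro tendsto_intros eps0)
    then have up: "(\<lambda>n. (\<epsilon> n)\<^sup>2 * measure ?t (convex hull {x1, x2, x3})) \<longlonglongrightarrow> 0" by simp
    have "(\<lambda>n. \<integral>x. (norm (u n x - f x))\<^sup>2 \<partial>?t) \<longlonglongrightarrow> 0"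
      by (rule tendsto_sandwich[OF _ _ tendsto_const up])
        (use le in \<open>auto intro!: always_eventually Bochner_Integration.integral_nonneg\<close>)
    then show ?thesis unfolding L2_tendsto_def using L2_triangle[OF smooth_continuous[OF su]] L2_triangle[OF cf] by blast
  qed
  have var: "energy G (grad \<phi>) = 0" if phi: "test_function K \<phi>" for \<phi>
  proof -
    have sphi: "smooth \<phi>" by (rule test_function_smooth[OF phi])
    \<comment> \<open>Adding multiples of \<phi> keeps the boundary values, so the perturbed energy
      is at least \<open>c n\<close>. In the limit the quadratic polynomial in \<open>t\<close> has
      constant term 0, and its discriminant bound forces the linear coefficient to vanish.\<close>
    have "(energy G (grad \<phi>))\<^sup>2 \<le> 0 * energy (grad \<phi>) (grad \<phi>)"
    proof (rule discriminant_le[OF _ energy_nonneg])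
      fix t :: real
      have ge: "0 \<le> \<epsilon> n + 2 * t * energy (grad (u n)) (grad \<phi>) + t\<^sup>2 * energy (grad \<phi>) (grad \<phi>)" for n
      proof -
        let ?w = "\<lambda>x. u n x + t * \<phi> x"
        have stp: "smooth (\<lambda>x. t * \<phi> x)" by (intro smooth_mult smooth_const sphi)
        have sw: "smooth ?w" by (rule smooth_add[OF su stp])
        have gw: "grad ?w = (\<lambda>x. grad (u n) x + t *\<^sub>R grad \<phi> x)"
          using grad_add[OF su stp, of n] grad_cmult[OF sphi] by (simp add: fun_eq_iff)
        have "\<phi> y = 0" if "y \<in> frontier K" for y
          using test_function_zero[OF phi] that oK by (metis frontier_disjoint_eq disjoint_iff)
        then have wC: "?w \<in> Cs (\<epsilon> n)" using sw ub unfolding Cs_def by simp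
        have "c n \<le> J (u n) + 2 * t * energy (grad (u n)) (grad \<phi>) + t\<^sup>2 * energy (grad \<phi>) (grad \<phi>)"
          using m_le[OF wC] unfolding c_def J_def gw energy_add_scaled[OF gL[OF su] gL[OF sphi]] .
        then show ?thesis using uJ[of n] by linarith
      qed
      have "(\<lambda>n. \<integral>x. (b x *\<^sub>R grad \<phi> x) \<bullet> grad (u n) x \<partial>M) \<longlonglongrightarrow> (\<integral>x. (b x *\<^sub>R grad \<phi> x) \<bullet> G x \<partial>M)"
        by (rule L2_tendsto_inner_right[OF G weight_L2[OF gL[OF sphi]]])
      then have lim: "(\<lambda>n. energy (grad (u n)) (grad \<phi>)) \<longlonglongrightarrow> energy G (grad \<phi>)"
        unfolding energy_def by (simp add: inner_commute)
      have "(\<lambda>n. \<epsilon> n + 2 * t * energy (grad (u n)) (grad \<phi>) + t\<^sup>2 * energy (grad \<phi>) (grad \<phi>))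
          \<longlonglongrightarrow> 0 + 2 * t * energy G (grad \<phi>) + t\<^sup>2 * energy (grad \<phi>) (grad \<phi>)"
        by (intro tendsto_intros eps0 lim)
      then show "0 \<le> 0 + 2 * t * energy G (grad \<phi>) + t\<^sup>2 * energy (grad \<phi>) (grad \<phi>)"
        by (rule LIMSEQ_le_const) (use ge in blast)
    qed
    then show ?thesis by simp
  qed
  show ?thesis by (rule that[OF su v G tr var])
qed

end

lemma L2_inner_bounded:
  fixes F W :: "'a \<Rightarrow> 'b::euclidean_space"
  assumes F: "L2 M F" and W: "W \<in> borel_measurable M" "\<And>x. norm (W x) \<le> B"
  shows "L2 M (\<lambda>x. W x \<bullet> F x)"
  unfolding L2_def
proof
  show m: "(\<lambda>x. W x \<bullet> F x) \<in> borel_measurable M" using W(1) L2_measurable[OF F] by measurable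
  show "integrable M (\<lambda>x. (norm (W x \<bullet> F x))\<^sup>2)"
  proof (rule Bochner_Integration.integrable_bound)
    show "integrable M (\<lambda>x. B\<^sup>2 * (norm (F x))\<^sup>2)" using L2_integrable[OF F] by simp
    show "AE x in M. norm ((norm (W x \<bullet> F x))\<^sup>2) \<le> norm (B\<^sup>2 * (norm (F x))\<^sup>2)"
    proof (rule AE_I2)
      fix x
      have "\<bar>W x \<bullet> F x\<bar> \<le> norm (W x) * norm (F x)" by (rule Cauchy_Schwarz_ineq2)
      also have "\<dots> \<le> B * norm (F x)" by (intro mult_right_mono W(2)) simp
      finally have "\<bar>W x \<bullet> F x\<bar>\<^sup>2 \<le> (B * norm (F x))\<^sup>2" by (intro power_mono) auto
      then show "norm ((norm (W x \<bullet> F x))\<^sup>2) \<le> norm (B\<^sup>2 * (norm (F x))\<^sup>2)" by (simp add: power_mult_distrib)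
    qed
  qed (use m in measurable)
qed

context weighted_tetrahedron
begin

lemma borel_imp_M: "f \<in> borel_measurable borel \<Longrightarrow> f \<in> borel_measurable M"
  by (intro measurable_restrict_space1 measurable_completion) simp

text \<open>With zero trace the face term of the layer estimate disappears, and the remaining factor
  \<open>\<delta>\<^sup>2\<close> is exactly what balances the squared gradient of a cutoff of width
  \<delta>.\<close>

lemma layer_limit:
  assumes u: "\<And>n. smooth (u n)" and e: "L2_tendsto M u e" and G: "L2_tendsto M (\<lambda>n. grad (u n)) G"
    and tr: "\<And>a1 a2 a3. (convex hull {a1, a2, a3}) facet_of closure K \<Longrightarrow> L2_tendsto (triangle_measure a1 a2 a3) u z"
    and z: "\<And>x. x \<in> frontier K \<Longrightarrow> z x = 0"
    and c: "corner a b' c d p q K" and F: "(convex hull {a, b', c}) facet_of closure K"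
  obtains C where "0 < C" "\<And>\<delta>. 0 < \<delta> \<Longrightarrow> \<delta> \<le> 1 \<Longrightarrow>
    (\<integral>x. indicator {x \<in> K. p \<bullet> x + q < \<delta>} x * (norm (e x))\<^sup>2 \<partial>M)
      \<le> C * \<delta>\<^sup>2 * (\<integral>x. indicator {x \<in> K. p \<bullet> x + q < \<delta>} x * (norm (G x))\<^sup>2 \<partial>M)"
proof -
  obtain C where C: "0 < C"
    "\<And>u v G g \<delta>. (\<And>n. smooth (u n)) \<Longrightarrow> L2_tendsto M u v \<Longrightarrow>
      L2_tendsto M (\<lambda>n. grad (u n)) G \<Longrightarrow> L2_tendsto (triangle_measure a b' c) u g \<Longrightarrow>
      0 < \<delta> \<Longrightarrow> \<delta> \<le> 1 \<Longrightarrow>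
      (\<integral>x. indicator {x \<in> K. p \<bullet> x + q < \<delta>} x * (norm (v x))\<^sup>2 \<partial>M)
      \<le> C * \<delta> * (\<integral>x. (norm (g x))\<^sup>2 \<partial>triangle_measure a b' c)
        + C * \<delta>\<^sup>2 * (\<integral>x. indicator {x \<in> K. p \<bullet> x + q < \<delta>} x * (norm (G x))\<^sup>2 \<partial>M)"
    by (rule corner.layer_estimate[OF c bK]) blast
  have "(\<integral>x. (norm (z x))\<^sup>2 \<partial>triangle_measure a b' c) = (\<integral>x. 0 \<partial>triangle_measure a b' c)"
    using z facet_subset_frontier[OF T F]
    by (intro Bochner_Integration.integral_cong) (auto simp: space_triangle_measure)
  then have z0: "(\<integral>x. (norm (z x))\<^sup>2 \<partial>triangle_measure a b' c) = 0" by simp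
  show ?thesis
  proof (rule that[OF C(1)])
    fix \<delta> :: real assume d: "0 < \<delta>" "\<delta> \<le> 1"
    show "(\<integral>x. indicator {x \<in> K. p \<bullet> x + q < \<delta>} x * (norm (e x))\<^sup>2 \<partial>M)
      \<le> C * \<delta>\<^sup>2 * (\<integral>x. indicator {x \<in> K. p \<bullet> x + q < \<delta>} x * (norm (G x))\<^sup>2 \<partial>M)"
      using C(2)[OF u e G tr[OF F] d] unfolding z0 by simp
  qed
qed

text \<open>\<open>e\<close> need not be smooth, so the equation is tested with \<psi> times
  \<open>u n\<close>, which is a test function. The product rule splits the gradient into two terms,
  and both pass to the limit.\<close>

lemma cutoff_energy:
  assumes u: "\<And>n. smooth (u n)" and e: "L2_tendsto M u e" and G: "L2_tendsto M (\<lambda>n. grad (u n)) G"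
    and weak: "\<And>\<phi>. test_function K \<phi> \<Longrightarrow> energy G (grad \<phi>) = 0"
    and chi: "test_function K \<psi>" "\<And>x. \<bar>\<psi> x\<bar> \<le> 1" "\<And>x. norm (grad \<psi> x) \<le> B"
  shows "(\<integral>x. b x * \<psi> x * (norm (G x))\<^sup>2 \<partial>M) = - (\<integral>x. b x * e x * (grad \<psi> x \<bullet> G x) \<partial>M)"
    "integrable M (\<lambda>x. b x * e x * (grad \<psi> x \<bullet> G x))"
proof -
  have sc: "smooth \<psi>" by (rule test_function_smooth[OF chi(1)])
  note LG = L2_tendstoD(2)[OF G] and Le = L2_tendstoD(2)[OF e]
  have mchi: "\<psi> \<in> borel_measurable M" by (rule borel_imp_M[OF smooth_measurable[OF sc]])
  have mg: "grad \<psi> \<in> borel_measurable M"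
    by (rule borel_imp_M[OF borel_measurable_continuous_onI[OF smooth_grad_continuous[OF sc]]])
  have L1: "L2 M (\<lambda>x. \<psi> x *\<^sub>R (b x *\<^sub>R G x))"
    by (rule L2_bounded_mult[OF weight_L2[OF LG] mchi, of 1]) (use chi(2) in simp)
  have L2': "L2 M (\<lambda>x. grad \<psi> x \<bullet> (b x *\<^sub>R G x))"
    by (rule L2_inner_bounded[OF weight_L2[OF LG] mg chi(3)])
  have eqn: "(\<integral>x. (\<psi> x *\<^sub>R (b x *\<^sub>R G x)) \<bullet> grad (u n) x \<partial>M) + (\<integral>x. (grad \<psi> x \<bullet> (b x *\<^sub>R G x)) \<bullet> u n x \<partial>M) = 0" for n
  proof -
    have "0 = energy G (grad (\<lambda>x. \<psi> x * u n x))" using weak[OF test_function_mult[OF chi(1) u]] by simp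
    also have "\<dots> = (\<integral>x. (\<psi> x *\<^sub>R (b x *\<^sub>R G x)) \<bullet> grad (u n) x + (grad \<psi> x \<bullet> (b x *\<^sub>R G x)) \<bullet> u n x \<partial>M)"
      unfolding energy_def by (intro Bochner_Integration.integral_cong)
        (auto simp: grad_mult[OF sc u] inner_add_right inner_commute algebra_simps)
    also have "\<dots> = (\<integral>x. (\<psi> x *\<^sub>R (b x *\<^sub>R G x)) \<bullet> grad (u n) x \<partial>M) + (\<integral>x. (grad \<psi> x \<bullet> (b x *\<^sub>R G x)) \<bullet> u n x \<partial>M)"
      by (intro Bochner_Integration.integral_add L2_inner_integrable L1 L2' L2_tendstoD(1)[OF G] L2_tendstoD(1)[OF e])
    finally show ?thesis by simp
  qed
  have "(\<lambda>n. (\<integral>x. (\<psi> x *\<^sub>R (b x *\<^sub>R G x)) \<bullet> grad (u n) x \<partial>M) + (\<integral>x. (grad \<psi> x \<bullet> (b x *\<^sub>R G x)) \<bullet> u n x \<partial>M))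
     \<longlonglongrightarrow> (\<integral>x. (\<psi> x *\<^sub>R (b x *\<^sub>R G x)) \<bullet> G x \<partial>M) + (\<integral>x. (grad \<psi> x \<bullet> (b x *\<^sub>R G x)) \<bullet> e x \<partial>M)"
    by (intro tendsto_add L2_tendsto_inner_right[OF G L1] L2_tendsto_inner_right[OF e L2'])
  then have lim: "(\<integral>x. (\<psi> x *\<^sub>R (b x *\<^sub>R G x)) \<bullet> G x \<partial>M) + (\<integral>x. (grad \<psi> x \<bullet> (b x *\<^sub>R G x)) \<bullet> e x \<partial>M) = 0"
    unfolding eqn by (simp add: LIMSEQ_const_iff)
  have 1: "(\<lambda>x. (\<psi> x *\<^sub>R (b x *\<^sub>R G x)) \<bullet> G x) = (\<lambda>x. b x * \<psi> x * (norm (G x))\<^sup>2)"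
    by (auto simp: power2_norm_eq_inner mult_ac)
  have 2: "(\<lambda>x. (grad \<psi> x \<bullet> (b x *\<^sub>R G x)) \<bullet> e x) = (\<lambda>x. b x * e x * (grad \<psi> x \<bullet> G x))"
    by (auto simp: mult_ac)
  show "(\<integral>x. b x * \<psi> x * (norm (G x))\<^sup>2 \<partial>M) = - (\<integral>x. b x * e x * (grad \<psi> x \<bullet> G x) \<partial>M)"
    using lim unfolding 1 2 by linarith
  show "integrable M (\<lambda>x. b x * e x * (grad \<psi> x \<bullet> G x))"
    using L2_inner_integrable[OF L2' Le] unfolding 2 .
qed

text \<open>Testing the equation with \<open>\<psi> u\<close>, where the cutoff \<open>\<psi>\<close> varies only in the layer of width
  \<open>\<epsilon>\<close>, leaves an error bounded by the energy in that layer, which vanishes as \<open>\<epsilon> \<rightarrow> 0\<close>.\<close>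

lemma energy_zero:
  assumes u: "\<And>n. smooth (u n)" and e: "L2_tendsto M u e" and G: "L2_tendsto M (\<lambda>n. grad (u n)) G"
    and tr: "\<And>a1 a2 a3. (convex hull {a1, a2, a3}) facet_of closure K \<Longrightarrow> L2_tendsto (triangle_measure a1 a2 a3) u z"
    and z: "\<And>x. x \<in> frontier K \<Longrightarrow> z x = 0"
    and weak: "\<And>\<phi>. test_function K \<phi> \<Longrightarrow> energy G (grad \<phi>) = 0"
  shows "AE x in M. e x = 0"
proof -
  obtain P where P: "finite P" "K = halfspaces P"
    "\<And>p q. (p, q) \<in> P \<Longrightarrow> \<exists>a b c d. corner a b c d p q K \<and> (convex hull {a, b, c}) facet_of closure K"
    by (rule tetrahedron_halfspaces[OF T]) blast
  note LG = L2_tendstoD(2)[OF G] and Le = L2_tendstoD(2)[OF e]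
  define Ly where "Ly w \<delta> = {x \<in> K. fst w \<bullet> x + snd w < \<delta>}" for w :: "R3 \<times> real" and \<delta>
  have LyB: "Ly w \<delta> \<in> sets borel" for w \<delta>
  proof -
    have "open (Ly w \<delta>)" unfolding Ly_def
      using oK by (intro open_Collect_conj open_Collect_less continuous_intros) (simp add: Collect_mem_eq)
    then show ?thesis by simp
  qed
  have "\<exists>C>0. \<forall>\<delta>. 0 < \<delta> \<longrightarrow> \<delta> \<le> 1 \<longrightarrow> (\<integral>x. indicator (Ly w \<delta>) x * (norm (e x))\<^sup>2 \<partial>M)
      \<le> C * \<delta>\<^sup>2 * (\<integral>x. indicator (Ly w \<delta>) x * (norm (G x))\<^sup>2 \<partial>M)" if w: "w \<in> P" for w
  proof -
    obtain p q where pq: "w = (p, q)" by (cases w)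
    obtain a b' c d where crn: "corner a b' c d p q K" "(convex hull {a, b', c}) facet_of closure K"
      using P(3) w unfolding pq by blast
    obtain C where "0 < C" "\<And>\<delta>. 0 < \<delta> \<Longrightarrow> \<delta> \<le> 1 \<Longrightarrow>
      (\<integral>x. indicator {x \<in> K. p \<bullet> x + q < \<delta>} x * (norm (e x))\<^sup>2 \<partial>M)
      \<le> C * \<delta>\<^sup>2 * (\<integral>x. indicator {x \<in> K. p \<bullet> x + q < \<delta>} x * (norm (G x))\<^sup>2 \<partial>M)"
      by (rule layer_limit[OF u e G tr z crn]) blast+
    then show ?thesis unfolding Ly_def pq fst_conv snd_conv by blast
  qed
  then have "\<exists>C. \<forall>w\<in>P. 0 < C w \<and> (\<forall>\<delta>. 0 < \<delta> \<longrightarrow> \<delta> \<le> 1 \<longrightarrow> (\<integral>x. indicator (Ly w \<delta>) x * (norm (e x))\<^sup>2 \<partial>M)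
      \<le> C w * \<delta>\<^sup>2 * (\<integral>x. indicator (Ly w \<delta>) x * (norm (G x))\<^sup>2 \<partial>M))" by (intro bchoice ballI) blast
  then obtain C where C: "\<And>w. w \<in> P \<Longrightarrow> 0 < C w" "\<And>w \<delta>. w \<in> P \<Longrightarrow> 0 < \<delta> \<Longrightarrow> \<delta> \<le> 1 \<Longrightarrow>
      (\<integral>x. indicator (Ly w \<delta>) x * (norm (e x))\<^sup>2 \<partial>M) \<le> C w * \<delta>\<^sup>2 * (\<integral>x. indicator (Ly w \<delta>) x * (norm (G x))\<^sup>2 \<partial>M)"
    by blast
  define Q where "Q = (\<Sum>w\<in>P. C w)"
  have Q: "0 \<le> Q" unfolding Q_def using C(1) by (intro sum_nonneg) (auto intro: less_imp_le)
  obtain H where H: "H \<ge> 0"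
    "\<And>P \<epsilon> x. finite P \<Longrightarrow> 0 < \<epsilon> \<Longrightarrow> norm (grad (cutoff P \<epsilon>) x) \<le> H / \<epsilon> * (\<Sum>(p, q)\<in>P. norm p)"
    "\<And>P \<epsilon> x. finite P \<Longrightarrow> 0 < \<epsilon> \<Longrightarrow> (\<And>p q. (p, q) \<in> P \<Longrightarrow> 2 * \<epsilon> < p \<bullet> x + q) \<Longrightarrow> grad (cutoff P \<epsilon>) x = 0"
    using cutoff_grad by blast
  define A where "A = H * (\<Sum>(p, q)\<in>P. norm p)"
  have A: "0 \<le> A" unfolding A_def using H(1) by (intro mult_nonneg_nonneg sum_nonneg) auto
  have gb: "norm (grad (cutoff P \<epsilon>) x) \<le> A / \<epsilon>" if "0 < \<epsilon>" for \<epsilon> x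
    using H(2)[OF P(1) that, of x] by (simp add: A_def)
  \<comment> \<open>The gradient of the cutoff is known to vanish where all forms strictly exceed
    2\<epsilon>; layers of width 3\<epsilon> contain the rest of \<open>K\<close> with room to
    spare.\<close>
  define U where "U \<epsilon> = (\<Union>w\<in>P. Ly w (3 * \<epsilon>))" for \<epsilon>
  have UB: "U \<epsilon> \<in> sets borel" for \<epsilon> unfolding U_def using P(1) LyB by auto
  have indM: "(indicator X :: R3 \<Rightarrow> real) \<in> borel_measurable M" if "X \<in> sets borel" for X
    using that by (intro borel_imp_M) simp
  have ii: "integrable M (\<lambda>x. indicator X x * (norm (F x))\<^sup>2)"
    if "X \<in> sets borel" "L2 M F" for X and F :: "R3 \<Rightarrow> 'z::euclidean_space"
  proof -
    have "integrable M (\<lambda>x. (indicator X x *\<^sub>R F x) \<bullet> F x)"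
      by (intro L2_inner_integrable L2_bounded_mult[OF that(2) indM[OF that(1)], of 1] that(2)) (auto simp: indicator_def)
    then show ?thesis by (simp add: power2_norm_eq_inner)
  qed
  \<comment> \<open>The constant is free of \<epsilon>: the cutoff gradient is at most
    \<open>A / \<epsilon>\<close>, and the layer estimates at width 3\<epsilon> give
    \<open>9 * \<epsilon>\<^sup>2 * Q\<close>, so the powers of \<epsilon> cancel.\<close>
  have main: "b0 * (\<integral>x. cutoff P \<epsilon> x * (norm (G x))\<^sup>2 \<partial>M)
      \<le> (\<bar>b1\<bar> * A * (9 * Q + 1)) * (\<integral>x. indicator (U \<epsilon>) x * (norm (G x))\<^sup>2 \<partial>M)"
    if eps: "0 < \<epsilon>" "3 * \<epsilon> \<le> 1" for \<epsilon>
  proof -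
    let ?\<psi> = "cutoff P \<epsilon>"
    have chi: "test_function K ?\<psi>" unfolding P(2)
      by (rule test_function_cutoff[OF P(1) _ eps(1)]) (use bK P(2) in simp)
    have chi1: "\<bar>?\<psi> x\<bar> \<le> 1" for x using cutoff_bounds[of P \<epsilon> x] by simp
    note ce = cutoff_energy[OF u e G weak chi chi1 gb[OF eps(1)]]
    have sc: "smooth ?\<psi>" by (rule smooth_cutoff)
    have mchi: "?\<psi> \<in> borel_measurable M" by (rule borel_imp_M[OF smooth_measurable[OF sc]])
    have i1: "integrable M (\<lambda>x. ?\<psi> x * (norm (G x))\<^sup>2)"
    proof -
      have "integrable M (\<lambda>x. (?\<psi> x *\<^sub>R G x) \<bullet> G x)"
        by (intro L2_inner_integrable L2_bounded_mult[OF LG mchi, of 1] LG) (use chi1 in simp)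
      then show ?thesis by (simp add: power2_norm_eq_inner)
    qed
    have i2: "integrable M (\<lambda>x. b x * ?\<psi> x * (norm (G x))\<^sup>2)"
    proof -
      have "integrable M (\<lambda>x. (?\<psi> x *\<^sub>R (b x *\<^sub>R G x)) \<bullet> G x)"
        by (intro L2_inner_integrable L2_bounded_mult[OF weight_L2[OF LG] mchi, of 1] LG) (use chi1 in simp)
      then show ?thesis by (simp add: power2_norm_eq_inner mult_ac)
    qed
    have zero: "grad ?\<psi> x = 0" if "x \<in> K" "x \<notin> U \<epsilon>" for x
    proof (rule H(3)[OF P(1) eps(1)])
      fix p q assume "(p, q) \<in> P"
      then have "\<not> p \<bullet> x + q < 3 * \<epsilon>" using that unfolding U_def Ly_def by force
      then show "2 * \<epsilon> < p \<bullet> x + q" using eps(1) by linarith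
    qed
    have Ue: "(\<integral>x. indicator (U \<epsilon>) x * (norm (e x))\<^sup>2 \<partial>M) \<le> 9 * \<epsilon>\<^sup>2 * Q * (\<integral>x. indicator (U \<epsilon>) x * (norm (G x))\<^sup>2 \<partial>M)"
    proof -
      have "(\<integral>x. indicator (U \<epsilon>) x * (norm (e x))\<^sup>2 \<partial>M) \<le> (\<integral>x. (\<Sum>w\<in>P. indicator (Ly w (3 * \<epsilon>)) x * (norm (e x))\<^sup>2) \<partial>M)"
      proof (rule integral_mono)
        show "integrable M (\<lambda>x. \<Sum>w\<in>P. indicator (Ly w (3 * \<epsilon>)) x * (norm (e x))\<^sup>2)"
          by (intro Bochner_Integration.integrable_sum ii LyB Le)
        fix x
        show "indicator (U \<epsilon>) x * (norm (e x))\<^sup>2 \<le> (\<Sum>w\<in>P. indicator (Ly w (3 * \<epsilon>)) x * (norm (e x))\<^sup>2)"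
        proof (cases "x \<in> U \<epsilon>")
          case True
          then obtain w where w: "w \<in> P" "x \<in> Ly w (3 * \<epsilon>)" unfolding U_def by blast
          have "indicator (Ly w (3 * \<epsilon>)) x * (norm (e x))\<^sup>2 \<le> (\<Sum>w\<in>P. indicator (Ly w (3 * \<epsilon>)) x * (norm (e x))\<^sup>2)"
            by (rule member_le_sum[OF w(1) _ P(1)]) simp
          then show ?thesis using True w(2) by simp
        qed (simp add: sum_nonneg)
      qed (rule ii[OF UB Le])
      also have "\<dots> = (\<Sum>w\<in>P. \<integral>x. indicator (Ly w (3 * \<epsilon>)) x * (norm (e x))\<^sup>2 \<partial>M)"
        by (intro Bochner_Integration.integral_sum ii LyB Le)
      also have "\<dots> \<le> (\<Sum>w\<in>P. C w * (9 * \<epsilon>\<^sup>2 * (\<integral>x. indicator (U \<epsilon>) x * (norm (G x))\<^sup>2 \<partial>M)))"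
      proof (rule sum_mono)
        fix w assume w: "w \<in> P"
        have "(\<integral>x. indicator (Ly w (3 * \<epsilon>)) x * (norm (G x))\<^sup>2 \<partial>M) \<le> (\<integral>x. indicator (U \<epsilon>) x * (norm (G x))\<^sup>2 \<partial>M)"
          by (rule integral_mono[OF ii[OF LyB LG] ii[OF UB LG]])
            (use w in \<open>auto simp: U_def indicator_def\<close>)
        then have "C w * (3 * \<epsilon>)\<^sup>2 * (\<integral>x. indicator (Ly w (3 * \<epsilon>)) x * (norm (G x))\<^sup>2 \<partial>M)
            \<le> C w * (3 * \<epsilon>)\<^sup>2 * (\<integral>x. indicator (U \<epsilon>) x * (norm (G x))\<^sup>2 \<partial>M)"
          using C(1)[OF w] by (intro mult_left_mono) auto
        then show "(\<integral>x. indicator (Ly w (3 * \<epsilon>)) x * (norm (e x))\<^sup>2 \<partial>M)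
            \<le> C w * (9 * \<epsilon>\<^sup>2 * (\<integral>x. indicator (U \<epsilon>) x * (norm (G x))\<^sup>2 \<partial>M))"
          using C(2)[OF w, of "3 * \<epsilon>"] eps by (simp add: power_mult_distrib mult_ac)
      qed
      also have "\<dots> = 9 * \<epsilon>\<^sup>2 * Q * (\<integral>x. indicator (U \<epsilon>) x * (norm (G x))\<^sup>2 \<partial>M)"
        by (simp add: Q_def sum_distrib_right[symmetric] mult_ac)
      finally show ?thesis .
    qed
    have pw: "AE x in M. - (b x * e x * (grad ?\<psi> x \<bullet> G x))
        \<le> \<bar>b1\<bar> * A * (1 / \<epsilon>\<^sup>2 * (indicator (U \<epsilon>) x * (norm (e x))\<^sup>2) + indicator (U \<epsilon>) x * (norm (G x))\<^sup>2)"
      using b_abs AE_space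
    proof eventually_elim
      case (elim x)
      have xK: "x \<in> K" using elim(2) by simp
      show ?case
      proof (cases "x \<in> U \<epsilon>")
        case False
        then show ?thesis using zero[OF xK] by simp
      next
        case True
        have "\<bar>grad ?\<psi> x \<bullet> G x\<bar> \<le> A / \<epsilon> * norm (G x)"
          by (rule order_trans[OF Cauchy_Schwarz_ineq2 mult_right_mono[OF gb[OF eps(1)]]]) simp
        then have "\<bar>b x\<bar> * (\<bar>e x\<bar> * \<bar>grad ?\<psi> x \<bullet> G x\<bar>) \<le> \<bar>b1\<bar> * (\<bar>e x\<bar> * (A / \<epsilon> * norm (G x)))"
          using elim(1) by (intro mult_mono mult_left_mono) auto
        also have "\<dots> = \<bar>b1\<bar> * A * (\<bar>e x\<bar> / \<epsilon> * norm (G x))" by simp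
        also have "\<dots> \<le> \<bar>b1\<bar> * A * ((\<bar>e x\<bar> / \<epsilon>)\<^sup>2 + (norm (G x))\<^sup>2)"
        proof (rule mult_left_mono)
          have "0 \<le> \<bar>e x\<bar> / \<epsilon> * norm (G x)" using eps(1) by simp
          moreover have "2 * (\<bar>e x\<bar> / \<epsilon> * norm (G x)) \<le> (\<bar>e x\<bar> / \<epsilon>)\<^sup>2 + (norm (G x))\<^sup>2"
            using sum_squares_bound[of "\<bar>e x\<bar> / \<epsilon>" "norm (G x)"] by (simp only: mult.assoc)
          ultimately show "\<bar>e x\<bar> / \<epsilon> * norm (G x) \<le> (\<bar>e x\<bar> / \<epsilon>)\<^sup>2 + (norm (G x))\<^sup>2" by linarith
        qed (use A in simp)
        finally have "\<bar>b x * e x * (grad ?\<psi> x \<bullet> G x)\<bar> \<le> \<bar>b1\<bar> * A * ((\<bar>e x\<bar> / \<epsilon>)\<^sup>2 + (norm (G x))\<^sup>2)"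
          by (simp add: abs_mult mult.assoc)
        then show ?thesis using True by (simp add: power_divide)
      qed
    qed
    have "b0 * (\<integral>x. ?\<psi> x * (norm (G x))\<^sup>2 \<partial>M) = (\<integral>x. b0 * (?\<psi> x * (norm (G x))\<^sup>2) \<partial>M)" by simp
    also have "\<dots> \<le> (\<integral>x. b x * ?\<psi> x * (norm (G x))\<^sup>2 \<partial>M)"
    proof (rule integral_mono_AE[OF _ i2])
      show "AE x in M. b0 * (?\<psi> x * (norm (G x))\<^sup>2) \<le> b x * ?\<psi> x * (norm (G x))\<^sup>2"
        using bb by eventually_elim (use cutoff_bounds in \<open>auto simp: mult.assoc intro!: mult_right_mono mult_nonneg_nonneg\<close>)
    qed (use i1 in simp)
    also have "\<dots> = (\<integral>x. - (b x * e x * (grad ?\<psi> x \<bullet> G x)) \<partial>M)" using ce(1) by simp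
    also have "\<dots> \<le> (\<integral>x. \<bar>b1\<bar> * A * (1 / \<epsilon>\<^sup>2 * (indicator (U \<epsilon>) x * (norm (e x))\<^sup>2) + indicator (U \<epsilon>) x * (norm (G x))\<^sup>2) \<partial>M)"
    proof (rule integral_mono_AE[OF _ _ pw])
      show "integrable M (\<lambda>x. - (b x * e x * (grad ?\<psi> x \<bullet> G x)))" using ce(2) by simp
      show "integrable M (\<lambda>x. \<bar>b1\<bar> * A * (1 / \<epsilon>\<^sup>2 * (indicator (U \<epsilon>) x * (norm (e x))\<^sup>2) + indicator (U \<epsilon>) x * (norm (G x))\<^sup>2))"
        by (intro integrable_mult_right Bochner_Integration.integrable_add ii UB LG Le)
    qed
    also have "\<dots> = \<bar>b1\<bar> * A * (1 / \<epsilon>\<^sup>2 * (\<integral>x. indicator (U \<epsilon>) x * (norm (e x))\<^sup>2 \<partial>M)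
        + (\<integral>x. indicator (U \<epsilon>) x * (norm (G x))\<^sup>2 \<partial>M))"
    proof -
      have "(\<integral>x. r * (s * X x + Y x) \<partial>M) = r * (s * (\<integral>x. X x \<partial>M) + (\<integral>x. Y x \<partial>M))"
        if "integrable M X" "integrable M Y" for X Y :: "R3 \<Rightarrow> real" and r s :: real
        using that by simp
      from this[OF ii[OF UB Le] ii[OF UB LG]] show ?thesis .
    qed
    also have "\<dots> \<le> \<bar>b1\<bar> * A * (1 / \<epsilon>\<^sup>2 * (9 * \<epsilon>\<^sup>2 * Q * (\<integral>x. indicator (U \<epsilon>) x * (norm (G x))\<^sup>2 \<partial>M))
        + (\<integral>x. indicator (U \<epsilon>) x * (norm (G x))\<^sup>2 \<partial>M))"
      using A by (intro mult_left_mono add_right_mono Ue) auto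
    also have "\<dots> = (\<bar>b1\<bar> * A * (9 * Q + 1)) * (\<integral>x. indicator (U \<epsilon>) x * (norm (G x))\<^sup>2 \<partial>M)"
      using eps(1) by (simp add: algebra_simps)
    finally show ?thesis .
  qed
  define h where "h n = inverse (real (Suc n))" for n
  have h: "0 < h n" for n by (simp add: h_def)
  have h0: "h \<longlonglongrightarrow> 0" unfolding h_def[abs_def] by (rule LIMSEQ_inverse_real_of_nat)
  note iG = L2_integrable[OF LG]
  have mG: "(\<lambda>x. (norm (G x))\<^sup>2) \<in> borel_measurable M" using L2_measurable[OF LG] by measurable
  have lim1: "(\<lambda>n. \<integral>x. cutoff P (h n) x * (norm (G x))\<^sup>2 \<partial>M) \<longlonglongrightarrow> (\<integral>x. (norm (G x))\<^sup>2 \<partial>M)"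
  proof (rule integral_dominated_convergence[OF mG _ iG])
    show "(\<lambda>x. cutoff P (h n) x * (norm (G x))\<^sup>2) \<in> borel_measurable M" for n
      by (intro borel_measurable_times borel_imp_M smooth_measurable smooth_cutoff mG)
    show "AE x in M. (\<lambda>n. cutoff P (h n) x * (norm (G x))\<^sup>2) \<longlonglongrightarrow> (norm (G x))\<^sup>2"
      using AE_space
    proof eventually_elim
      case (elim x)
      then have "x \<in> halfspaces P" using P(2) by simp
      from tendsto_mult_right[OF cutoff_tendsto_1[OF P(1) this], of "(norm (G x))\<^sup>2"]
      show ?case by (simp add: h_def)
    qed
    show "AE x in M. norm (cutoff P (h n) x * (norm (G x))\<^sup>2) \<le> (norm (G x))\<^sup>2" for n
      using cutoff_bounds by (intro AE_I2) (auto simp: abs_mult mult_left_le_one_le)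
  qed
  \<comment> \<open>Every point of the open set \<open>K\<close> has a positive margin in all forms
    and so leaves the layers eventually; dominated convergence does the rest.\<close>
  have lim2: "(\<lambda>n. \<integral>x. indicator (U (h n)) x * (norm (G x))\<^sup>2 \<partial>M) \<longlonglongrightarrow> (\<integral>x. 0 \<partial>M)"
  proof (rule integral_dominated_convergence[OF _ _ iG])
    show "(\<lambda>x. indicator (U (h n)) x * (norm (G x))\<^sup>2) \<in> borel_measurable M" for n
      by (intro borel_measurable_times indM UB mG)
    show "AE x in M. (\<lambda>n. indicator (U (h n)) x * (norm (G x))\<^sup>2) \<longlonglongrightarrow> 0"
      using AE_space
    proof eventually_elim
      case (elim x)
      then have "x \<in> halfspaces P" using P(2) by simp
      then obtain d where d: "0 < d" "\<And>p q. (p, q) \<in> P \<Longrightarrow> d \<le> p \<bullet> x + q"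
        by (rule halfspaces_margin[OF P(1)]) blast
      have "\<forall>\<^sub>F n in sequentially. h n < d / 3" by (rule order_tendstoD(2)[OF h0]) (use d in simp)
      then have "\<forall>\<^sub>F n in sequentially. indicator (U (h n)) x * (norm (G x))\<^sup>2 = 0"
      proof eventually_elim
        case (elim n)
        have "x \<notin> U (h n)" unfolding U_def Ly_def using elim d(2) by fastforce
        then show ?case by simp
      qed
      then show ?case by (rule tendsto_eventually)
    qed
    show "AE x in M. norm (indicator (U (h n)) x * (norm (G x))\<^sup>2) \<le> (norm (G x))\<^sup>2" for n
      by (intro AE_I2) (auto simp: indicator_def)
  qed simp
  have "b0 * (\<integral>x. (norm (G x))\<^sup>2 \<partial>M) \<le> (\<bar>b1\<bar> * A * (9 * Q + 1)) * (\<integral>x. 0 \<partial>M)"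
  proof (rule LIMSEQ_le[OF tendsto_mult_left[OF lim1] tendsto_mult_left[OF lim2]], intro exI allI impI)
    fix n :: nat assume "2 \<le> n"
    \<comment> \<open>\<open>h 2\<close> is 1/3; the layer estimates require widths at most
      1.\<close>
    then have "3 * h n \<le> 1" by (simp add: h_def field_simps)
    then show "b0 * (\<integral>x. cutoff P (h n) x * (norm (G x))\<^sup>2 \<partial>M)
       \<le> (\<bar>b1\<bar> * A * (9 * Q + 1)) * (\<integral>x. indicator (U (h n)) x * (norm (G x))\<^sup>2 \<partial>M)"
      by (rule main[OF h])
  qed
  then have "(\<integral>x. (norm (G x))\<^sup>2 \<partial>M) \<le> 0" using b0 by (simp add: mult_le_0_iff)
  moreover have "0 \<le> (\<integral>x. (norm (G x))\<^sup>2 \<partial>M)" by simp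
  ultimately have G0: "(\<integral>x. (norm (G x))\<^sup>2 \<partial>M) = 0" by linarith
  \<comment> \<open>The gradient is now zero almost everywhere. The layer estimate of any one face
    at width 1, with zero trace, then makes \<open>e\<close> vanish too.\<close>
  have "card S = 4" using T unfolding tetrahedron_def by blast
  then obtain a b' c d where S: "S = {a, b', c, d}" "distinct [a, b', c, d]" by (rule card_4_obtain)
  obtain p q where crn: "corner a b' c d p q K" by (rule tetrahedron_corner[OF T[unfolded S(1)] S(2)])
  obtain C' where C': "0 < C'" "\<And>\<delta>. 0 < \<delta> \<Longrightarrow> \<delta> \<le> 1 \<Longrightarrow>
      (\<integral>x. indicator {x \<in> K. p \<bullet> x + q < \<delta>} x * (norm (e x))\<^sup>2 \<partial>M)
      \<le> C' * \<delta>\<^sup>2 * (\<integral>x. indicator {x \<in> K. p \<bullet> x + q < \<delta>} x * (norm (G x))\<^sup>2 \<partial>M)"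
    by (rule layer_limit[OF u e G tr z crn face_of_vertices[OF T S]]) blast+
  have "(\<integral>x. (norm (e x))\<^sup>2 \<partial>M) \<le> 0"
    using C'(2)[of 1] unfolding integral_indicator_whole[OF crn] G0 by simp
  moreover have "0 \<le> (\<integral>x. (norm (e x))\<^sup>2 \<partial>M)" by simp
  ultimately have "(\<integral>x. (norm (e x))\<^sup>2 \<partial>M) = 0" by linarith
  then have "AE x in M. (norm (e x))\<^sup>2 = 0"
    using integral_nonneg_eq_0_iff_AE[OF L2_integrable[OF Le]] by simp
  then show ?thesis by eventually_elim simp
qed

end

section \<open>Unisolvence\<close>

text \<open>The gradients are returned as well, because those hidden in \<open>has_trace\<close>
  need not coincide pointwise with the ones for which a weak equation is known.\<close>

lemma has_trace_diff:
  assumes "has_trace K v g" "has_trace K w h"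
  obtains u G G' where "weak_grad K v G" "weak_grad K w G'" "\<And>n. smooth (u n)"
    "L2_tendsto (lebesgue_on K) u (\<lambda>x. w x - v x)" "L2_tendsto (lebesgue_on K) (\<lambda>n. grad (u n)) (\<lambda>x. G' x - G x)"
    "\<And>a b c. (convex hull {a, b, c}) facet_of closure K \<Longrightarrow> L2_tendsto (triangle_measure a b c) u (\<lambda>x. h x - g x)"
proof -
  obtain u G where u: "weak_grad K v G" "\<And>n. smooth (u n)" "L2_tendsto (lebesgue_on K) u v"
     "L2_tendsto (lebesgue_on K) (\<lambda>n. grad (u n)) G"
     "\<And>a b c. (convex hull {a, b, c}) facet_of closure K \<Longrightarrow> L2_tendsto (triangle_measure a b c) u g"
    using assms(1) unfolding has_trace_def by blast
  obtain u' G' where u': "weak_grad K w G'" "\<And>n. smooth (u' n)" "L2_tendsto (lebesgue_on K) u' w"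
     "L2_tendsto (lebesgue_on K) (\<lambda>n. grad (u' n)) G'"
     "\<And>a b c. (convex hull {a, b, c}) facet_of closure K \<Longrightarrow> L2_tendsto (triangle_measure a b c) u' h"
    using assms(2) unfolding has_trace_def by blast
  let ?d = "\<lambda>n x. u' n x - u n x"
  have gd: "grad (?d n) = (\<lambda>x. grad (u' n) x - grad (u n) x)" for n
    by (rule ext, rule grad_diff[OF u'(2) u(2)])
  show ?thesis
  proof (rule that[OF u(1) u'(1)])
    show "smooth (?d n)" for n by (intro smooth_diff u(2) u'(2))
    show "L2_tendsto (lebesgue_on K) ?d (\<lambda>x. w x - v x)" by (rule L2_tendsto_diff[OF u'(3) u(3)])
    show "L2_tendsto (lebesgue_on K) (\<lambda>n. grad (?d n)) (\<lambda>x. G' x - G x)"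
      unfolding gd by (rule L2_tendsto_diff[OF u'(4) u(4)])
    show "L2_tendsto (triangle_measure a b c) ?d (\<lambda>x. h x - g x)" if "(convex hull {a, b, c}) facet_of closure K" for a b c
      by (rule L2_tendsto_diff[OF u'(5)[OF that] u(5)[OF that]])
  qed
qed

context weighted_tetrahedron
begin

lemma V_space_exists:
  assumes F: "triangulated_boundary K \<F>"
  shows "\<exists>v\<in>V_space b K \<F>. \<forall>z\<in>nodes \<F>. boundary_value K v z = a z"
proof -
  obtain f L where f: "0 \<le> L" "\<And>x y. \<bar>f x - f y\<bar> \<le> L * norm (x - y)"
    "\<And>z. z \<in> nodes \<F> \<Longrightarrow> f z = a z" "f \<in> B_space K \<F>"
    by (rule nodal_interpolant[OF T F, of a]) blast
  obtain u v G where u: "\<And>n. smooth (u n)" "L2_tendsto M u v" "L2_tendsto M (\<lambda>n. grad (u n)) G"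
    "\<And>a1 a2 a3. (convex hull {a1, a2, a3}) facet_of closure K \<Longrightarrow> L2_tendsto (triangle_measure a1 a2 a3) u f"
    "\<And>\<phi>. test_function K \<phi> \<Longrightarrow> energy G (grad \<phi>) = 0"
    by (rule minimizer[OF f(1,2)]) blast
  have wg: "weak_grad K v G" by (rule weak_grad_limit[OF oK bK u(1-3)])
  have wd: "weak_div K (\<lambda>x. b x *\<^sub>R G x) (\<lambda>x. 0)"
    unfolding weak_div_def
  proof (intro conjI allI impI)
    show "L2 M (\<lambda>x. b x *\<^sub>R G x)" by (rule weight_L2[OF L2_tendstoD(2)[OF u(3)]])
    show "L2 M (\<lambda>x. 0 :: real)" by (simp add: L2_def)
    fix \<phi> assume "test_function K \<phi>"
    then show "(\<integral>x. (b x *\<^sub>R G x) \<bullet> grad \<phi> x \<partial>M) = - (\<integral>x. 0 * \<phi> x \<partial>M)"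
      using u(5) by (simp add: energy_def)
  qed
  have tr: "has_trace K v f" unfolding has_trace_def using wg u(1-4) by blast
  have "v \<in> H1 K" using wg unfolding H1_def by blast
  moreover have "(\<lambda>x. b x *\<^sub>R G x) \<in> Hdiv K" using wd unfolding Hdiv_def by blast
  ultimately have "v \<in> V_space b K \<F>" unfolding V_space_def using wg wd tr f(4) by blast
  moreover have "boundary_value K v z = a z" if z: "z \<in> nodes \<F>" for z
  proof -
    obtain T' where T': "T' \<in> \<F>" "z extreme_point_of T'" using z unfolding nodes_def by blast
    then have "z \<in> frontier K"
      using triangulated_boundary_frontier(1)[OF T F T'(1)] unfolding extreme_point_of_def by blast
    moreover have "continuous_on (frontier K) f" using f(4) unfolding B_space_def by blast
    ultimately show ?thesis using boundary_value_eq[OF T tr] f(3)[OF z] by simp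
  qed
  ultimately show ?thesis by blast
qed

lemma V_space_unique:
  assumes F: "triangulated_boundary K \<F>"
    and v: "v \<in> V_space b K \<F>" and w: "w \<in> V_space b K \<F>"
    and eq: "\<And>z. z \<in> nodes \<F> \<Longrightarrow> boundary_value K v z = boundary_value K w z"
  shows "AE x in M. w x = v x"
proof -
  obtain Gv g where gv: "weak_grad K v Gv" "weak_div K (\<lambda>x. b x *\<^sub>R Gv x) (\<lambda>x. 0)" "g \<in> B_space K \<F>" "has_trace K v g"
    using v unfolding V_space_def by blast
  obtain Gw h where gw: "weak_grad K w Gw" "weak_div K (\<lambda>x. b x *\<^sub>R Gw x) (\<lambda>x. 0)" "h \<in> B_space K \<F>" "has_trace K w h"
    using w unfolding V_space_def by blast
  have c: "continuous_on (frontier K) g" "continuous_on (frontier K) h"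
    using gv(3) gw(3) unfolding B_space_def by blast+
  have gh: "g x = h x" if x: "x \<in> frontier K" for x
  proof (rule B_space_unique[OF T F gv(3) gw(3) _ x])
    fix z assume z: "z \<in> nodes \<F>"
    then obtain T' where T': "T' \<in> \<F>" "z extreme_point_of T'" unfolding nodes_def by blast
    then have zf: "z \<in> frontier K"
      using triangulated_boundary_frontier(1)[OF T F T'(1)] unfolding extreme_point_of_def by blast
    show "g z = h z"
      using eq[OF z] boundary_value_eq[OF T gv(4) c(1) zf] boundary_value_eq[OF T gw(4) c(2) zf] by simp
  qed
  obtain u G G' where u: "weak_grad K v G" "weak_grad K w G'" "\<And>n. smooth (u n)"
    "L2_tendsto M u (\<lambda>x. w x - v x)" "L2_tendsto M (\<lambda>n. grad (u n)) (\<lambda>x. G' x - G x)"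
    "\<And>a b c. (convex hull {a, b, c}) facet_of closure K \<Longrightarrow> L2_tendsto (triangle_measure a b c) u (\<lambda>x. h x - g x)"
    by (rule has_trace_diff[OF gv(4) gw(4)]) blast
  have LG: "L2 M G" "L2 M G'" "L2 M Gv" "L2 M Gw" using u(1,2) gv(1) gw(1) unfolding weak_grad_def by blast+
  \<comment> \<open>The weak equation holds for the gradients from \<open>V_space\<close>, while the
    approximants converge to those from \<open>has_trace\<close>; uniqueness of weak gradients
    transfers the equation.\<close>
  have AEv: "AE x in M. Gv x = G x" by (rule tetrahedron_weak_grad_unique[OF T gv(1) u(1)])
  have AEw: "AE x in M. Gw x = G' x" by (rule tetrahedron_weak_grad_unique[OF T gw(1) u(2)])
  have "AE x in M. w x - v x = 0"
  proof (rule energy_zero[OF u(3-6)])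
    show "h x - g x = 0" if "x \<in> frontier K" for x using gh[OF that] by simp
    fix \<phi> assume phi: "test_function K \<phi>"
    have Lp: "L2 M (grad \<phi>)" by (rule L2_smooth_grad[OF oK bK test_function_smooth[OF phi]])
    have "energy Gv (grad \<phi>) = 0" "energy Gw (grad \<phi>) = 0"
      using gv(2) gw(2) phi unfolding weak_div_def energy_def by simp_all
    moreover have "energy Gv (grad \<phi>) = energy G (grad \<phi>)" unfolding energy_def
      by (rule integral_cong_AE) (use AEv energy_integrable[OF LG(3) Lp] energy_integrable[OF LG(1) Lp] in auto)
    moreover have "energy Gw (grad \<phi>) = energy G' (grad \<phi>)" unfolding energy_def
      by (rule integral_cong_AE) (use AEw energy_integrable[OF LG(4) Lp] energy_integrable[OF LG(2) Lp] in auto)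
    moreover have "energy (\<lambda>x. G' x - G x) (grad \<phi>) = energy G' (grad \<phi>) - energy G (grad \<phi>)"
      unfolding energy_def inner_diff_left right_diff_distrib
      by (rule Bochner_Integration.integral_diff[OF energy_integrable[OF LG(2) Lp] energy_integrable[OF LG(1) Lp]])
    ultimately show "energy (\<lambda>x. G' x - G x) (grad \<phi>) = 0" by simp
  qed
  then show ?thesis by eventually_elim simp
qed

end

section \<open>From the mesh and the interface to a single weighted tetrahedron\<close>

lemma mesh_tetrahedron:
  assumes "tetrahedral_mesh \<Omega> \<T>" "K \<in> \<T>"
  obtains S where "tetrahedron K S" "K \<subseteq> \<Omega>"
proof -
  have "3 simplex (closure K)" and K: "K = interior (closure K)" and sub: "K \<subseteq> \<Omega>"
    using assms unfolding tetrahedral_mesh_def by blast+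
  then obtain S where S: "\<not> affine_dependent S" "int (card S) = 3 + 1" "closure K = convex hull S"
    unfolding simplex_def by blast
  have "K = interior (convex hull S)" using K unfolding S(3) .
  moreover have "card S = 4" using S(2) by simp
  ultimately have "tetrahedron K S" using S(1,3) unfolding tetrahedron_def by blast
  then show ?thesis using sub by (rule that)
qed

text \<open>\<beta> is prescribed only off the frontier of \<open>\<Omega>m\<close>. Outside this
  null set it agrees on \<open>K\<close> with a two-valued Borel function, which yields
  measurability and the bounds almost everywhere.\<close>

lemma piecewise_constant_weight:
  fixes \<beta> :: "R3 \<Rightarrow> real"
  assumes "open \<Omega>m" "Ck_surface k (frontier \<Omega>m)" "1 \<le> k" "0 < \<beta>m" "0 < \<beta>p"
    and "\<And>x. x \<in> \<Omega>m \<Longrightarrow> \<beta> x = \<beta>m" "\<And>x. x \<in> \<Omega> - closure \<Omega>m \<Longrightarrow> \<beta> x = \<beta>p"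
    and K: "tetrahedron K S" "K \<subseteq> \<Omega>"
  shows "weighted_tetrahedron K S \<beta> (min \<beta>m \<beta>p) (max \<beta>m \<beta>p)"
proof -
  have N: "negligible (frontier \<Omega>m)" by (rule Ck_surface_negligible[OF assms(2,3)]) simp
  have oK: "open K" by (rule tetrahedron_facts(1)[OF K(1)])
  define f where "f x = (if x \<in> \<Omega>m then \<beta>m else \<beta>p)" for x
  have fm: "f \<in> borel_measurable (lebesgue_on K)"
    unfolding f_def[abs_def] using assms(1)
    by (intro measurable_restrict_space1 measurable_completion) auto
  have eq: "f x = \<beta> x" if "x \<in> K - frontier \<Omega>m" for x
  proof (cases "x \<in> \<Omega>m")
    case True then show ?thesis using assms(6) by (simp add: f_def)
  next
    case False
    then have "x \<notin> closure \<Omega>m" using that interior_open[OF assms(1)] by (simp add: frontier_def)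
    then show ?thesis using assms(7)[of x] that K(2) False by (auto simp: f_def)
  qed
  have bm: "\<beta> \<in> borel_measurable (lebesgue_on K)"
    by (rule measurable_off_negligible[OF N _ fm eq]) (use oK in simp)
  have "AE x in lebesgue. x \<notin> frontier \<Omega>m"
    using N unfolding negligible_iff_null_sets by (rule AE_not_in)
  then have "AE x in lebesgue. x \<in> K \<longrightarrow> min \<beta>m \<beta>p \<le> \<beta> x \<and> \<beta> x \<le> max \<beta>m \<beta>p"
  proof eventually_elim
    case (elim x)
    then show ?case using eq[of x] by (auto simp: f_def split: if_splits)
  qed
  then have bb: "AE x in lebesgue_on K. min \<beta>m \<beta>p \<le> \<beta> x \<and> \<beta> x \<le> max \<beta>m \<beta>p"
    using oK by (subst AE_restrict_space_iff) auto
  show ?thesis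
    by (rule weighted_tetrahedron.intro[OF K(1) bm _ bb]) (use assms(4,5) in simp)
qed

theorem lemma5p1:
  fixes \<Omega> \<Omega>m \<Omega>p \<Gamma> K :: "(real^3) set"
    and \<beta> :: "real^3 \<Rightarrow> real"
    and \<beta>m \<beta>p \<sigma> \<theta> C :: real
    and k :: nat
    and \<T> \<F> :: "(real^3) set set"
  assumes "open \<Omega>" "connected \<Omega>" "bounded \<Omega>"
    and "open \<Omega>m" "connected \<Omega>m" "\<Omega>m \<noteq> {}" "\<Omega>m \<subseteq> \<Omega>"
    and "\<Omega>p = \<Omega> - closure \<Omega>m"
    and "\<Gamma> = frontier \<Omega>m" "1 \<le> k" "Ck_surface k \<Gamma>"
    and "0 < \<beta>m" "0 < \<beta>p"
    and "\<And>x. x \<in> \<Omega>m \<Longrightarrow> \<beta> x = \<beta>m" "\<And>x. x \<in> \<Omega>p \<Longrightarrow> \<beta> x = \<beta>p"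
    and "tetrahedral_mesh \<Omega> \<T>" "shape_regular \<sigma> \<T>"
    and "K \<in> \<T>" "K \<inter> \<Gamma> \<noteq> {}"
    and "\<theta> < pi" "boundary_triangulation \<Gamma> \<theta> C K \<F>"
  shows "\<forall>a :: real^3 \<Rightarrow> real.
    (\<exists>v\<in>V_space \<beta> K \<F>. (\<forall>z\<in>nodes \<F>. boundary_value K v z = a z) \<and>
       (\<forall>w\<in>V_space \<beta> K \<F>. (\<forall>z\<in>nodes \<F>. boundary_value K w z = a z) \<longrightarrow>
          (AE x in lebesgue_on K. w x = v x)))"
proof
  fix a :: "real^3 \<Rightarrow> real"
  obtain S where K: "tetrahedron K S" "K \<subseteq> \<Omega>"
    by (rule mesh_tetrahedron[OF \<open>tetrahedral_mesh \<Omega> \<T>\<close> \<open>K \<in> \<T>\<close>])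
  have "weighted_tetrahedron K S \<beta> (min \<beta>m \<beta>p) (max \<beta>m \<beta>p)"
  proof (rule piecewise_constant_weight[where \<Omega>m=\<Omega>m and k=k and \<Omega>=\<Omega>])
    show "Ck_surface k (frontier \<Omega>m)" using assms by simp
    show "\<beta> x = \<beta>p" if "x \<in> \<Omega> - closure \<Omega>m" for x using that assms by simp
  qed (use assms K in auto)
  then interpret weighted_tetrahedron K S \<beta> "min \<beta>m \<beta>p" "max \<beta>m \<beta>p" .
  have F: "triangulated_boundary K \<F>"
    by (rule boundary_triangulation_boundary[OF \<open>boundary_triangulation \<Gamma> \<theta> C K \<F>\<close>])
  obtain v where "v \<in> V_space \<beta> K \<F>" "\<forall>z\<in>nodes \<F>. boundary_value K v z = a z"
    using V_space_exists[OF F] by blast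
  then show "\<exists>v\<in>V_space \<beta> K \<F>. (\<forall>z\<in>nodes \<F>. boundary_value K v z = a z) \<and>
       (\<forall>w\<in>V_space \<beta> K \<F>. (\<forall>z\<in>nodes \<F>. boundary_value K w z = a z) \<longrightarrow>
          (AE x in lebesgue_on K. w x = v x))"
    using V_space_unique[OF F] by (intro bexI[of _ v]) auto
qed

end
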